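(* Let $S$ be a closed oriented surface with a smooth Riemannian metric $g$, let $h:S\to(0,\infty)$ be smooth and let $\tilde g=h^2g$. Let $\psi$ be a stream function with zero background vorticity having a unit vortex at $s_o\in S$. Then the $\tilde g$-regularized stream function of the vortex is obtained by subtracting $\frac{\log h}{2\pi}$ from its $g$-regularized stream function: $$\lim_{s\to s_o}\left(\psi(s)-\frac{\log d_{\tilde g}(s,s_o)}{2\pi}\right)=\lim_{s\to s_o}\left(\psi(s)-\frac{\log d_g(s,s_o)}{2\pi}\right)-\frac{\log h(s_o)}{2\pi}.$$
   Context: $d_g$ and $d_{\tilde g}$ are the geodesic distances of $g$ and $\tilde g$. A stream function with zero background vorticity having a unit vortex at $s_o$ means a real function $\psi$ which is harmonic on $S$ minus a finite set of points (the vortices, one of which is $s_o$), and for which $\psi(s)-\frac{1}{2\pi}\log d_g(s,s_o)$ is bounded near $s_o$. Harmonicity depends only on the conformal class of $g$, because $\Delta_{h^2g}=h^{-2}\Delta_g$. The $g$-regularized stream function at the vortex $s_o$ is the value $\lim_{s\to s_o}\left(\psi(s)-\frac{1}{2\pi}\log d_g(s,s_o)\right)$, and similarly for $\tilde g$. *)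

theory Defs
  imports "HOL-Analysis.Analysis"
begin

section \<open>Smooth maps between Euclidean domains\<close>

text \<open>Only meant for open domains \<open>U\<close>: the derivatives are full (two-sided) ones.\<close>

primrec Ck_on ::
  "nat \<Rightarrow> ('e::real_normed_vector \<Rightarrow> 'f::real_normed_vector) \<Rightarrow> 'e set \<Rightarrow> bool" where
  "Ck_on 0 f U \<longleftrightarrow> continuous_on U f"
| "Ck_on (Suc k) f U \<longleftrightarrow> (\<forall>x\<in>U. f differentiable (at x)) \<and>
     (\<forall>v. Ck_on k (\<lambda>x. frechet_derivative f (at x) v) U)"

definition smooth_on ::
  "('e::real_normed_vector \<Rightarrow> 'f::real_normed_vector) \<Rightarrow> 'e set \<Rightarrow> bool" where
  "smooth_on f U \<longleftrightarrow> (\<forall>k. Ck_on k f U)"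


section \<open>Oriented smooth surfaces\<close>

text \<open>A chart is a pair of its domain and its coordinate map; outside the domain the values of the
  coordinate map are irrelevant.\<close>

type_synonym 'a chart = "'a set \<times> ('a \<Rightarrow> real^2)"

definition is_chart :: "'a::topological_space set \<Rightarrow> 'a chart \<Rightarrow> bool" where
  "is_chart S c \<longleftrightarrow> openin (top_of_set S) (fst c) \<and> open (snd c ` fst c) \<and>
     homeomorphism (fst c) (snd c ` fst c) (snd c) (inv_into (fst c) (snd c))"

definition chart_repr :: "'a chart \<Rightarrow> ('a \<Rightarrow> 'b) \<Rightarrow> real^2 \<Rightarrow> 'b" where
  "chart_repr c f = f \<circ> inv_into (fst c) (snd c)"

definition transition :: "'a chart \<Rightarrow> 'a chart \<Rightarrow> real^2 \<Rightarrow> real^2" where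
  "transition c c' = chart_repr c (snd c')"

definition jacobian_matrix :: "(real^2 \<Rightarrow> real^2) \<Rightarrow> real^2 \<Rightarrow> real^2^2" where
  "jacobian_matrix f x = matrix (frechet_derivative f (at x))"

definition oriented_surface :: "'a::t2_space set \<Rightarrow> 'a chart set \<Rightarrow> bool" where
  "oriented_surface S A \<longleftrightarrow>
     (\<forall>c\<in>A. is_chart S c) \<and> (\<Union>c\<in>A. fst c) = S \<and>
     (\<forall>c\<in>A. \<forall>c'\<in>A. smooth_on (transition c c') (snd c ` (fst c \<inter> fst c')) \<and>
        (\<forall>x\<in>snd c ` (fst c \<inter> fst c'). det (jacobian_matrix (transition c c') x) > 0))"

text \<open>Second countability follows from compactness. Connectedness is not required.\<close>

definition closed_oriented_surface :: "'a::t2_space set \<Rightarrow> 'a chart set \<Rightarrow> bool" where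
  "closed_oriented_surface S A \<longleftrightarrow> oriented_surface S A \<and> compact S"

definition smooth_function :: "'a chart set \<Rightarrow> ('a \<Rightarrow> real) \<Rightarrow> bool" where
  "smooth_function A f \<longleftrightarrow> (\<forall>c\<in>A. smooth_on (chart_repr c f) (snd c ` fst c))"


section \<open>Riemannian metrics\<close>

text \<open>A metric is given by its Gram matrices \<open>g c p\<close> with respect to the coordinate frame of the
  chart \<open>c\<close> at the point \<open>p\<close>.\<close>

type_synonym 'a metric_field = "'a chart \<Rightarrow> 'a \<Rightarrow> real^2^2"

definition riemannian_metric :: "'a chart set \<Rightarrow> 'a metric_field \<Rightarrow> bool" where
  "riemannian_metric A g \<longleftrightarrow>
     (\<forall>c\<in>A. smooth_on (chart_repr c (g c)) (snd c ` fst c) \<and>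
        (\<forall>p\<in>fst c. transpose (g c p) = g c p \<and> (\<forall>v. v \<noteq> 0 \<longrightarrow> v \<bullet> (g c p *v v) > 0))) \<and>
     (\<forall>c\<in>A. \<forall>c'\<in>A. \<forall>p\<in>fst c \<inter> fst c'.
        g c p = transpose (jacobian_matrix (transition c c') (snd c p)) ** g c' p **
                jacobian_matrix (transition c c') (snd c p))"

definition conformal_metric :: "('a \<Rightarrow> real) \<Rightarrow> 'a metric_field \<Rightarrow> 'a metric_field" where
  "conformal_metric h g = (\<lambda>c p. (h p)\<^sup>2 *\<^sub>R g c p)"


section \<open>Geodesic distance\<close>

definition C1_segment :: "'a::topological_space chart set \<Rightarrow> (real \<Rightarrow> 'a) \<Rightarrow> real \<Rightarrow> real \<Rightarrow> bool" where
  "C1_segment A \<gamma> a b \<longleftrightarrow>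
     (\<forall>c\<in>A. \<exists>v. (\<forall>t\<in>{a..b} \<inter> \<gamma> -` fst c.
                    ((snd c \<circ> \<gamma>) has_vector_derivative v t) (at t within {a..b})) \<and>
                continuous_on ({a..b} \<inter> \<gamma> -` fst c) v)"

text \<open>One-sided derivatives at the break points are part of the definition, so that the speed is
  bounded and integrable.\<close>

definition piecewise_C1_path :: "'a::topological_space set \<Rightarrow> 'a chart set \<Rightarrow> (real \<Rightarrow> 'a) \<Rightarrow> bool" where
  "piecewise_C1_path S A \<gamma> \<longleftrightarrow> path \<gamma> \<and> path_image \<gamma> \<subseteq> S \<and>
     (\<exists>P. finite P \<and> {0, 1} \<subseteq> P \<and> P \<subseteq> {0..1} \<and>
        (\<forall>a\<in>P. \<forall>b\<in>P. a < b \<and> {a<..<b} \<inter> P = {} \<longrightarrow> C1_segment A \<gamma> a b))"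

text \<open>The value does not depend on the chart selected, by the transformation law of the metric.
  It is unspecified at the finitely many times where the path is not differentiable.\<close>

definition speed :: "'a chart set \<Rightarrow> 'a metric_field \<Rightarrow> (real \<Rightarrow> 'a) \<Rightarrow> real \<Rightarrow> real" where
  "speed A g \<gamma> t =
     (let c = (SOME c. c \<in> A \<and> \<gamma> t \<in> fst c); v = vector_derivative (snd c \<circ> \<gamma>) (at t)
      in sqrt (v \<bullet> (g c (\<gamma> t) *v v)))"

definition riemannian_length :: "'a chart set \<Rightarrow> 'a metric_field \<Rightarrow> (real \<Rightarrow> 'a) \<Rightarrow> real" where
  "riemannian_length A g \<gamma> = integral {0..1} (speed A g \<gamma>)"

text \<open>Unspecified when the two points lie in different components.\<close>

definition geodesic_dist ::
  "'a::topological_space set \<Rightarrow> 'a chart set \<Rightarrow> 'a metric_field \<Rightarrow> 'a \<Rightarrow> 'a \<Rightarrow> real" where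
  "geodesic_dist S A g p q =
     Inf {riemannian_length A g \<gamma> |\<gamma>.
            piecewise_C1_path S A \<gamma> \<and> pathstart \<gamma> = p \<and> pathfinish \<gamma> = q}"


section \<open>Harmonic functions and stream functions\<close>

definition partial_deriv :: "2 \<Rightarrow> (real^2 \<Rightarrow> real) \<Rightarrow> real^2 \<Rightarrow> real" where
  "partial_deriv i f x = frechet_derivative f (at x) (axis i 1)"

definition laplace_beltrami_coord ::
  "(real^2 \<Rightarrow> real^2^2) \<Rightarrow> (real^2 \<Rightarrow> real) \<Rightarrow> real^2 \<Rightarrow> real" where
  "laplace_beltrami_coord G f x =
     (\<Sum>i\<in>UNIV. partial_deriv i
        (\<lambda>y. sqrt (det (G y)) * (\<Sum>j\<in>UNIV. matrix_inv (G y) $ i $ j * partial_deriv j f y)) x)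
     / sqrt (det (G x))"

definition harmonic_on :: "'a chart set \<Rightarrow> 'a metric_field \<Rightarrow> 'a set \<Rightarrow> ('a \<Rightarrow> real) \<Rightarrow> bool" where
  "harmonic_on A g W f \<longleftrightarrow>
     (\<forall>c\<in>A. Ck_on 2 (chart_repr c f) (snd c ` (fst c \<inter> W)) \<and>
        (\<forall>x\<in>snd c ` (fst c \<inter> W).
           laplace_beltrami_coord (chart_repr c (g c)) (chart_repr c f) x = 0))"

text \<open>\<open>V\<close> is the set of vortices. Nothing is prescribed about the singularities other than \<open>s\<^sub>o\<close>.\<close>

definition unit_vortex_stream_function ::
  "'a::t2_space set \<Rightarrow> 'a chart set \<Rightarrow> 'a metric_field \<Rightarrow> 'a \<Rightarrow> ('a \<Rightarrow> real) \<Rightarrow> bool" where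
  "unit_vortex_stream_function S A g s\<^sub>o \<psi> \<longleftrightarrow>
     (\<exists>V. finite V \<and> V \<subseteq> S \<and> s\<^sub>o \<in> V \<and> harmonic_on A g (S - V) \<psi>) \<and>
     Bfun (\<lambda>s. \<psi> s - ln (geodesic_dist S A g s s\<^sub>o) / (2 * pi)) (at s\<^sub>o within S)"

definition regularized_stream_function ::
  "'a::t2_space set \<Rightarrow> 'a chart set \<Rightarrow> 'a metric_field \<Rightarrow> 'a \<Rightarrow> ('a \<Rightarrow> real) \<Rightarrow> real" where
  "regularized_stream_function S A g s\<^sub>o \<psi> =
     Lim (at s\<^sub>o within S) (\<lambda>s. \<psi> s - ln (geodesic_dist S A g s s\<^sub>o) / (2 * pi))"

end

theory Submission
  imports Defs
begin

text \<open>
  Near the vortex everything can be read off in one chart. Let \<open>N(s)\<close> be the length of the coordinate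
  displacement from \<open>s\<^sub>o\<close> to \<open>s\<close>, measured with the Gram matrix of the metric at \<open>s\<^sub>o\<close>. Then
  \<open>d\<^sub>g(s, s\<^sub>o) / N(s)\<close> tends to \<open>1\<close> (\<open>geodesic_dist_asymptotics\<close>), and passing from \<open>g\<close> to \<open>h\<^sup>2 g\<close>
  multiplies \<open>N\<close> by the constant \<open>h(s\<^sub>o)\<close>. So the formula follows, with both limits, once
  \<open>\<psi> - ln N / (2 pi)\<close> is known to converge at \<open>s\<^sub>o\<close>
  (\<open>stream_function_coordinate_limit\<close>).

  This convergence is the analytic part. In isothermal coordinates it is the removability of an
  isolated singularity of a bounded harmonic function. The proof below takes an arbitrary
  chart instead and works with the operator \<open>L = div (a grad)\<close>, where \<open>a = sqrt (det G) G^(-1)\<close> for the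
  Gram matrix \<open>G\<close>. After a linear change of coordinates and a rescaling, \<open>a\<close> is the identity at the origin
  and \<open>L ln |x| = O(1/|x|)\<close>, so \<open>u = \<psi> - ln |x| / (2 pi)\<close> is bounded with \<open>L u = O(1/|x|)\<close>. Two facts
  force \<open>u\<close> to converge (\<open>has_limit\<close>).

  The first is an energy argument. Let \<open>m(r)\<close> be the integral of \<open>|grad u|\<close> over the circle of radius
  \<open>r\<close>, and \<open>J(r)\<close> the flux of \<open>u a grad u\<close> through it. The divergence theorem and the Cauchy-Schwarz
  inequality give \<open>J' \<ge> c m\<^sup>2 / r - C\<close>, while \<open>|J| \<le> K m\<close>. If \<open>m \<ge> \<delta> > 0\<close> held for all small \<open>r\<close>,
  then \<open>J\<close> would tend to minus infinity as \<open>r\<close> decreases, and the Riccati inequality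
  \<open>J' \<ge> k J\<^sup>2 / r\<close> would make it infinite already at a positive radius (\<open>no_blow_up\<close>). Hence there are
  arbitrarily small circles on which \<open>u\<close> has arbitrarily small oscillation
  (\<open>small_total_variation\<close>).

  The second is the maximum principle. Since \<open>L |x| \<ge> 1 / (2|x|)\<close>, both \<open>u\<close> and \<open>-u\<close> become strict
  subsolutions after a suitable multiple of \<open>|x|\<close> is added. On the annulus between two such circles
  the values of \<open>u\<close> are therefore squeezed between its boundary values, up to an error of the order of
  the outer radius (\<open>annulus_bound\<close>).

  The asymptotics of the distance compare lengths in a small coordinate ball in which the metric is
  nearly constant. The straight segment bounds the distance from above; a path is bounded from below by
  its part after the last entry into the ball on whose boundary it starts.
\<close>

section \<open>Calculus of continuously differentiable maps\<close>

lemma Ck_on_1I: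
  assumes "\<And>x. x \<in> U \<Longrightarrow> (f has_derivative f' x) (at x)"
    and "\<And>v. continuous_on U (\<lambda>x. f' x v)"
  shows "Ck_on 1 f U"
proof -
  have "continuous_on U (\<lambda>x. frechet_derivative f (at x) v)" for v
    using assms(2)[of v]
    by (rule continuous_on_eq) (use frechet_derivative_at[OF assms(1)] in metis)
  then show ?thesis
    using assms(1) by (auto simp: differentiable_def)
qed

lemma Ck_on_1_has_derivative:
  "Ck_on 1 f U \<Longrightarrow> x \<in> U \<Longrightarrow> (f has_derivative frechet_derivative f (at x)) (at x)"
  by (simp add: frechet_derivative_works)

lemma Ck_on_1_continuous_derivative:
  "Ck_on 1 f U \<Longrightarrow> continuous_on U (\<lambda>x. frechet_derivative f (at x) v)"
  by simp

lemma Ck_on_1_continuous_on: "Ck_on 1 f U \<Longrightarrow> continuous_on U f"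
  by (meson Ck_on_1_has_derivative continuous_at_imp_continuous_on has_derivative_continuous)

lemma Ck_on_subset: "Ck_on k f U \<Longrightarrow> V \<subseteq> U \<Longrightarrow> Ck_on k f V"
  by (induction k arbitrary: f) (auto intro: continuous_on_subset)

lemma Ck_on_1_bounded_linear:
  assumes "bounded_linear L" "Ck_on 1 f U"
  shows "Ck_on 1 (\<lambda>x. L (f x)) U"
proof (rule Ck_on_1I[where f' = "\<lambda>x v. L (frechet_derivative f (at x) v)"])
  show "((\<lambda>x. L (f x)) has_derivative (\<lambda>v. L (frechet_derivative f (at x) v))) (at x)" if "x \<in> U" for x
    by (rule bounded_linear.has_derivative[OF assms(1) Ck_on_1_has_derivative[OF assms(2) that]])
  show "continuous_on U (\<lambda>x. L (frechet_derivative f (at x) v))" for v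
    by (rule bounded_linear.continuous_on[OF assms(1) Ck_on_1_continuous_derivative[OF assms(2)]])
qed

lemma Ck_on_1_bilinear:
  assumes "bounded_bilinear B" "Ck_on 1 f U" "Ck_on 1 g U"
  shows "Ck_on 1 (\<lambda>x. B (f x) (g x)) U"
proof (rule Ck_on_1I[where f' = "\<lambda>x v. B (f x) (frechet_derivative g (at x) v) +
                                       B (frechet_derivative f (at x) v) (g x)"])
  show "((\<lambda>x. B (f x) (g x)) has_derivative (\<lambda>v. B (f x) (frechet_derivative g (at x) v) +
          B (frechet_derivative f (at x) v) (g x))) (at x)" if "x \<in> U" for x
    by (rule bounded_bilinear.FDERIV[OF assms(1) Ck_on_1_has_derivative[OF assms(2) that]
          Ck_on_1_has_derivative[OF assms(3) that]])
  show "continuous_on U (\<lambda>x. B (f x) (frechet_derivative g (at x) v) +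
          B (frechet_derivative f (at x) v) (g x))" for v
    by (intro continuous_intros bounded_bilinear.continuous_on[OF assms(1)]
        Ck_on_1_continuous_on[OF assms(2)] Ck_on_1_continuous_on[OF assms(3)]
        Ck_on_1_continuous_derivative[OF assms(2)] Ck_on_1_continuous_derivative[OF assms(3)])
qed

lemma Ck_on_1_add:
  assumes "Ck_on 1 f U" "Ck_on 1 g U"
  shows "Ck_on 1 (\<lambda>x. f x + g x) U"
proof (rule Ck_on_1I[where f' = "\<lambda>x v. frechet_derivative f (at x) v + frechet_derivative g (at x) v"])
  show "((\<lambda>x. f x + g x) has_derivative
      (\<lambda>v. frechet_derivative f (at x) v + frechet_derivative g (at x) v)) (at x)" if "x \<in> U" for x
    by (intro has_derivative_add Ck_on_1_has_derivative[OF assms(1) that]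
        Ck_on_1_has_derivative[OF assms(2) that])
  show "continuous_on U (\<lambda>x. frechet_derivative f (at x) v + frechet_derivative g (at x) v)" for v
    by (intro continuous_on_add Ck_on_1_continuous_derivative[OF assms(1)]
        Ck_on_1_continuous_derivative[OF assms(2)])
qed

lemma Ck_on_1_compose_real:
  fixes f :: "'e::real_normed_vector \<Rightarrow> real"
  assumes "Ck_on 1 f U" "\<And>x. x \<in> U \<Longrightarrow> (\<phi> has_real_derivative \<phi>' (f x)) (at (f x))"
    and "continuous_on (f ` U) \<phi>'"
  shows "Ck_on 1 (\<lambda>x. \<phi> (f x)) U"
proof (rule Ck_on_1I[where f' = "\<lambda>x v. frechet_derivative f (at x) v * \<phi>' (f x)"])
  show "((\<lambda>x. \<phi> (f x)) has_derivative (\<lambda>v. frechet_derivative f (at x) v * \<phi>' (f x))) (at x)"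
    if "x \<in> U" for x
    using has_derivative_compose[OF Ck_on_1_has_derivative[OF assms(1) that]
        assms(2)[OF that, unfolded has_field_derivative_def]]
    by (simp add: mult.commute)
  show "continuous_on U (\<lambda>x. frechet_derivative f (at x) v * \<phi>' (f x))" for v
    by (intro continuous_intros continuous_on_compose2[OF assms(3)]
        Ck_on_1_continuous_on[OF assms(1)] Ck_on_1_continuous_derivative[OF assms(1)]) auto
qed

lemma Ck_on_cong:
  assumes "open U" "Ck_on k f U" "\<And>x. x \<in> U \<Longrightarrow> f x = g x"
  shows "Ck_on k g U"
  using assms(2,3)
proof (induction k arbitrary: f g)
  case 0
  then show ?case by (auto cong: continuous_on_cong)
next
  case (Suc k)
  have hd: "(g has_derivative frechet_derivative f (at x)) (at x)" if "x \<in> U" for x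
    using Suc.prems that assms(1)
    by (auto simp: frechet_derivative_works intro: has_derivative_transform_within_open)
  have eq: "frechet_derivative f (at x) v = frechet_derivative g (at x) v" if "x \<in> U" for x v
    using frechet_derivative_at[OF hd[OF that]] by metis
  have "Ck_on k (\<lambda>x. frechet_derivative g (at x) v) U" for v
    by (rule Suc.IH[OF _ eq]) (use Suc.prems(1) in simp_all)
  then show ?case using hd by (auto simp: differentiable_def)
qed

lemma Ck_on_compose_affine:
  fixes L :: "'e::real_normed_vector \<Rightarrow> 'd::real_normed_vector"
  assumes "bounded_linear L" "open U" "Ck_on k f U"
  shows "Ck_on k (\<lambda>y. f (x0 + L y)) ((\<lambda>y. x0 + L y) -` U)"
  using assms(3)
proof (induction k arbitrary: f)
  case 0
  have "continuous_on ((\<lambda>y. x0 + L y) -` U) (\<lambda>y. x0 + L y)"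
    by (intro continuous_intros bounded_linear.continuous_on[OF assms(1)])
  then show ?case using 0 by (auto intro!: continuous_on_compose2[of U f])
next
  case (Suc k)
  have hd: "((\<lambda>y. f (x0 + L y)) has_derivative (\<lambda>v. frechet_derivative f (at (x0 + L y)) (L v))) (at y)"
    if "x0 + L y \<in> U" for y
  proof -
    have "((\<lambda>y. x0 + L y) has_derivative L) (at y)"
      by (auto intro!: derivative_eq_intros bounded_linear.has_derivative[OF assms(1)])
    then show ?thesis
      using Suc.prems that by (auto simp: frechet_derivative_works intro: has_derivative_compose)
  qed
  have eq: "frechet_derivative (\<lambda>y. f (x0 + L y)) (at y) v = frechet_derivative f (at (x0 + L y)) (L v)"
    if "x0 + L y \<in> U" for y v
    using frechet_derivative_at[OF hd[OF that]] by metis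
  have "open ((\<lambda>y. x0 + L y) -` U)"
    by (intro open_vimage[OF assms(2)] continuous_intros bounded_linear.continuous_on[OF assms(1)])
  then have "Ck_on k (\<lambda>y. frechet_derivative (\<lambda>y. f (x0 + L y)) (at y) v) ((\<lambda>y. x0 + L y) -` U)" for v
    by (rule Ck_on_cong[OF _ Suc.IH]) (use Suc.prems in \<open>auto simp: eq\<close>)
  then show ?case using hd by (auto simp: differentiable_def)
qed

section \<open>Gradient and divergence in the plane\<close>

definition gradient :: "(real^2 \<Rightarrow> real) \<Rightarrow> real^2 \<Rightarrow> real^2" where
  "gradient f x = (\<chi> i. partial_deriv i f x)"

definition divergence :: "(real^2 \<Rightarrow> real^2) \<Rightarrow> real^2 \<Rightarrow> real" where
  "divergence X x = (\<Sum>i\<in>UNIV. frechet_derivative X (at x) (axis i 1) $ i)"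

lemma inner_2: "(x::real^2) \<bullet> y = x$1 * y$1 + x$2 * y$2"
  by (simp add: inner_vec_def sum_2)

lemma expand_2: "(x::real^2) = x$1 *\<^sub>R axis 1 1 + x$2 *\<^sub>R axis 2 1"
  by (simp add: vec_eq_iff axis_def forall_2)

lemma linear_expand_2:
  fixes L :: "real^2 \<Rightarrow> 'b::real_vector"
  assumes "linear L"
  shows "L v = v$1 *\<^sub>R L (axis 1 1) + v$2 *\<^sub>R L (axis 2 1)"
  by (subst expand_2[of v]) (simp add: linear_add[OF assms] linear_scale[OF assms])

lemma gradient_unique:
  assumes "(f has_derivative (\<lambda>v. q \<bullet> v)) (at x)"
  shows "gradient f x = q"
  using frechet_derivative_at[OF assms, symmetric]
  by (simp add: gradient_def partial_deriv_def vec_eq_iff inner_axis)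

lemma has_derivative_gradient:
  assumes "f differentiable (at x)"
  shows "(f has_derivative (\<lambda>v. gradient f x \<bullet> v)) (at x)"
proof -
  have hd: "(f has_derivative frechet_derivative f (at x)) (at x)"
    using assms by (simp add: frechet_derivative_works)
  have "frechet_derivative f (at x) v = gradient f x \<bullet> v" for v
    using linear_expand_2[OF has_derivative_linear[OF hd], of v]
    by (simp add: gradient_def partial_deriv_def inner_2 mult.commute)
  then have "frechet_derivative f (at x) = (\<lambda>v. gradient f x \<bullet> v)" by auto
  then show ?thesis using hd by simp
qed

lemma Ck_on_2_Ck_on_1_gradient:
  assumes "Ck_on 2 f U"
  shows "Ck_on 1 (gradient f) U"
proof -
  have c: "Ck_on 1 (\<lambda>x. frechet_derivative f (at x) v) U" for v
    using assms by (simp add: numeral_2_eq_2)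
  have "gradient f = (\<lambda>x. frechet_derivative f (at x) (axis 1 1) *\<^sub>R axis 1 1
                         + frechet_derivative f (at x) (axis 2 1) *\<^sub>R axis 2 1)"
    by (rule ext) (simp add: gradient_def partial_deriv_def vec_eq_iff axis_def forall_2)
  moreover have "Ck_on 1 \<dots> U"
    by (intro Ck_on_1_add Ck_on_1_bounded_linear[OF bounded_linear_scaleR_left] c)
  ultimately show ?thesis by simp
qed

lemma Ck_on_2D_1:
  assumes "Ck_on 2 f U"
  shows "Ck_on 1 f U"
proof -
  have "Ck_on 1 (\<lambda>x. frechet_derivative f (at x) v) U" for v
    using assms by (simp add: numeral_2_eq_2)
  then have "continuous_on U (\<lambda>x. frechet_derivative f (at x) v)" for v
    by (rule Ck_on_1_continuous_on)
  then show ?thesis using assms by (simp add: numeral_2_eq_2)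
qed

lemma Ck_on_2I:
  assumes "\<And>x. x \<in> U \<Longrightarrow> (f has_derivative (\<lambda>v. q x \<bullet> v)) (at x)" "Ck_on 1 q U" "open U"
  shows "Ck_on 2 f U"
proof -
  have "Ck_on 1 (\<lambda>x. q x \<bullet> v) U" for v
    by (rule Ck_on_1_bounded_linear[OF bounded_linear_inner_left assms(2)])
  moreover have "q x \<bullet> v = frechet_derivative f (at x) v" if "x \<in> U" for x v
    using frechet_derivative_at[OF assms(1)[OF that]] by metis
  ultimately have "Ck_on 1 (\<lambda>x. frechet_derivative f (at x) v) U" for v
    using assms(3) by (rule_tac Ck_on_cong[of U 1 "\<lambda>x. q x \<bullet> v"]) auto
  moreover have "f differentiable (at x)" if "x \<in> U" for x
    using assms(1)[OF that] by (auto simp: differentiable_def)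
  ultimately show ?thesis by (simp add: numeral_2_eq_2)
qed

lemma divergence_eq:
  assumes "(X has_derivative X') (at x)"
  shows "divergence X x = X' (axis 1 1) $ 1 + X' (axis 2 1) $ 2"
  unfolding divergence_def frechet_derivative_at[OF assms, symmetric] by (simp add: sum_2)

lemma divergence_transform:
  assumes "(X has_derivative X') (at x)" "open U" "x \<in> U" "\<And>y. y \<in> U \<Longrightarrow> X y = Y y"
  shows "divergence Y x = divergence X x"
  by (metis assms divergence_eq has_derivative_transform_within_open)

lemma bounded_bilinear_matrix_vector: "bounded_bilinear (\<lambda>(A::real^2^2) x. A *v x)"
  by (rule bilinear_conv_bounded_bilinear[THEN iffD1])
     (simp add: bilinear_def linear_iff matrix_vector_right_distrib matrix_vector_mult_add_rdistrib
        matrix_vector_mult_scaleR scaleR_matrix_vector_assoc)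

section \<open>Flux through circles\<close>

definition circ :: "real \<Rightarrow> real^2" where
  "circ \<theta> = cos \<theta> *\<^sub>R axis 1 1 + sin \<theta> *\<^sub>R axis 2 1"

definition circ_tangent :: "real \<Rightarrow> real^2" where
  "circ_tangent \<theta> = (- sin \<theta>) *\<^sub>R axis 1 1 + cos \<theta> *\<^sub>R axis 2 1"

lemma circ_nth [simp]: "circ \<theta> $ 1 = cos \<theta>" "circ \<theta> $ 2 = sin \<theta>"
  "circ_tangent \<theta> $ 1 = - sin \<theta>" "circ_tangent \<theta> $ 2 = cos \<theta>"
  by (simp_all add: circ_def circ_tangent_def axis_def)

lemma norm_circ [simp]: "norm (circ \<theta>) = 1" "norm (circ_tangent \<theta>) = 1"
  by (simp_all add: norm_eq_sqrt_inner inner_2 flip: power2_eq_square)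

lemma circ_surj: obtains \<theta> where "0 \<le> \<theta>" "\<theta> \<le> 2 * pi" "x = norm x *\<^sub>R circ \<theta>"
proof (cases "x = 0")
  case True
  then show ?thesis using that[of 0] by simp
next
  case False
  have "(norm x)\<^sup>2 = (x$1)\<^sup>2 + (x$2)\<^sup>2"
    by (simp only: power2_norm_eq_inner inner_2) (simp add: power2_eq_square)
  then have "(x$1 / norm x)\<^sup>2 + (x$2 / norm x)\<^sup>2 = 1"
    using False by (simp add: power_divide flip: add_divide_distrib)
       (metis add.right_neutral norm_eq_zero zero_eq_power2)
  then obtain t where "0 \<le> t" "t < 2*pi" "x$1 / norm x = cos t" "x$2 / norm x = sin t"
    by (rule sincos_total_2pi)
  then have t: "x$1 = norm x * cos t" "x$2 = norm x * sin t"
    using False by (metis mult.commute nonzero_divide_eq_eq norm_eq_zero)+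
  have "x = norm x *\<^sub>R circ t"
    unfolding vec_eq_iff forall_2 by (simp flip: t)
  with \<open>0 \<le> t\<close> \<open>t < 2*pi\<close> show ?thesis by (intro that[of t]) auto
qed

lemma circ_has_derivative:
  "(circ has_vector_derivative circ_tangent \<theta>) (at \<theta> within T)"
  "(circ_tangent has_vector_derivative - circ \<theta>) (at \<theta> within T)"
  unfolding circ_def[abs_def] circ_tangent_def[abs_def]
  by (auto intro!: derivative_eq_intros simp: has_vector_derivative_def algebra_simps)

lemma continuous_on_circ [continuous_intros]:
  assumes "continuous_on T f"
  shows "continuous_on T (\<lambda>t. circ (f t))" "continuous_on T (\<lambda>t. circ_tangent (f t))"
proof -
  have "continuous_on UNIV circ" "continuous_on UNIV circ_tangent"
    by (auto intro!: has_vector_derivative_continuous circ_has_derivative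
        simp: continuous_on_eq_continuous_within)
  then show "continuous_on T (\<lambda>t. circ (f t))" "continuous_on T (\<lambda>t. circ_tangent (f t))"
    by (auto intro: continuous_on_compose2[OF _ assms])
qed

lemma has_vector_derivative_compose:
  assumes "(f has_vector_derivative f') (at x within S)" "(g has_derivative g') (at (f x))"
  shows "((\<lambda>t. g (f t)) has_vector_derivative g' f') (at x within S)"
  using vector_derivative_diff_chain_within[OF assms(1) has_derivative_at_withinI[OF assms(2)]]
  by (simp add: o_def)

text \<open>Differentiating under the integral sign produces the radial part of the divergence. The tangential part
  differs from what is left by the derivative in \<open>\<theta>\<close> of the periodic function
  \<open>Y \<bullet> circ_tangent\<close>, whose integral vanishes. This is the divergence theorem on an
  infinitesimally thin annulus.\<close>

lemma flux_has_derivative: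
  fixes Y :: "real^2 \<Rightarrow> real^2"
  assumes Y: "Ck_on 1 Y (ball 0 R - {0})" and r: "0 < r" "r < R"
  shows "((\<lambda>r. integral {0..2*pi} (\<lambda>\<theta>. r * (Y (r *\<^sub>R circ \<theta>) \<bullet> circ \<theta>))) has_real_derivative
           integral {0..2*pi} (\<lambda>\<theta>. r * divergence Y (r *\<^sub>R circ \<theta>))) (at r)"
proof -
  define D where "D = ball (0::real^2) R - {0}"
  define Y' where "Y' x = frechet_derivative Y (at x)" for x
  have hd: "(Y has_derivative Y' x) (at x)" if "x \<in> D" for x
    using Ck_on_1_has_derivative[OF Y] that unfolding D_def Y'_def by simp
  have cY': "continuous_on D (\<lambda>x. Y' x v)" for v
    using Ck_on_1_continuous_derivative[OF Y] unfolding D_def Y'_def by simp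
  have cY: "continuous_on D Y"
    using Ck_on_1_continuous_on[OF Y] unfolding D_def .
  have lin: "linear (Y' x)" if "x \<in> D" for x
    using hd[OF that] by (rule has_derivative_linear)
  have inD: "\<rho> *\<^sub>R circ \<theta> \<in> D" if "\<rho> \<in> {0<..<R}" for \<rho> \<theta>
  proof -
    have "norm (\<rho> *\<^sub>R circ \<theta>) = \<rho>" using that by simp
    then show ?thesis using that unfolding D_def by (metis Diff_iff greaterThanLessThan_iff
      less_irrefl mem_ball_0 norm_zero singletonD)
  qed
  define F where "F \<rho> \<theta> = Y (\<rho> *\<^sub>R circ \<theta>) \<bullet> circ \<theta>
      + \<rho> * ((cos \<theta> *\<^sub>R Y' (\<rho> *\<^sub>R circ \<theta>) (axis 1 1) + sin \<theta> *\<^sub>R Y' (\<rho> *\<^sub>R circ \<theta>) (axis 2 1)) \<bullet> circ \<theta>)"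
    for \<rho> \<theta>
  have Yc: "Y' x (circ \<theta>) = cos \<theta> *\<^sub>R Y' x (axis 1 1) + sin \<theta> *\<^sub>R Y' x (axis 2 1)"
    "Y' x (circ_tangent \<theta>) = - sin \<theta> *\<^sub>R Y' x (axis 1 1) + cos \<theta> *\<^sub>R Y' x (axis 2 1)"
    if "x \<in> D" for x \<theta>
    using linear_expand_2[OF lin[OF that], of "circ \<theta>"]
      linear_expand_2[OF lin[OF that], of "circ_tangent \<theta>"] by simp_all
  have dF: "((\<lambda>\<rho>. \<rho> * (Y (\<rho> *\<^sub>R circ \<theta>) \<bullet> circ \<theta>)) has_field_derivative F \<rho> \<theta>) (at \<rho> within {0<..<R})"
    if "\<rho> \<in> {0<..<R}" for \<rho> \<theta>
  proof -
    have "((\<lambda>\<rho>. \<rho> *\<^sub>R circ \<theta>) has_vector_derivative circ \<theta>) (at \<rho>)"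
      by (auto intro!: derivative_eq_intros simp: has_vector_derivative_def)
    then have "((\<lambda>\<rho>. Y (\<rho> *\<^sub>R circ \<theta>)) has_vector_derivative Y' (\<rho> *\<^sub>R circ \<theta>) (circ \<theta>)) (at \<rho>)"
      by (rule has_vector_derivative_compose) (rule hd[OF inD[OF that]])
    then have "((\<lambda>\<rho>. Y (\<rho> *\<^sub>R circ \<theta>) \<bullet> circ \<theta>) has_real_derivative Y' (\<rho> *\<^sub>R circ \<theta>) (circ \<theta>) \<bullet> circ \<theta>) (at \<rho>)"
      unfolding has_real_derivative_iff_has_vector_derivative
      by (rule bounded_linear.has_vector_derivative[OF bounded_linear_inner_left])
    then have "((\<lambda>\<rho>. \<rho> * (Y (\<rho> *\<^sub>R circ \<theta>) \<bullet> circ \<theta>)) has_field_derivative F \<rho> \<theta>) (at \<rho>)"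
      by (rule DERIV_cong[OF DERIV_mult[OF DERIV_ident]])
         (simp add: F_def Yc(1)[OF inD[OF that]] algebra_simps)
    then show ?thesis by (rule has_field_derivative_at_within)
  qed
  have ccirc: "continuous_on ({0<..<R} \<times> {0..2*pi}) (\<lambda>z. fst z *\<^sub>R circ (snd z))"
    by (intro continuous_intros)
  have cF: "continuous_on ({0<..<R} \<times> cbox 0 (2*pi)) (\<lambda>(\<rho>, \<theta>). F \<rho> \<theta>)"
    unfolding F_def split_beta cbox_interval
    by (intro continuous_intros continuous_on_compose2[OF cY' ccirc]
        continuous_on_compose2[OF cY ccirc]) (auto intro!: inD)
  have cr: "continuous_on {0..2*pi} (\<lambda>\<theta>. \<rho> *\<^sub>R circ \<theta>)" for \<rho>
    by (intro continuous_intros)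
  have int: "(\<lambda>\<theta>. \<rho> * (Y (\<rho> *\<^sub>R circ \<theta>) \<bullet> circ \<theta>)) integrable_on cbox 0 (2*pi)" if "\<rho> \<in> {0<..<R}" for \<rho>
    unfolding cbox_interval
    by (intro integrable_continuous_interval continuous_intros continuous_on_compose2[OF cY cr])
       (use that in \<open>auto intro!: inD\<close>)
  have rin: "r \<in> {0<..<R}" using r by simp
  have "((\<lambda>r. integral (cbox 0 (2*pi)) (\<lambda>\<theta>. r * (Y (r *\<^sub>R circ \<theta>) \<bullet> circ \<theta>))) has_field_derivative
           integral (cbox 0 (2*pi)) (F r)) (at r within {0<..<R})"
    by (rule leibniz_rule_field_derivative[OF dF int cF rin]) (auto simp: convex_real_interval)
  then have leib: "((\<lambda>r. integral {0..2*pi} (\<lambda>\<theta>. r * (Y (r *\<^sub>R circ \<theta>) \<bullet> circ \<theta>))) has_real_derivative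
           integral {0..2*pi} (F r)) (at r)"
    using rin by (simp add: at_within_open[of r "{0<..<R}"] cbox_interval)
  \<comment> \<open>The part of the integrand that is not \<open>r * divergence Y\<close> is an exact derivative of a
    periodic function of the angle.\<close>
  define T' where "T' \<theta> = r * (Y' (r *\<^sub>R circ \<theta>) (circ_tangent \<theta>) \<bullet> circ_tangent \<theta>) - Y (r *\<^sub>R circ \<theta>) \<bullet> circ \<theta>" for \<theta>
  have "((\<lambda>\<theta>. Y (r *\<^sub>R circ \<theta>) \<bullet> circ_tangent \<theta>) has_vector_derivative T' \<theta>) (at \<theta> within {0..2*pi})" for \<theta>
  proof -
    have "((\<lambda>\<theta>. r *\<^sub>R circ \<theta>) has_vector_derivative r *\<^sub>R circ_tangent \<theta>) (at \<theta> within {0..2*pi})"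
      by (rule bounded_linear.has_vector_derivative[OF bounded_linear_scaleR_right circ_has_derivative(1)])
    then have "((\<lambda>\<theta>. Y (r *\<^sub>R circ \<theta>)) has_vector_derivative Y' (r *\<^sub>R circ \<theta>) (r *\<^sub>R circ_tangent \<theta>)) (at \<theta> within {0..2*pi})"
      by (rule has_vector_derivative_compose) (rule hd[OF inD[OF rin]])
    from bounded_bilinear.has_vector_derivative[OF bounded_bilinear_inner this circ_has_derivative(2)]
    show ?thesis
      by (rule has_vector_derivative_eq_rhs)
         (simp add: T'_def linear_scale[OF lin[OF inD[OF rin]]] inner_add_left algebra_simps)
  qed
  then have "(T' has_integral (Y (r *\<^sub>R circ (2*pi)) \<bullet> circ_tangent (2*pi) - Y (r *\<^sub>R circ 0) \<bullet> circ_tangent 0)) {0..2*pi}"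
    by (intro fundamental_theorem_of_calculus) auto
  moreover have "circ (2*pi) = circ 0" "circ_tangent (2*pi) = circ_tangent 0"
    by (simp_all add: circ_def circ_tangent_def)
  ultimately have T0: "(T' has_integral 0) {0..2*pi}" by simp
  have eq: "r * divergence Y (r *\<^sub>R circ \<theta>) = F r \<theta> + T' \<theta>" for \<theta>
  proof -
    let ?x = "r *\<^sub>R circ \<theta>"
    let ?m = "\<lambda>i j. Y' ?x (axis j 1) $ i"
    define c s where "c = cos \<theta>" and "s = sin \<theta>"
    have "c * c + s * s = 1"
      by (simp add: c_def s_def flip: power2_eq_square)
    moreover have "F r \<theta> + T' \<theta> = r * ((?m 1 1 + ?m 2 2) * (c * c + s * s))"
      unfolding F_def T'_def Yc(2)[OF inD[OF rin]]
      by (simp add: inner_2 algebra_simps flip: c_def s_def)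
    ultimately show ?thesis by (simp add: divergence_eq[OF hd[OF inD[OF rin]]])
  qed
  have "continuous_on {0..2*pi} (\<lambda>\<theta>. (r, \<theta>))" by (intro continuous_intros)
  moreover have "Pair r ` {0..2*pi} \<subseteq> {0<..<R} \<times> cbox 0 (2*pi)"
    using rin by auto
  ultimately have "continuous_on {0..2*pi} (F r)"
    using continuous_on_compose2[OF cF, of "{0..2*pi}" "Pair r"] by simp
  then have "(F r has_integral integral {0..2*pi} (F r)) {0..2*pi}"
    by (intro integrable_integral integrable_continuous_interval)
  from has_integral_add[OF this T0] have "integral {0..2*pi} (\<lambda>\<theta>. r * divergence Y (r *\<^sub>R circ \<theta>)) = integral {0..2*pi} (F r)"
    by (simp add: eq integral_unique)
  with leib show ?thesis by simp
qed

text \<open>The lower bound makes \<open>J\<close> tend to minus infinity at least as fast as \<open>\<delta> ln r\<close>. Once \<open>J\<close> is negative, the quadratic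
  bound says that \<open>1 / J + k ln r\<close> is nonincreasing in \<open>r\<close>, so \<open>1 / J\<close> would have to become
  nonnegative before \<open>r\<close> reaches \<open>0\<close>.\<close>

lemma no_blow_up:
  fixes J J' :: "real \<Rightarrow> real"
  assumes pos: "0 < k" "0 < \<delta>" "0 < R"
    and J: "\<And>r. 0 < r \<Longrightarrow> r < R \<Longrightarrow> (J has_real_derivative J' r) (at r)"
    and quad: "\<And>r. 0 < r \<Longrightarrow> r < R \<Longrightarrow> k * (J r)\<^sup>2 / r \<le> J' r"
    and low: "\<And>r. 0 < r \<Longrightarrow> r < R \<Longrightarrow> \<delta> / r \<le> J' r"
  shows False
proof -
  define \<rho> where "\<rho> = R / 2"
  have \<rho>: "0 < \<rho>" "\<rho> < R" using pos by (auto simp: \<rho>_def)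
  \<comment> \<open>At this radius the first bound gives \<open>J r0 \<le> J \<rho> - (\<bar>J \<rho>\<bar> + 1) \<le> -1\<close>.\<close>
  define r0 where "r0 = \<rho> * exp (- (\<bar>J \<rho>\<bar> + 1) / \<delta>)"
  have "exp (- (\<bar>J \<rho>\<bar> + 1) / \<delta>) < 1" using pos by (simp add: divide_neg_pos)
  then have r0: "0 < r0" "r0 < \<rho>" using \<rho> mult_strict_left_mono[of _ 1 \<rho>] by (auto simp: r0_def)
  have lnr0: "ln r0 = ln \<rho> - (\<bar>J \<rho>\<bar> + 1) / \<delta>"
    using \<rho> by (simp add: r0_def ln_mult minus_divide_left)
  have mono: "J s - \<delta> * ln s \<le> J t - \<delta> * ln t" if "0 < s" "s \<le> t" "t < R" for s t
  proof (rule DERIV_nonneg_imp_nondecreasing[OF that(2)])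
    fix x assume "s \<le> x" "x \<le> t"
    then have x: "0 < x" "x < R" using that by auto
    have "((\<lambda>x. J x - \<delta> * ln x) has_real_derivative J' x - \<delta> * (1 / x)) (at x)"
      using x by (auto intro!: derivative_eq_intros J)
    moreover have "0 \<le> J' x - \<delta> * (1 / x)" using low[OF x] by simp
    ultimately show "\<exists>y. ((\<lambda>x. J x - \<delta> * ln x) has_real_derivative y) (at x) \<and> 0 \<le> y" by blast
  qed
  have "J r0 \<le> J \<rho> - \<delta> * (ln \<rho> - ln r0)"
    using mono[of r0 \<rho>] r0 \<rho> by (simp add: algebra_simps)
  also have "\<dots> = J \<rho> - (\<bar>J \<rho>\<bar> + 1)" using pos by (simp add: lnr0)
  finally have Jr0: "J r0 < 0" by linarith
  have Jneg: "J r < 0" if "0 < r" "r \<le> r0" for r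
  proof -
    have "ln r \<le> ln r0" using that by simp
    then have "\<delta> * ln r \<le> \<delta> * ln r0" using pos by simp
    then show ?thesis using mono[of r r0] that r0 \<rho> Jr0 by linarith
  qed
  have mono2: "inverse (J r0) + k * ln r0 \<le> inverse (J r) + k * ln r" if "0 < r" "r \<le> r0" for r
  proof (rule DERIV_nonpos_imp_nonincreasing[OF that(2)])
    fix x assume "r \<le> x" "x \<le> r0"
    then have x: "0 < x" "x < R" "J x < 0" using that r0 \<rho> Jneg by auto
    have "((\<lambda>x. inverse (J x) + k * ln x) has_real_derivative
            - (inverse (J x) * J' x * inverse (J x)) + k * (1 / x)) (at x)"
      using x by (auto intro!: derivative_eq_intros J)
    moreover have "- (inverse (J x) * J' x * inverse (J x)) + k * (1 / x) \<le> 0"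
    proof -
      have "k * (1/x) = inverse (J x) * (k * (J x)\<^sup>2 / x) * inverse (J x)"
        using x by (simp add: field_simps power2_eq_square)
      also have "\<dots> \<le> inverse (J x) * J' x * inverse (J x)"
        using quad[OF x(1,2)] x(3)
        by (intro mult_right_mono_neg mult_left_mono_neg) auto
      finally show ?thesis by simp
    qed
    ultimately show "\<exists>y. ((\<lambda>x. inverse (J x) + k * ln x) has_real_derivative y) (at x) \<and> y \<le> 0" by blast
  qed
  \<comment> \<open>Here \<open>k ln r\<close> equals \<open>inverse (J r0) + k ln r0\<close>, and nothing is left for \<open>inverse (J r)\<close>.\<close>
  define r where "r = r0 * exp (inverse (J r0) / k)"
  have "exp (inverse (J r0) / k) \<le> 1" using Jr0 pos by (simp add: divide_nonpos_pos)
  then have r: "0 < r" "r \<le> r0" using r0 mult_left_mono[of _ 1 r0] by (auto simp: r_def)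
  have "k * ln r = k * ln r0 + inverse (J r0)"
    using r0 pos by (simp add: r_def ln_mult algebra_simps)
  then have "0 \<le> inverse (J r)" using mono2[OF r] by simp
  moreover have "inverse (J r) < 0" using Jneg[OF r] by simp
  ultimately show False by simp
qed

section \<open>Elliptic operators in divergence form\<close>

text \<open>For \<open>a = sqrt (det G) G^(-1)\<close> this is the Laplace-Beltrami operator of \<open>G\<close> multiplied by the density
  \<open>sqrt (det G)\<close>.\<close>

definition elliptic_op :: "(real^2 \<Rightarrow> real^2^2) \<Rightarrow> (real^2 \<Rightarrow> real) \<Rightarrow> real^2 \<Rightarrow> real" where
  "elliptic_op a f = divergence (\<lambda>y. a y *v gradient f y)"

lemma has_derivative_matrix_vector:
  fixes a :: "'e::real_normed_vector \<Rightarrow> real^2^2"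
  assumes "(a has_derivative a') (at x)" "(q has_derivative q') (at x)"
  shows "((\<lambda>y. a y *v q y) has_derivative (\<lambda>v. a x *v q' v + a' v *v q x)) (at x)"
  using bounded_bilinear.FDERIV[OF bounded_bilinear_matrix_vector assms] by simp

lemma elliptic_op_expand:
  assumes "(a has_derivative a') (at x)" "(gradient f has_derivative q') (at x)"
  shows "elliptic_op a f x =
    (a x *v q' (axis 1 1)) $ 1 + (a x *v q' (axis 2 1)) $ 2 +
    ((a' (axis 1 1) *v gradient f x) $ 1 + (a' (axis 2 1) *v gradient f x) $ 2)"
  unfolding elliptic_op_def divergence_eq[OF has_derivative_matrix_vector[OF assms]] by simp

lemma elliptic_op_lincomb:
  fixes f g :: "real^2 \<Rightarrow> real"
  assumes "open U" "x \<in> U" "Ck_on 1 a U" "Ck_on 2 f U" "Ck_on 2 g U"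
  shows "elliptic_op a (\<lambda>y. \<alpha> * f y + \<beta> * g y) x = \<alpha> * elliptic_op a f x + \<beta> * elliptic_op a g x"
proof -
  define F G where "F = frechet_derivative (gradient f) (at x)"
    and "G = frechet_derivative (gradient g) (at x)"
  have F: "(gradient f has_derivative F) (at x)" and G: "(gradient g has_derivative G) (at x)"
    using Ck_on_1_has_derivative[OF Ck_on_2_Ck_on_1_gradient] assms unfolding F_def G_def by blast+
  have a: "(a has_derivative frechet_derivative a (at x)) (at x)"
    using Ck_on_1_has_derivative assms by blast
  have grad: "gradient (\<lambda>y. \<alpha> * f y + \<beta> * g y) y = \<alpha> *\<^sub>R gradient f y + \<beta> *\<^sub>R gradient g y"
    if "y \<in> U" for y
  proof (rule gradient_unique)
    have "(f has_derivative (\<lambda>v. gradient f y \<bullet> v)) (at y)" "(g has_derivative (\<lambda>v. gradient g y \<bullet> v)) (at y)"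
      using Ck_on_2D_1[OF assms(4)] Ck_on_2D_1[OF assms(5)] that by (auto intro!: has_derivative_gradient)
    then show "((\<lambda>y. \<alpha> * f y + \<beta> * g y) has_derivative (\<lambda>v. (\<alpha> *\<^sub>R gradient f y + \<beta> *\<^sub>R gradient g y) \<bullet> v)) (at y)"
      by (auto intro!: derivative_eq_intros simp: inner_add_left)
  qed
  have "((\<lambda>y. \<alpha> *\<^sub>R gradient f y + \<beta> *\<^sub>R gradient g y) has_derivative (\<lambda>v. \<alpha> *\<^sub>R F v + \<beta> *\<^sub>R G v)) (at x)"
    using F G by (auto intro!: derivative_eq_intros)
  then have "(gradient (\<lambda>y. \<alpha> * f y + \<beta> * g y) has_derivative (\<lambda>v. \<alpha> *\<^sub>R F v + \<beta> *\<^sub>R G v)) (at x)"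
    by (rule has_derivative_transform_within_open[OF _ assms(1,2)]) (simp add: grad)
  from elliptic_op_expand[OF a this] elliptic_op_expand[OF a F] elliptic_op_expand[OF a G]
  show ?thesis
    by (simp add: grad[OF assms(2)] matrix_vector_right_distrib matrix_vector_mult_scaleR algebra_simps)
qed

lemma Ck_on_2_lincomb:
  fixes f g :: "real^2 \<Rightarrow> real"
  assumes "open U" "Ck_on 2 f U" "Ck_on 2 g U"
  shows "Ck_on 2 (\<lambda>y. \<alpha> * f y + \<beta> * g y) U"
proof (rule Ck_on_2I[where q = "\<lambda>y. \<alpha> *\<^sub>R gradient f y + \<beta> *\<^sub>R gradient g y"])
  fix y assume "y \<in> U"
  then have "(f has_derivative (\<lambda>v. gradient f y \<bullet> v)) (at y)" "(g has_derivative (\<lambda>v. gradient g y \<bullet> v)) (at y)"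
    using Ck_on_2D_1[OF assms(2)] Ck_on_2D_1[OF assms(3)] by (auto intro!: has_derivative_gradient)
  then show "((\<lambda>y. \<alpha> * f y + \<beta> * g y) has_derivative (\<lambda>v. (\<alpha> *\<^sub>R gradient f y + \<beta> *\<^sub>R gradient g y) \<bullet> v)) (at y)"
    by (auto intro!: derivative_eq_intros simp: inner_add_left)
next
  show "Ck_on 1 (\<lambda>y. \<alpha> *\<^sub>R gradient f y + \<beta> *\<^sub>R gradient g y) U"
    by (intro Ck_on_1_add Ck_on_1_bounded_linear[OF bounded_linear_scaleR_right]
        Ck_on_2_Ck_on_1_gradient assms)
qed (rule assms(1))

lemma has_vector_derivative_line:
  fixes x v :: "'e::real_normed_vector"
  shows "((\<lambda>s::real. x + s *\<^sub>R v) has_vector_derivative v) (at s)"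
  by (auto intro!: derivative_eq_intros simp: has_vector_derivative_def)

lemma second_derivative_test:
  fixes w :: "real^2 \<Rightarrow> real"
  assumes U: "open U" "x \<in> U" and max: "\<And>y. y \<in> U \<Longrightarrow> w y \<le> w x"
    and w: "\<And>y. y \<in> U \<Longrightarrow> (w has_derivative (\<lambda>v. q y \<bullet> v)) (at y)"
    and q: "(q has_derivative q') (at x)"
  shows "q x = 0" "v \<bullet> q' v \<le> 0"
proof -
  have "(\<lambda>v. q x \<bullet> v) = (\<lambda>v. 0)"
    by (rule differential_zero_maxmin[OF U(2,1) w[OF U(2)]]) (use max in blast)
  then have "q x \<bullet> q x = 0" by metis
  then show 0: "q x = 0" by simp
  show "v \<bullet> q' v \<le> 0"
  proof (rule ccontr)
    assume neg: "\<not> v \<bullet> q' v \<le> 0"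
    have "((\<lambda>s. q (x + s *\<^sub>R v)) has_vector_derivative q' v) (at 0)"
      by (rule has_vector_derivative_compose[OF has_vector_derivative_line]) (use q in simp)
    then have "((\<lambda>s. q (x + s *\<^sub>R v) \<bullet> v) has_real_derivative q' v \<bullet> v) (at 0)"
      unfolding has_real_derivative_iff_has_vector_derivative
      by (rule bounded_linear.has_vector_derivative[OF bounded_linear_inner_left])
    then obtain d where d: "0 < d" "\<And>h. 0 < h \<Longrightarrow> h < d \<Longrightarrow> 0 < q (x + h *\<^sub>R v) \<bullet> v"
      using has_real_derivative_pos_inc_right[of "\<lambda>s. q (x + s *\<^sub>R v) \<bullet> v" "q' v \<bullet> v" 0 UNIV] neg 0
      by (auto simp: inner_commute)
    have "open ((\<lambda>s. x + s *\<^sub>R v) -` U)"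
      by (intro open_vimage[OF U(1)] continuous_intros)
    then obtain e where e: "0 < e" "\<And>s. \<bar>s\<bar> < e \<Longrightarrow> x + s *\<^sub>R v \<in> U"
      using U(2) unfolding open_dist by (auto simp: dist_real_def dest!: bspec[of _ _ 0])
    define s where "s = min d e / 2"
    have s: "0 < s" "s < d" "s < e" using d(1) e(1) by (auto simp: s_def)
    have "w (x + 0 *\<^sub>R v) < w (x + s *\<^sub>R v)"
    proof (rule DERIV_pos_imp_increasing_open[OF s(1)])
      fix t :: real assume t: "0 < t" "t < s"
      then have "x + t *\<^sub>R v \<in> U" using s by (intro e(2)) auto
      then have "((\<lambda>s. w (x + s *\<^sub>R v)) has_vector_derivative q (x + t *\<^sub>R v) \<bullet> v) (at t)"
        by (intro has_vector_derivative_compose[OF has_vector_derivative_line] w)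
      then show "\<exists>y. ((\<lambda>s. w (x + s *\<^sub>R v)) has_real_derivative y) (at t) \<and> 0 < y"
        using d(2)[of t] t s by (auto simp: has_real_derivative_iff_has_vector_derivative)
    next
      have "continuous_on U w"
        using w by (meson continuous_at_imp_continuous_on has_derivative_continuous)
      moreover have "continuous_on {0..s} (\<lambda>t. x + t *\<^sub>R v)"
        by (intro continuous_intros)
      moreover have "(\<lambda>t. x + t *\<^sub>R v) ` {0..s} \<subseteq> U"
      proof (rule image_subsetI)
        fix t assume "t \<in> {0..s}"
        then show "x + t *\<^sub>R v \<in> U" using s by (intro e(2)) auto
      qed
      ultimately show "continuous_on {0..s} (\<lambda>s. w (x + s *\<^sub>R v))"
        by (rule continuous_on_compose2)
    qed
    moreover have "w (x + s *\<^sub>R v) \<le> w x" using s by (intro max e(2)) auto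
    ultimately show False by simp
  qed
qed

text \<open>As \<open>A\<close> is symmetric, only the quadratic form of \<open>H\<close> enters the trace of \<open>A H\<close>.\<close>

lemma trace_nonpos:
  fixes A :: "real^2^2" and H :: "real^2 \<Rightarrow> real^2"
  assumes "linear H" and H: "\<And>v. v \<bullet> H v \<le> 0"
    and A: "A $ 1 $ 2 = A $ 2 $ 1" "0 < A$1$1" "0 \<le> A$1$1 * A$2$2 - A$1$2 * A$2$1"
  shows "(A *v H (axis 1 1)) $ 1 + (A *v H (axis 2 1)) $ 2 \<le> 0"
proof -
  define p s where "p = A$1$1" and "s = A$1$2"
  define h where "h i j = H (axis j 1) $ i" for i j :: 2
  have quad: "h 1 1 * v$1 * v$1 + (h 1 2 + h 2 1) * v$1 * v$2 + h 2 2 * v$2 * v$2 \<le> 0" for v :: "real^2"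
    using H[of v] unfolding linear_expand_2[OF assms(1), of v] inner_2 h_def by (simp add: algebra_simps)
  \<comment> \<open>Completing the square: \<open>p A\<close> is the sum of the rank one matrix of the vector \<open>(p, s)\<close> and a
    nonnegative multiple of that of \<open>(0, 1)\<close>.\<close>
  have "(A *v H (axis 1 1)) $ 1 + (A *v H (axis 2 1)) $ 2
      = p * h 1 1 + s * (h 1 2 + h 2 1) + A$2$2 * h 2 2"
    using A by (simp add: matrix_vector_mult_def sum_2 p_def s_def h_def algebra_simps)
  also have "p * \<dots> = (h 1 1 * p * p + (h 1 2 + h 2 1) * p * s + h 2 2 * s * s) + (p * A$2$2 - s * s) * h 2 2"
    by (simp add: algebra_simps)
  also have "\<dots> \<le> 0"
  proof (rule add_nonpos_nonpos)
    show "h 1 1 * p * p + (h 1 2 + h 2 1) * p * s + h 2 2 * s * s \<le> 0"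
      using quad[of "vector [p, s]"] by simp
    show "(p * A$2$2 - s * s) * h 2 2 \<le> 0"
      using quad[of "vector [0, 1]"] A by (intro mult_nonneg_nonpos) (simp_all add: p_def s_def)
  qed
  finally show ?thesis using A by (simp add: p_def mult_le_0_iff)
qed

text \<open>At an interior maximum the first order terms of the operator vanish and the second order part is the
  trace of a positive semidefinite times a negative semidefinite matrix, which contradicts strict
  positivity.\<close>

lemma maximum_principle:
  fixes w :: "real^2 \<Rightarrow> real"
  assumes K: "compact K" "K \<subseteq> U" "open U" and w: "Ck_on 2 w U" and a: "Ck_on 1 a U"
    and ell: "\<And>x. x \<in> U \<Longrightarrow> a x $ 1 $ 2 = a x $ 2 $ 1"
      "\<And>x. x \<in> U \<Longrightarrow> 0 < a x $ 1 $ 1" "\<And>x. x \<in> U \<Longrightarrow> 0 \<le> a x$1$1 * a x$2$2 - a x$1$2 * a x$2$1"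
    and sub: "\<And>x. x \<in> U \<Longrightarrow> 0 < elliptic_op a w x"
    and x: "x \<in> K"
  obtains y where "y \<in> K - interior K" "w x \<le> w y"
proof -
  have cont: "continuous_on K w"
    using Ck_on_1_continuous_on[OF Ck_on_2D_1[OF w]] K(2) by (rule continuous_on_subset)
  obtain y where y: "y \<in> K" "\<And>z. z \<in> K \<Longrightarrow> w z \<le> w y"
    using continuous_attains_sup[OF K(1) _ cont] x by blast
  have "y \<notin> interior K"
  proof
    assume yK: "y \<in> interior K"
    have yU: "y \<in> U" using y(1) K(2) by blast
    define H where "H = frechet_derivative (gradient w) (at y)"
    have H: "(gradient w has_derivative H) (at y)"
      unfolding H_def by (rule Ck_on_1_has_derivative[OF Ck_on_2_Ck_on_1_gradient[OF w] yU])
    have der: "(w has_derivative (\<lambda>v. gradient w z \<bullet> v)) (at z)" if "z \<in> interior K" for z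
      using Ck_on_2D_1[OF w] that K(2) interior_subset[of K] by (intro has_derivative_gradient) auto
    have max: "w z \<le> w y" if "z \<in> interior K" for z
      using y(2) that interior_subset by blast
    note t = second_derivative_test[OF open_interior yK max der H]
    have "elliptic_op a w y = (a y *v H (axis 1 1)) $ 1 + (a y *v H (axis 2 1)) $ 2"
      by (simp add: elliptic_op_expand[OF Ck_on_1_has_derivative[OF a yU] H] t(1))
    also have "\<dots> \<le> 0"
      by (rule trace_nonpos[OF has_derivative_linear[OF H] t(2) ell[OF yU]])
    finally show False using sub[OF yU] by simp
  qed
  then show ?thesis using that y x by blast
qed

section \<open>Isolated singularities of bounded functions\<close>

lemma axis_off_diagonal: "axis 1 (1::real) $ (2::2) = 0" "axis 2 (1::real) $ (1::2) = 0"
  by (simp_all add: axis_def)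

text \<open>The gradients of \<open>norm\<close> and of \<open>ln \<circ> norm\<close> both have the form \<open>\<phi> (|x|\<^sup>2) x\<close>, so one computation
  serves for both.\<close>

lemma radial_field:
  fixes \<phi> \<phi>' :: "real \<Rightarrow> real"
  assumes \<phi>: "\<And>s. 0 < s \<Longrightarrow> (\<phi> has_real_derivative \<phi>' s) (at s)" and c: "continuous_on {0<..} \<phi>'"
  shows "x \<noteq> 0 \<Longrightarrow> ((\<lambda>x::real^2. \<phi> (x \<bullet> x) *\<^sub>R x) has_derivative
            (\<lambda>v. \<phi> (x \<bullet> x) *\<^sub>R v + (2 * \<phi>' (x \<bullet> x) * (x \<bullet> v)) *\<^sub>R x)) (at x)"
    and "Ck_on 1 (\<lambda>x::real^2. \<phi> (x \<bullet> x) *\<^sub>R x) (- {0})"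
proof -
  have der: "((\<lambda>x. \<phi> (x \<bullet> x)) has_derivative (\<lambda>v. 2 * \<phi>' (x \<bullet> x) * (x \<bullet> v))) (at x)"
    if "x \<noteq> 0" for x :: "real^2"
  proof -
    have "((\<lambda>x. x \<bullet> x) has_derivative (\<lambda>v. 2 * (x \<bullet> v))) (at x)"
      by (auto intro!: derivative_eq_intros simp: inner_commute)
    from has_derivative_compose[OF this \<phi>[unfolded has_field_derivative_def, of "x \<bullet> x"]] that
    show ?thesis by (simp add: mult_ac)
  qed
  show *: "((\<lambda>x. \<phi> (x \<bullet> x) *\<^sub>R x) has_derivative
            (\<lambda>v. \<phi> (x \<bullet> x) *\<^sub>R v + (2 * \<phi>' (x \<bullet> x) * (x \<bullet> v)) *\<^sub>R x)) (at x)"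
    if "x \<noteq> 0" for x :: "real^2"
    by (rule has_derivative_eq_rhs[OF has_derivative_scaleR[OF der[OF that] has_derivative_ident]]) simp
  have "continuous_on {0<..} \<phi>"
    using \<phi> by (meson DERIV_continuous_on greaterThan_iff has_field_derivative_at_within)
  then show "Ck_on 1 (\<lambda>x::real^2. \<phi> (x \<bullet> x) *\<^sub>R x) (- {0})"
  proof (intro Ck_on_1I[OF *])
    assume \<phi>c: "continuous_on {0<..} \<phi>"
    have i: "continuous_on (- {0}) (\<lambda>x::real^2. x \<bullet> x)" "(\<lambda>x::real^2. x \<bullet> x) ` (- {0}) \<subseteq> {0<..}"
      by (auto intro: continuous_intros)
    show "continuous_on (- {0}) (\<lambda>x::real^2. \<phi> (x \<bullet> x) *\<^sub>R v + (2 * \<phi>' (x \<bullet> x) * (x \<bullet> v)) *\<^sub>R x)" for v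
      by (intro continuous_on_add continuous_on_scaleR continuous_on_mult continuous_on_inner
          continuous_on_compose2[OF c i] continuous_on_compose2[OF \<phi>c i] continuous_on_const continuous_on_id)
  qed auto
qed

lemma norm_field: "x \<noteq> 0 \<Longrightarrow> (norm has_derivative (\<lambda>v. (inverse (sqrt (x \<bullet> x)) *\<^sub>R x) \<bullet> v)) (at (x::real^2))"
proof -
  assume "x \<noteq> 0"
  then have "(norm has_derivative (\<lambda>v. v \<bullet> sgn x)) (at x)" by (rule has_derivative_norm)
  then show ?thesis by (simp add: sgn_div_norm norm_eq_sqrt_inner inner_commute)
qed

lemma ln_norm_field:
  "x \<noteq> 0 \<Longrightarrow> ((\<lambda>x. ln (norm x)) has_derivative (\<lambda>v. (inverse (x \<bullet> x) *\<^sub>R x) \<bullet> v)) (at (x::real^2))"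
proof -
  assume x: "x \<noteq> 0"
  have "((\<lambda>x. ln (norm x)) has_derivative (\<lambda>v. (v \<bullet> sgn x) * inverse (norm x))) (at x)"
    using x by (auto intro!: derivative_eq_intros has_derivative_norm simp: divide_inverse)
  moreover have "(v \<bullet> sgn x) * inverse (norm x) = (inverse (x \<bullet> x) *\<^sub>R x) \<bullet> v" for v
    using x by (simp add: sgn_div_norm inner_commute power2_eq_square flip: power2_norm_eq_inner)
  ultimately show ?thesis by simp
qed

lemma inv_sqrt_derivative:
  assumes "0 < s"
  shows "((\<lambda>s. inverse (sqrt s)) has_real_derivative - inverse (2 * sqrt s * s)) (at s)"
proof (rule DERIV_cong)
  show "((\<lambda>s. inverse (sqrt s)) has_real_derivative
      - (inverse (sqrt s) * (inverse (sqrt s) / 2) * inverse (sqrt s))) (at s)"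
    using assms by (intro DERIV_inverse' DERIV_real_sqrt) auto
  have "inverse (sqrt s) * inverse (sqrt s) = inverse s"
    using assms by (simp flip: inverse_mult_distrib)
  then show "- (inverse (sqrt s) * (inverse (sqrt s) / 2) * inverse (sqrt s)) = - inverse (2 * sqrt s * s)"
    by simp
qed

lemma inv_derivative: "0 < s \<Longrightarrow> (inverse has_real_derivative - inverse (s * s)) (at (s::real))"
  using DERIV_inverse[of s] by (simp add: power2_eq_square)

lemma cont_derivs:
  "continuous_on {0<..} (\<lambda>s::real. - inverse (2 * sqrt s * s))"
  "continuous_on {0<..} (\<lambda>s::real. - inverse (s * s))"
  by (auto intro!: continuous_intros)

text \<open>A quantitative form of \<open>a 0 = mat 1\<close> for continuously differentiable coefficients. The bound on
  \<open>C * R\<close> keeps all error terms below half of the leading terms on the whole disc.\<close>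

locale near_identity =
  fixes a :: "real^2 \<Rightarrow> real^2^2" and R C :: real
  assumes R: "0 < R" and C: "0 \<le> C" "C * R \<le> 1 / 10"
    and C1: "Ck_on 1 a (ball 0 R)"
    and sym: "x \<in> ball 0 R \<Longrightarrow> transpose (a x) = a x"
    and near: "x \<in> ball 0 R \<Longrightarrow> norm (a x *v v - v) \<le> C * norm x * norm v"
    and deriv: "x \<in> ball 0 R \<Longrightarrow> norm (frechet_derivative a (at x) v *v w) \<le> C * norm v * norm w"
begin

abbreviation D where "D \<equiv> ball (0::real^2) R - {0}"

lemma open_D: "open D" by (simp add: open_Diff)

lemma C_norm: "x \<in> ball 0 R \<Longrightarrow> C * norm x \<le> 1 / 10"
  using C mult_left_mono[of "norm x" R C] by auto

lemma norm_near: "x \<in> ball 0 R \<Longrightarrow> norm (a x *v v - v) \<le> norm v / 10"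
  using near[of x v] mult_right_mono[OF C_norm, of x "norm v"] by simp

lemma norm_mult_le: "x \<in> ball 0 R \<Longrightarrow> norm (a x *v v) \<le> 2 * norm v"
  using norm_near[of x v] norm_triangle_sub[of "a x *v v" v] norm_ge_zero[of v] by linarith

lemma inner_near: "x \<in> ball 0 R \<Longrightarrow> \<bar>v \<bullet> (a x *v v) - (norm v)\<^sup>2\<bar> \<le> C * norm x * (norm v)\<^sup>2"
proof -
  assume x: "x \<in> ball 0 R"
  have "v \<bullet> (a x *v v) - (norm v)\<^sup>2 = v \<bullet> (a x *v v - v)"
    by (simp add: inner_diff_right power2_norm_eq_inner)
  then have "\<bar>v \<bullet> (a x *v v) - (norm v)\<^sup>2\<bar> \<le> norm v * norm (a x *v v - v)"
    by (simp add: Cauchy_Schwarz_ineq2)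
  also have "\<dots> \<le> norm v * (C * norm x * norm v)"
    using near[OF x, of v] by (intro mult_left_mono) auto
  finally show ?thesis by (simp add: power2_eq_square mult_ac)
qed

lemma coercive: "x \<in> ball 0 R \<Longrightarrow> (norm v)\<^sup>2 / 2 \<le> v \<bullet> (a x *v v)"
proof -
  assume x: "x \<in> ball 0 R"
  have "C * norm x * (norm v)\<^sup>2 \<le> 1 / 10 * (norm v)\<^sup>2"
    using C_norm[OF x] by (intro mult_right_mono) auto
  then show ?thesis using inner_near[OF x, of v] zero_le_power2[of "norm v"] by linarith
qed

lemma entries:
  assumes x: "x \<in> ball 0 R"
  shows "a x $ 1 $ 2 = a x $ 2 $ 1" "\<bar>a x $ 1 $ 1 - 1\<bar> \<le> C * norm x" "\<bar>a x $ 2 $ 2 - 1\<bar> \<le> C * norm x"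
    "\<bar>a x $ 1 $ 2\<bar> \<le> C * norm x"
proof -
  show "a x $ 1 $ 2 = a x $ 2 $ 1"
    using arg_cong[OF sym[OF x], of "\<lambda>A. A $ 1 $ 2"] by (simp add: transpose_def)
  have "\<bar>a x $ i $ j - axis j 1 $ i\<bar> \<le> C * norm x" for i j
    using component_le_norm_cart[of "a x *v axis j 1 - axis j 1" i] near[OF x, of "axis j 1"]
    by (simp add: matrix_vector_mult_basis column_def)
  from this[of 1 1] this[of 2 2] this[of 1 2]
  show "\<bar>a x $ 1 $ 1 - 1\<bar> \<le> C * norm x" "\<bar>a x $ 2 $ 2 - 1\<bar> \<le> C * norm x" "\<bar>a x $ 1 $ 2\<bar> \<le> C * norm x"
    by (simp_all add: axis_def)
qed

lemma elliptic:
  assumes x: "x \<in> ball 0 R"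
  shows "0 < a x $ 1 $ 1" "0 \<le> a x $ 1 $ 1 * a x $ 2 $ 2 - a x $ 1 $ 2 * a x $ 2 $ 1"
proof -
  note e = entries[OF x] C_norm[OF x]
  show "0 < a x $ 1 $ 1" using e by (simp add: abs_le_iff)
  have "(9/10) * (9/10) \<le> a x $ 1 $ 1 * a x $ 2 $ 2"
    using e by (intro mult_mono) (auto simp: abs_le_iff)
  moreover have "\<bar>a x $ 1 $ 2 * a x $ 2 $ 1\<bar> \<le> (1/10) * (1/10)"
    unfolding abs_mult e(1)[symmetric] using e by (intro mult_mono) auto
  ultimately show "0 \<le> a x $ 1 $ 1 * a x $ 2 $ 2 - a x $ 1 $ 2 * a x $ 2 $ 1"
    by (simp add: abs_le_iff)
qed

lemma first_order_bound:
  assumes x: "x \<in> ball 0 R"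
  shows "\<bar>(frechet_derivative a (at x) (axis 1 1) *v q) $ 1 + (frechet_derivative a (at x) (axis 2 1) *v q) $ 2\<bar>
    \<le> 2 * C * norm q"
proof -
  have "\<bar>(frechet_derivative a (at x) (axis i 1) *v q) $ i\<bar> \<le> C * norm q" for i
    using component_le_norm_cart[of "frechet_derivative a (at x) (axis i 1) *v q" i]
      deriv[OF x, of "axis i 1" q] by simp
  from this[of 1] this[of 2] show ?thesis by linarith
qed

text \<open>The subtracted term is the flat Laplacian. The remainder comes from \<open>a - mat 1\<close> in the second order
  part and from the derivative of \<open>a\<close> in the first order part; each gains a factor \<open>C * norm x\<close> over
  the size of the corresponding flat term.\<close>

lemma elliptic_op_radial:
  fixes \<phi> \<phi>' :: "real \<Rightarrow> real"
  assumes \<phi>: "\<And>s. 0 < s \<Longrightarrow> (\<phi> has_real_derivative \<phi>' s) (at s)" and c: "continuous_on {0<..} \<phi>'"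
    and f: "\<And>x. x \<noteq> 0 \<Longrightarrow> (f has_derivative (\<lambda>v. (\<phi> (x \<bullet> x) *\<^sub>R x) \<bullet> v)) (at x)"
    and x: "x \<in> D"
  shows "\<bar>elliptic_op a f x - (2 * \<phi> (x \<bullet> x) + 2 * \<phi>' (x \<bullet> x) * (norm x)\<^sup>2)\<bar>
     \<le> C * norm x * (4 * \<bar>\<phi> (x \<bullet> x)\<bar> + 2 * \<bar>\<phi>' (x \<bullet> x)\<bar> * (norm x)\<^sup>2)"
proof -
  let ?f = "\<phi> (x \<bullet> x)" and ?f' = "\<phi>' (x \<bullet> x)"
  have xR: "x \<in> ball 0 R" and x0: "x \<noteq> 0" using x by auto
  have grad: "gradient f y = \<phi> (y \<bullet> y) *\<^sub>R y" if "y \<noteq> 0" for y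
    by (rule gradient_unique[OF f[OF that]])
  have der: "(gradient f has_derivative (\<lambda>v. ?f *\<^sub>R v + (2 * ?f' * (x \<bullet> v)) *\<^sub>R x)) (at x)"
    by (rule has_derivative_transform_within_open[OF radial_field(1)[OF \<phi> c x0], of "- {0}"])
       (use x0 in \<open>auto simp: grad\<close>)
  define S where "S = (frechet_derivative a (at x) (axis 1 1) *v gradient f x) $ 1
       + (frechet_derivative a (at x) (axis 2 1) *v gradient f x) $ 2"
  have S: "\<bar>S\<bar> \<le> 2 * C * (\<bar>?f\<bar> * norm x)"
    using first_order_bound[OF xR, of "gradient f x"] by (simp add: S_def grad[OF x0])
  have "elliptic_op a f x = ?f * (a x $ 1 $ 1 + a x $ 2 $ 2) + 2 * ?f' * (x \<bullet> (a x *v x)) + S"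
    unfolding elliptic_op_expand[OF Ck_on_1_has_derivative[OF C1 xR] der] S_def
    by (simp add: axis_off_diagonal inner_axis matrix_vector_right_distrib matrix_vector_mult_scaleR
        matrix_vector_mult_basis column_def inner_2 algebra_simps)
  then have "elliptic_op a f x - (2 * ?f + 2 * ?f' * (norm x)\<^sup>2) =
      ?f * ((a x $ 1 $ 1 - 1) + (a x $ 2 $ 2 - 1)) + 2 * ?f' * (x \<bullet> (a x *v x) - (norm x)\<^sup>2) + S"
    by (simp add: algebra_simps)
  also have "\<bar>\<dots>\<bar> \<le> \<bar>?f\<bar> * (C * norm x + C * norm x) + 2 * \<bar>?f'\<bar> * (C * norm x * (norm x)\<^sup>2)
      + 2 * C * (\<bar>?f\<bar> * norm x)"
  proof -
    have "\<bar>?f * ((a x $ 1 $ 1 - 1) + (a x $ 2 $ 2 - 1))\<bar> \<le> \<bar>?f\<bar> * (C * norm x + C * norm x)"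
      unfolding abs_mult using entries(2,3)[OF xR] by (intro mult_left_mono) auto
    moreover have "\<bar>2 * ?f' * (x \<bullet> (a x *v x) - (norm x)\<^sup>2)\<bar> \<le> 2 * \<bar>?f'\<bar> * (C * norm x * (norm x)\<^sup>2)"
      unfolding abs_mult using inner_near[OF xR, of x] by (intro mult_mono) auto
    ultimately show ?thesis using S by linarith
  qed
  also have "\<bar>?f\<bar> * (C * norm x + C * norm x) + 2 * \<bar>?f'\<bar> * (C * norm x * (norm x)\<^sup>2)
      + 2 * C * (\<bar>?f\<bar> * norm x) = C * norm x * (4 * \<bar>?f\<bar> + 2 * \<bar>?f'\<bar> * (norm x)\<^sup>2)"
    by algebra
  finally show ?thesis .
qed

lemma Ck_on_2_norm: "Ck_on 2 norm D"
proof -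
  have "Ck_on 2 (norm :: real^2 \<Rightarrow> real) (- {0})"
    by (rule Ck_on_2I[OF _ radial_field(2)[OF inv_sqrt_derivative cont_derivs(1)]])
       (use norm_field in auto)
  then show ?thesis by (rule Ck_on_subset) auto
qed

lemma Ck_on_2_ln_norm: "Ck_on 2 (\<lambda>x. ln (norm x)) D"
proof -
  have "Ck_on 2 (\<lambda>x::real^2. ln (norm x)) (- {0})"
    by (rule Ck_on_2I[OF _ radial_field(2)[OF inv_derivative cont_derivs(2)]])
       (use ln_norm_field in auto)
  then show ?thesis by (rule Ck_on_subset) auto
qed

text \<open>The flat Laplacian of the norm is \<open>1 / norm x\<close>, and the error is at most half of it.\<close>

lemma elliptic_op_norm:
  assumes x: "x \<in> D"
  shows "1 / (2 * norm x) \<le> elliptic_op a norm x"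
proof -
  have r: "0 < norm x" using x by auto
  have "\<bar>elliptic_op a norm x - (2 * inverse (norm x) + 2 * (- inverse (2 * norm x * (norm x)\<^sup>2)) * (norm x)\<^sup>2)\<bar>
     \<le> C * norm x * (4 * \<bar>inverse (norm x)\<bar> + 2 * \<bar>- inverse (2 * norm x * (norm x)\<^sup>2)\<bar> * (norm x)\<^sup>2)"
    using elliptic_op_radial[OF inv_sqrt_derivative cont_derivs(1) norm_field x]
    by (simp add: dot_square_norm)
  also have "2 * inverse (norm x) + 2 * (- inverse (2 * norm x * (norm x)\<^sup>2)) * (norm x)\<^sup>2 = 1 / norm x"
    using r by (simp add: field_simps)
  also have "4 * \<bar>inverse (norm x)\<bar> + 2 * \<bar>- inverse (2 * norm x * (norm x)\<^sup>2)\<bar> * (norm x)\<^sup>2 = 5 / norm x"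
    using r by (simp add: abs_mult field_simps)
  finally have "\<bar>elliptic_op a norm x - 1 / norm x\<bar> \<le> C * norm x * (5 / norm x)" .
  moreover have "C * norm x * (5 / norm x) \<le> 1 / 10 * (5 / norm x)"
    using C_norm[of x] x by (intro mult_right_mono) auto
  moreover have "1 / 10 * (5 / norm x) = 1 / norm x - 1 / (2 * norm x)"
    by (simp add: field_simps)
  ultimately show ?thesis by linarith
qed

text \<open>The logarithm is harmonic for the flat Laplacian, so only the error terms remain.\<close>

lemma elliptic_op_ln_norm:
  assumes x: "x \<in> D"
  shows "\<bar>elliptic_op a (\<lambda>x. ln (norm x)) x\<bar> \<le> 6 * C / norm x"
proof -
  have r: "0 < norm x" using x by auto
  have "\<bar>elliptic_op a (\<lambda>x. ln (norm x)) x - (2 * inverse ((norm x)\<^sup>2) + 2 * (- inverse ((norm x)\<^sup>2 * (norm x)\<^sup>2)) * (norm x)\<^sup>2)\<bar>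
     \<le> C * norm x * (4 * \<bar>inverse ((norm x)\<^sup>2)\<bar> + 2 * \<bar>- inverse ((norm x)\<^sup>2 * (norm x)\<^sup>2)\<bar> * (norm x)\<^sup>2)"
    using elliptic_op_radial[OF inv_derivative cont_derivs(2) ln_norm_field x]
    by (simp add: power2_norm_eq_inner)
  also have "2 * inverse ((norm x)\<^sup>2) + 2 * (- inverse ((norm x)\<^sup>2 * (norm x)\<^sup>2)) * (norm x)\<^sup>2 = 0"
    using r by (simp add: field_simps del: power_add)
  also have "C * norm x * (4 * \<bar>inverse ((norm x)\<^sup>2)\<bar> + 2 * \<bar>- inverse ((norm x)\<^sup>2 * (norm x)\<^sup>2)\<bar> * (norm x)\<^sup>2) = 6 * C / norm x"
    using r by (simp add: abs_mult field_simps power2_eq_square)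
  finally show ?thesis by simp
qed

end

text \<open>The Cauchy-Schwarz inequality against the constant \<open>1\<close>, from the nonnegative integral of
  \<open>(f - m)\<^sup>2\<close> with \<open>m\<close> the mean of \<open>f\<close>.\<close>

lemma power2_integral_le:
  fixes f :: "real \<Rightarrow> real"
  assumes "continuous_on {0..b} f" "0 \<le> b"
  shows "(integral {0..b} f)\<^sup>2 \<le> b * integral {0..b} (\<lambda>x. (f x)\<^sup>2)"
proof (cases "b = 0")
  case False
  then have b: "0 < b" using assms by simp
  define m where "m = integral {0..b} f / b"
  have I: "f integrable_on {0..b}" "(\<lambda>x. (f x)\<^sup>2) integrable_on {0..b}"
    using assms by (auto intro!: integrable_continuous_interval continuous_intros)
  have "((\<lambda>x. (f x)\<^sup>2 - 2 * m * f x + m\<^sup>2) has_integral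
      integral {0..b} (\<lambda>x. (f x)\<^sup>2) - 2 * m * integral {0..b} f + m\<^sup>2 * b) {0..b}"
    using has_integral_const_real[of "m\<^sup>2" 0 b] b
    by (intro has_integral_add has_integral_diff has_integral_mult_right integrable_integral I)
       (simp add: mult.commute)
  moreover have "0 \<le> (f x)\<^sup>2 - 2 * m * f x + m\<^sup>2" for x
    using zero_le_power2[of "f x - m"] by (simp add: power2_diff mult_ac)
  ultimately have "0 \<le> integral {0..b} (\<lambda>x. (f x)\<^sup>2) - 2 * m * integral {0..b} f + m\<^sup>2 * b"
    by (rule has_integral_nonneg)
  then show ?thesis using b by (simp add: m_def field_simps power2_eq_square)
qed simp

locale bounded_approximate_solution = near_identity +
  fixes u :: "real^2 \<Rightarrow> real" and K B :: real
  assumes u: "Ck_on 2 u (ball 0 R - {0})" and K: "1 \<le> K" "\<And>x. x \<in> ball 0 R - {0} \<Longrightarrow> \<bar>u x\<bar> \<le> K"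
    and B: "\<And>x. x \<in> ball 0 R - {0} \<Longrightarrow> \<bar>elliptic_op a u x\<bar> \<le> B / norm x"
begin

lemma aD: "Ck_on 1 a D" by (rule Ck_on_subset[OF C1]) auto

lemma grad_u: "x \<in> D \<Longrightarrow> (u has_derivative (\<lambda>v. gradient u x \<bullet> v)) (at x)"
proof (rule has_derivative_gradient)
  assume "x \<in> D"
  then show "u differentiable (at x)"
    using Ck_on_1_has_derivative[OF Ck_on_2D_1[OF u]] differentiableI by blast
qed

lemma grad_C1: "Ck_on 1 (gradient u) D"
  by (rule Ck_on_2_Ck_on_1_gradient[OF u])

lemma circ_in_D:
  assumes "0 < r" "r < R"
  shows "r *\<^sub>R circ \<theta> \<in> D"
proof -
  have "norm (r *\<^sub>R circ \<theta>) = r" using assms by simp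
  then show ?thesis using assms by (metis Diff_iff mem_ball_0 norm_zero order_less_irrefl singletonD)
qed

lemma cont_circ: "continuous_on T (\<lambda>\<theta>. r *\<^sub>R circ \<theta>)"
  by (intro continuous_intros)

lemma cont_on_circle:
  assumes "continuous_on D f" "0 < r" "r < R"
  shows "continuous_on T (\<lambda>\<theta>. f (r *\<^sub>R circ \<theta>))"
  by (rule continuous_on_compose2[OF assms(1) cont_circ])
     (intro image_subsetI circ_in_D assms(2,3))

text \<open>The integrand has the full gradient, not its tangential part alone. So this bounds the
  oscillation of \<open>u\<close> on the circle and, up to a factor, the flux of \<open>u a grad u\<close> through it.\<close>

definition total_variation :: "real \<Rightarrow> real" where
  "total_variation r = integral {0..2*pi} (\<lambda>\<theta>. r * norm (gradient u (r *\<^sub>R circ \<theta>)))"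

lemma cont_grad_circle:
  assumes "0 < r" "r < R"
  shows "continuous_on T (\<lambda>\<theta>. r * norm (gradient u (r *\<^sub>R circ \<theta>)))"
  by (intro continuous_on_mult_left continuous_on_norm
      cont_on_circle[OF Ck_on_1_continuous_on[OF grad_C1] assms])

lemma oscillation_le_total_variation:
  assumes "norm x = r" "norm y = r" "0 < r" "r < R"
  shows "\<bar>u x - u y\<bar> \<le> total_variation r"
proof -
  have main: "\<bar>u (r *\<^sub>R circ t) - u (r *\<^sub>R circ s)\<bar> \<le> total_variation r"
    if st: "0 \<le> s" "s \<le> t" "t \<le> 2 * pi" for s t
  proof -
    have d: "((\<lambda>\<theta>. u (r *\<^sub>R circ \<theta>)) has_vector_derivative gradient u (r *\<^sub>R circ \<theta>) \<bullet> (r *\<^sub>R circ_tangent \<theta>)) (at \<theta> within {s..t})" for \<theta>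
      by (rule has_vector_derivative_compose[OF
            bounded_linear.has_vector_derivative[OF bounded_linear_scaleR_right circ_has_derivative(1)]])
         (rule grad_u[OF circ_in_D[OF assms(3,4)]])
    have I: "((\<lambda>\<theta>. gradient u (r *\<^sub>R circ \<theta>) \<bullet> (r *\<^sub>R circ_tangent \<theta>)) has_integral
        (u (r *\<^sub>R circ t) - u (r *\<^sub>R circ s))) {s..t}"
      by (rule fundamental_theorem_of_calculus[OF st(2) d])
    let ?h = "\<lambda>\<theta>. r * norm (gradient u (r *\<^sub>R circ \<theta>))"
    have "norm (gradient u (r *\<^sub>R circ \<theta>) \<bullet> (r *\<^sub>R circ_tangent \<theta>)) \<le> ?h \<theta>" for \<theta>
      using Cauchy_Schwarz_ineq2[of "gradient u (r *\<^sub>R circ \<theta>)" "r *\<^sub>R circ_tangent \<theta>"] assms(3)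
      by (simp add: mult.commute)
    then have "norm (integral {s..t} (\<lambda>\<theta>. gradient u (r *\<^sub>R circ \<theta>) \<bullet> (r *\<^sub>R circ_tangent \<theta>))) \<le> integral {s..t} ?h"
      using has_integral_integrable[OF I] integrable_continuous_interval[OF cont_grad_circle[OF assms(3,4)]]
      by (intro integral_norm_bound_integral) auto
    also have "\<dots> \<le> integral {0..2*pi} ?h"
      using st assms(3) integrable_continuous_interval[OF cont_grad_circle[OF assms(3,4)]]
      by (intro integral_subset_le) auto
    finally show ?thesis using integral_unique[OF I] by (simp add: total_variation_def)
  qed
  obtain s where s: "0 \<le> s" "s \<le> 2 * pi" "x = norm x *\<^sub>R circ s" by (rule circ_surj)
  obtain t where t: "0 \<le> t" "t \<le> 2 * pi" "y = norm y *\<^sub>R circ t" by (rule circ_surj)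
  show ?thesis
    using main[of s t] main[of t s] s t assms by (cases "s \<le> t") (auto simp: abs_minus_commute)
qed

text \<open>Otherwise the flux \<open>J\<close> of the field \<open>u a grad u\<close> satisfies the two differential inequalities of
  \<open>no_blow_up\<close>: its derivative controls the energy of \<open>u\<close> on the circle, hence the square of the total
  variation, and \<open>J\<close> itself is at most a multiple of the total variation because \<open>u\<close> is bounded.\<close>

lemma small_total_variation:
  assumes \<delta>: "0 < \<delta>" and \<rho>: "0 < \<rho>"
  obtains r where "0 < r" "r < \<rho>" "r < R" "total_variation r < \<delta>"
proof (rule ccontr)
  assume "\<not> thesis"
  then have large: "\<delta> \<le> total_variation r" if "0 < r" "r < \<rho>" "r < R" for r
    using that \<open>\<And>r. 0 < r \<Longrightarrow> r < \<rho> \<Longrightarrow> r < R \<Longrightarrow> total_variation r < \<delta> \<Longrightarrow> thesis\<close> by force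
  let ?m = total_variation
  define Y where "Y x = u x *\<^sub>R (a x *v gradient u x)" for x
  have YC: "Ck_on 1 Y D"
    unfolding Y_def
    using Ck_on_1_bilinear[OF bounded_bilinear_matrix_vector aD grad_C1]
    by (intro Ck_on_1_bilinear[OF bounded_bilinear_scaleR] Ck_on_2D_1[OF u]) auto
  have divY: "divergence Y x = gradient u x \<bullet> (a x *v gradient u x) + u x * elliptic_op a u x"
    if x: "x \<in> D" for x
  proof -
    have X: "((\<lambda>y. a y *v gradient u y) has_derivative X') (at x) \<Longrightarrow>
       (Y has_derivative (\<lambda>v. u x *\<^sub>R X' v + (gradient u x \<bullet> v) *\<^sub>R (a x *v gradient u x))) (at x)" for X'
      unfolding Y_def using has_derivative_scaleR[OF grad_u[OF x]] by blast
    have XC: "((\<lambda>y. a y *v gradient u y) has_derivative frechet_derivative (\<lambda>y. a y *v gradient u y) (at x)) (at x)"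
      using Ck_on_1_has_derivative[OF Ck_on_1_bilinear[OF bounded_bilinear_matrix_vector aD grad_C1] x] by simp
    show ?thesis
      unfolding divergence_eq[OF X[OF XC]] elliptic_op_def divergence_eq[OF XC]
      by (simp add: inner_2 inner_axis axis_off_diagonal algebra_simps)
  qed
  define J J' where "J r = integral {0..2*pi} (\<lambda>\<theta>. r * (Y (r *\<^sub>R circ \<theta>) \<bullet> circ \<theta>))"
    and "J' r = integral {0..2*pi} (\<lambda>\<theta>. r * divergence Y (r *\<^sub>R circ \<theta>))" for r
  have J: "(J has_real_derivative J' r) (at r)" if "0 < r" "r < R" for r
    using flux_has_derivative[OF YC that] unfolding J_def J'_def .
  have Jm: "\<bar>J r\<bar> \<le> 2 * K * ?m r" if r: "0 < r" "r < R" for r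
  proof -
    have "norm (integral {0..2*pi} (\<lambda>\<theta>. r * (Y (r *\<^sub>R circ \<theta>) \<bullet> circ \<theta>)))
        \<le> integral {0..2*pi} (\<lambda>\<theta>. 2 * K * (r * norm (gradient u (r *\<^sub>R circ \<theta>))))"
    proof (rule integral_norm_bound_integral)
      show "(\<lambda>\<theta>. r * (Y (r *\<^sub>R circ \<theta>) \<bullet> circ \<theta>)) integrable_on {0..2*pi}"
        by (intro integrable_continuous_interval continuous_on_mult_left continuous_on_inner
            cont_on_circle[OF Ck_on_1_continuous_on[OF YC] r] continuous_on_circ continuous_on_id)
      show "(\<lambda>\<theta>. 2 * K * (r * norm (gradient u (r *\<^sub>R circ \<theta>)))) integrable_on {0..2*pi}"
        by (intro integrable_continuous_interval continuous_on_mult_left cont_grad_circle[OF r])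
      fix \<theta>
      let ?x = "r *\<^sub>R circ \<theta>"
      have xD: "?x \<in> D" by (rule circ_in_D[OF r])
      have "\<bar>Y ?x \<bullet> circ \<theta>\<bar> \<le> norm (Y ?x)"
        using Cauchy_Schwarz_ineq2[of "Y ?x" "circ \<theta>"] by simp
      also have "\<dots> \<le> K * (2 * norm (gradient u ?x))"
        unfolding Y_def norm_scaleR using K(2)[OF xD] norm_mult_le[of ?x "gradient u ?x"] xD K(1)
        by (intro mult_mono) auto
      finally have "r * \<bar>Y ?x \<bullet> circ \<theta>\<bar> \<le> r * (K * (2 * norm (gradient u ?x)))"
        using r by (intro mult_left_mono) auto
      then show "norm (r * (Y ?x \<bullet> circ \<theta>)) \<le> 2 * K * (r * norm (gradient u ?x))"
        using r by (simp add: abs_mult mult_ac)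
    qed
    then show ?thesis by (simp add: J_def total_variation_def)
  qed
  have J'm: "(?m r)\<^sup>2 / (4 * pi * r) - 2 * pi * K * B \<le> J' r" if r: "0 < r" "r < R" for r
  proof -
    let ?h = "\<lambda>\<theta>. r * norm (gradient u (r *\<^sub>R circ \<theta>))"
    have cd: "continuous_on D (divergence Y)"
      unfolding divergence_def[abs_def] using Ck_on_1_continuous_derivative[OF YC]
      by (intro continuous_on_sum continuous_on_component) auto
    have "(?m r)\<^sup>2 \<le> 2 * pi * integral {0..2*pi} (\<lambda>\<theta>. (?h \<theta>)\<^sup>2)"
      unfolding total_variation_def by (intro power2_integral_le cont_grad_circle[OF r]) simp
    then have "(?m r)\<^sup>2 / (4 * pi * r) \<le> 2 * pi * integral {0..2*pi} (\<lambda>\<theta>. (?h \<theta>)\<^sup>2) / (4 * pi * r)"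
      using r by (intro divide_right_mono) auto
    then have "(?m r)\<^sup>2 / (4 * pi * r) - 2 * pi * K * B \<le> (1 / (2*r)) * integral {0..2*pi} (\<lambda>\<theta>. (?h \<theta>)\<^sup>2) - K * B * (2 * pi)"
      by (simp add: mult_ac)
    also have "\<dots> = integral {0..2*pi} (\<lambda>\<theta>. (1 / (2*r)) * (?h \<theta>)\<^sup>2 - K * B)"
    proof -
      have "(\<lambda>\<theta>. (?h \<theta>)\<^sup>2) integrable_on {0..2*pi}"
        by (intro integrable_continuous_interval continuous_on_power cont_grad_circle[OF r])
      then have "((\<lambda>\<theta>. (1 / (2*r)) * (?h \<theta>)\<^sup>2 - K * B) has_integral
          (1 / (2*r)) * integral {0..2*pi} (\<lambda>\<theta>. (?h \<theta>)\<^sup>2) - (2*pi - 0) *\<^sub>R (K * B)) {0..2*pi}"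
        by (intro has_integral_diff has_integral_mult_right integrable_integral has_integral_const_real[THEN has_integral_eq_rhs]) auto
      from integral_unique[OF this] show ?thesis by (simp add: mult_ac)
    qed
    also have "\<dots> \<le> J' r"
      unfolding J'_def
    proof (rule integral_le)
      show "(\<lambda>\<theta>. (1 / (2*r)) * (?h \<theta>)\<^sup>2 - K * B) integrable_on {0..2*pi}"
        by (intro integrable_continuous_interval continuous_on_diff continuous_on_mult_left
            continuous_on_power continuous_on_const cont_grad_circle[OF r])
      show "(\<lambda>\<theta>. r * divergence Y (r *\<^sub>R circ \<theta>)) integrable_on {0..2*pi}"
        by (intro integrable_continuous_interval continuous_on_mult_left cont_on_circle[OF cd r])
      fix \<theta>
      let ?x = "r *\<^sub>R circ \<theta>"
      have xD: "?x \<in> D" by (rule circ_in_D[OF r])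
      have "\<bar>u ?x * elliptic_op a u ?x\<bar> \<le> K * (B / norm ?x)"
        unfolding abs_mult using K(1) K(2)[OF xD] B[OF xD] by (intro mult_mono) auto
      then have "- (K * B / r) \<le> u ?x * elliptic_op a u ?x"
        using r by (simp add: abs_le_iff)
      then have "(norm (gradient u ?x))\<^sup>2 / 2 - K * B / r \<le> divergence Y ?x"
        unfolding divY[OF xD] using coercive[of ?x "gradient u ?x"] xD by auto
      then have "r * ((norm (gradient u ?x))\<^sup>2 / 2 - K * B / r) \<le> r * divergence Y ?x"
        using r by (intro mult_left_mono) auto
      then show "(1 / (2*r)) * (?h \<theta>)\<^sup>2 - K * B \<le> r * divergence Y ?x"
        using r by (simp add: power_mult_distrib power2_eq_square algebra_simps)
    qed
    finally show ?thesis .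
  qed
  \<comment> \<open>Below the radius \<open>r1\<close> the lower order term is absorbed by half of the main term, since
    the total variation is at least \<open>\<delta>\<close>.\<close>
  have B0: "0 \<le> B"
  proof -
    have "0 \<le> B / norm ((R/2) *\<^sub>R circ 0)"
      using R by (intro order_trans[OF abs_ge_zero B] circ_in_D) auto
    then show ?thesis using R by (simp add: zero_le_divide_iff)
  qed
  define q where "q = 2 * pi * K * B + 1"
  have "0 \<le> 2 * pi * K * B" using K(1) B0 by simp
  then have q: "0 < q" unfolding q_def by linarith
  define r1 where "r1 = min (min \<rho> R) (\<delta>\<^sup>2 / (8 * pi * q))"
  have r1: "0 < r1" using \<delta> \<rho> R q by (simp add: r1_def)
  have main: "(?m r)\<^sup>2 / (8 * pi * r) \<le> J' r" "\<delta>\<^sup>2 \<le> (?m r)\<^sup>2" if r: "0 < r" "r < r1" for r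
  proof -
    have r': "r < \<rho>" "r < R" "r < \<delta>\<^sup>2 / (8 * pi * q)" using r by (auto simp: r1_def)
    show m: "\<delta>\<^sup>2 \<le> (?m r)\<^sup>2" using large[OF r(1) r'(1,2)] \<delta> by (intro power_mono) auto
    have "r * (8 * pi * q) < \<delta>\<^sup>2"
      using r'(3) q by (simp add: pos_less_divide_eq)
    then have "q * (8 * pi * r) \<le> (?m r)\<^sup>2" using m by (simp add: mult_ac)
    then have "q \<le> (?m r)\<^sup>2 / (8 * pi * r)" using r by (simp add: pos_le_divide_eq)
    moreover have "(?m r)\<^sup>2 / (4 * pi * r) = (?m r)\<^sup>2 / (8 * pi * r) + (?m r)\<^sup>2 / (8 * pi * r)"
      using r by (simp add: field_simps)
    ultimately show "(?m r)\<^sup>2 / (8 * pi * r) \<le> J' r" using J'm[OF r(1) r'(2)] by (simp add: q_def)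
  qed
  show False
  proof (rule no_blow_up[of "1 / (8 * pi * (4 * K\<^sup>2))" "\<delta>\<^sup>2 / (8 * pi)" r1 J J'])
    fix r assume r: "0 < r" "r < r1"
    then have rR: "r < R" by (simp add: r1_def)
    show "(J has_real_derivative J' r) (at r)" by (rule J[OF r(1) rR])
    have "\<bar>J r\<bar>\<^sup>2 \<le> (2 * K * ?m r)\<^sup>2" using Jm[OF r(1) rR] by (intro power_mono) auto
    then have "(J r)\<^sup>2 / (4 * K\<^sup>2) \<le> (?m r)\<^sup>2"
      using K(1) by (simp add: power_mult_distrib divide_le_eq mult_ac)
    then have "(J r)\<^sup>2 / (4 * K\<^sup>2) / (8 * pi * r) \<le> (?m r)\<^sup>2 / (8 * pi * r)"
      using r by (intro divide_right_mono) auto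
    then show "1 / (8 * pi * (4 * K\<^sup>2)) * (J r)\<^sup>2 / r \<le> J' r"
      using main(1)[OF r] by (simp add: mult_ac)
    have "\<delta>\<^sup>2 / (8 * pi * r) \<le> (?m r)\<^sup>2 / (8 * pi * r)"
      using main(2)[OF r] r by (intro divide_right_mono) auto
    then show "\<delta>\<^sup>2 / (8 * pi) / r \<le> J' r" using main(1)[OF r] by (simp add: mult_ac)
  qed (use K(1) \<delta> r1 in auto)
qed

text \<open>The multiple of the norm outweighs \<open>elliptic_op a u\<close>, which is \<open>O(1 / norm x)\<close>, and so makes both \<open>u\<close>
  and \<open>-u\<close> strict subsolutions.\<close>

lemma annulus_bound:
  assumes \<sigma>: "\<sigma> = 1 \<or> \<sigma> = -1" and r: "0 < r1" "r1 \<le> norm x" "norm x \<le> r2" "r2 < R"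
  obtains y where "norm y = r1 \<or> norm y = r2"
    "\<sigma> * u x + (2 * \<bar>B\<bar> + 1) * norm x \<le> \<sigma> * u y + (2 * \<bar>B\<bar> + 1) * norm y"
proof -
  let ?c = "2 * \<bar>B\<bar> + 1"
  define K' where "K' = cball (0::real^2) r2 - ball 0 r1"
  have K'D: "K' \<subseteq> D" using r by (auto simp: K'_def)
  obtain y where y: "y \<in> K' - interior K'" "\<sigma> * u x + ?c * norm x \<le> \<sigma> * u y + ?c * norm y"
  proof (rule maximum_principle[of K' D "\<lambda>x. \<sigma> * u x + ?c * norm x" a x])
    show "compact K'" unfolding K'_def by (simp add: compact_diff)
    show "K' \<subseteq> D" "open D" by (rule K'D, rule open_D)
    show "Ck_on 2 (\<lambda>x. \<sigma> * u x + ?c * norm x) D"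
      by (rule Ck_on_2_lincomb[OF open_D u Ck_on_2_norm])
    show "Ck_on 1 a D" by (rule aD)
    show "x \<in> K'" using r by (auto simp: K'_def)
    fix z assume z: "z \<in> D"
    then have zR: "z \<in> ball 0 R" and z0: "0 < norm z" by auto
    show "a z $ 1 $ 2 = a z $ 2 $ 1" "0 < a z $ 1 $ 1" "0 \<le> a z $ 1 $ 1 * a z $ 2 $ 2 - a z $ 1 $ 2 * a z $ 2 $ 1"
      by (rule entries[OF zR] elliptic[OF zR])+
    have "\<bar>\<sigma> * elliptic_op a u z\<bar> \<le> \<bar>B\<bar> / norm z"
      using B[OF z] \<sigma> divide_right_mono[OF abs_ge_self[of B], of "norm z"] by (auto simp: abs_mult)
    moreover have "?c * (1 / (2 * norm z)) \<le> ?c * elliptic_op a norm z"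
      by (intro mult_left_mono elliptic_op_norm z) auto
    moreover have "?c * (1 / (2 * norm z)) = \<bar>B\<bar> / norm z + 1 / (2 * norm z)"
      using z0 by (simp add: field_simps)
    moreover have "0 < 1 / (2 * norm z)" using z0 by simp
    ultimately show "0 < elliptic_op a (\<lambda>x. \<sigma> * u x + ?c * norm x) z"
      unfolding elliptic_op_lincomb[OF open_D z aD u Ck_on_2_norm] by (simp only: abs_le_iff) linarith
  qed
  have "norm y = r1 \<or> norm y = r2"
  proof (rule ccontr)
    assume "\<not> ?thesis"
    then have "y \<in> ball 0 r2 - cball 0 r1" using y(1) by (auto simp: K'_def)
    moreover have "ball (0::real^2) r2 - cball 0 r1 \<subseteq> interior K'"
      by (rule interior_maximal) (auto simp: K'_def open_Diff)
    ultimately show False using y(1) by blast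
  qed
  then show ?thesis using y(2) that by blast
qed

text \<open>Choose radii \<open>\<rho> n\<close> tending to \<open>0\<close> with total variation tending to \<open>0\<close> and, by compactness, a
  subsequence along which the values of \<open>u\<close> on these circles converge to a number \<open>l\<close>. Any point
  close to the origin lies between two of the circles, where the annulus bound applies to \<open>u\<close> and \<open>-u\<close>.\<close>

theorem has_limit: "\<exists>l. (u \<longlongrightarrow> l) (at 0)"
proof -
  let ?c = "2 * \<bar>B\<bar> + 1"
  have "\<exists>r. 0 < r \<and> r < R \<and> r < 1 / Suc n \<and> total_variation r < 1 / Suc n" for n
    by (rule small_total_variation[of "1 / Suc n" "1 / Suc n"]) auto
  then obtain \<rho> where \<rho>: "\<And>n. 0 < \<rho> n" "\<And>n. \<rho> n < R" "\<And>n. \<rho> n < 1 / Suc n"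
    "\<And>n. total_variation (\<rho> n) < 1 / Suc n" by metis
  define x where "x n = \<rho> n *\<^sub>R circ 0" for n
  have nx: "norm (x n) = \<rho> n" for n using \<rho>(1)[of n] by (simp add: x_def)
  have xD: "x n \<in> D" for n unfolding x_def by (rule circ_in_D[OF \<rho>(1,2)])
  have "bounded (range (\<lambda>n. u (x n)))"
    unfolding bounded_iff using K(2)[OF xD] by auto
  then obtain l s where s: "strict_mono s" "((\<lambda>n. u (x n)) \<circ> s) \<longlonglongrightarrow> l"
    using bounded_imp_convergent_subsequence by blast
  have inv: "(\<lambda>n. 1 / real (Suc n)) \<longlonglongrightarrow> 0" by (rule lim_1_over_n[THEN LIMSEQ_Suc])
  have "(u \<longlongrightarrow> l) (at 0)"
  proof (rule tendstoI)
    fix e :: real assume e: "0 < e"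
    \<comment> \<open>On a good circle \<open>u\<close> is within \<open>2 \<epsilon>\<close> of \<open>l\<close>, and the correction term is at most \<open>?c * \<epsilon>\<close>.\<close>
    define \<epsilon> where "\<epsilon> = e / (3 + ?c)"
    have \<epsilon>: "0 < \<epsilon>" "(2 + ?c) * \<epsilon> < e" using e by (auto simp: \<epsilon>_def field_simps)
    have "\<forall>\<^sub>F n in sequentially. \<bar>u (x (s n)) - l\<bar> < \<epsilon>"
      using tendstoD[OF s(2) \<epsilon>(1)] by (simp add: dist_real_def)
    moreover have "\<forall>\<^sub>F n in sequentially. 1 / real (Suc n) < \<epsilon>"
      using order_tendstoD(2)[OF inv \<epsilon>(1)] .
    ultimately obtain N where N: "\<And>n. N \<le> n \<Longrightarrow> \<bar>u (x (s n)) - l\<bar> < \<epsilon>" "\<And>n. N \<le> n \<Longrightarrow> 1 / real (Suc n) < \<epsilon>"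
      unfolding eventually_sequentially by (metis nle_le order_trans)
    have small: "1 / real (Suc (s n)) < \<epsilon>" if "N \<le> n" for n
      using N(2)[of "s n"] that seq_suble[OF s(1), of n] by linarith
    have onsphere: "\<bar>u y - l\<bar> < 2 * \<epsilon>" "?c * norm y < ?c * \<epsilon>" if "N \<le> n" "norm y = \<rho> (s n)" for n y
    proof -
      have "\<bar>u y - u (x (s n))\<bar> \<le> total_variation (\<rho> (s n))"
        by (rule oscillation_le_total_variation[OF that(2) nx \<rho>(1,2)])
      also have "\<dots> < \<epsilon>" using \<rho>(4)[of "s n"] small[OF that(1)] by linarith
      finally show "\<bar>u y - l\<bar> < 2 * \<epsilon>" using N(1)[OF that(1)] by linarith
      show "?c * norm y < ?c * \<epsilon>" unfolding that(2)
        using \<rho>(3)[of "s n"] small[OF that(1)] by (intro mult_strict_left_mono) auto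
    qed
    have near: "dist (u y) l < e" if y: "y \<noteq> 0" "norm y < \<rho> (s N)" for y
    proof -
      have "\<forall>\<^sub>F n in sequentially. 1 / real (Suc n) < norm y"
        using order_tendstoD(2)[OF inv] y by auto
      then obtain M where M: "\<And>n. M \<le> n \<Longrightarrow> 1 / real (Suc n) < norm y"
        unfolding eventually_sequentially by blast
      define n where "n = max M N"
      have n: "N \<le> n" "\<rho> (s n) \<le> norm y"
        using M[of "s n"] seq_suble[OF s(1), of n] \<rho>(3)[of "s n"] by (auto simp: n_def)
      have bd: "\<sigma> * u y < \<sigma> * l + e" if \<sigma>: "\<sigma> = 1 \<or> \<sigma> = -1" for \<sigma>
      proof -
        obtain z where z: "norm z = \<rho> (s n) \<or> norm z = \<rho> (s N)"
          "\<sigma> * u y + ?c * norm y \<le> \<sigma> * u z + ?c * norm z"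
          by (rule annulus_bound[OF \<sigma> \<rho>(1) n(2) less_imp_le[OF y(2)] \<rho>(2)])
        have "\<bar>u z - l\<bar> < 2 * \<epsilon>" "?c * norm z < ?c * \<epsilon>" using z(1) onsphere n(1) by blast+
        moreover have "\<sigma> * u z - \<sigma> * l \<le> \<bar>u z - l\<bar>" using \<sigma> by auto
        moreover have "0 \<le> ?c * norm y" by simp
        moreover have "2 * \<epsilon> + ?c * \<epsilon> < e" using \<epsilon>(2) by (simp add: algebra_simps)
        ultimately show ?thesis using z(2) by linarith
      qed
      from bd[of 1] bd[of "-1"] show ?thesis by (auto simp: dist_real_def abs_less_iff)
    qed
    show "\<forall>\<^sub>F y in at 0. dist (u y) l < e"
      unfolding eventually_at using near \<rho>(1) by (intro exI[of _ "\<rho> (s N)"]) auto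
  qed
  then show ?thesis ..
qed

end

context near_identity
begin

text \<open>Subtracting the logarithm leaves a bounded function, and costs only an error of order \<open>1 / norm x\<close> in
  the equation.\<close>

theorem logarithmic_singularity_limit:
  assumes \<psi>: "Ck_on 2 \<psi> D" "\<And>x. x \<in> D \<Longrightarrow> elliptic_op a \<psi> x = 0"
    and bd: "\<And>x. x \<in> D \<Longrightarrow> \<bar>\<psi> x - \<kappa> * ln (norm x)\<bar> \<le> K"
  shows "\<exists>l. ((\<lambda>x. \<psi> x - \<kappa> * ln (norm x)) \<longlongrightarrow> l) (at 0)"
proof -
  have aD: "Ck_on 1 a D" by (rule Ck_on_subset[OF C1]) auto
  interpret bounded_approximate_solution a R C "\<lambda>x. 1 * \<psi> x + (- \<kappa>) * ln (norm x)" "max 1 K" "6 * C * \<bar>\<kappa>\<bar>"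
  proof
    show "Ck_on 2 (\<lambda>x. 1 * \<psi> x + (- \<kappa>) * ln (norm x)) D"
      by (rule Ck_on_2_lincomb[OF open_D \<psi>(1) Ck_on_2_ln_norm])
    show "1 \<le> max 1 K" by simp
    fix x :: "real^2" assume x: "x \<in> D"
    show "\<bar>1 * \<psi> x + (- \<kappa>) * ln (norm x)\<bar> \<le> max 1 K" using bd[OF x] by simp
    have "\<bar>- \<kappa> * elliptic_op a (\<lambda>x. ln (norm x)) x\<bar> \<le> \<bar>\<kappa>\<bar> * (6 * C / norm x)"
      unfolding abs_mult abs_minus_cancel using elliptic_op_ln_norm[OF x] by (rule mult_left_mono) simp
    then show "\<bar>elliptic_op a (\<lambda>x. 1 * \<psi> x + (- \<kappa>) * ln (norm x)) x\<bar> \<le> 6 * C * \<bar>\<kappa>\<bar> / norm x"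
      unfolding elliptic_op_lincomb[OF open_D x aD \<psi>(1) Ck_on_2_ln_norm]
      by (simp add: \<psi>(2)[OF x] mult_ac)
  qed
  show ?thesis using has_limit by simp
qed

end

section \<open>The limit at a logarithmic singularity, in arbitrary coordinates\<close>

text \<open>By the mean value inequality a bound on the derivative of \<open>a\<close> on a compact disc also bounds
  \<open>a x - mat 1\<close> by a multiple of \<open>norm x\<close>; shrinking the disc makes \<open>C * R\<close> small.\<close>

lemma near_identity_exists:
  fixes a :: "real^2 \<Rightarrow> real^2^2"
  assumes U: "open U" "0 \<in> U" and a: "Ck_on 1 a U" "a 0 = mat 1"
    and sym: "\<And>x. x \<in> U \<Longrightarrow> transpose (a x) = a x"
  obtains R C where "near_identity a R C" "ball 0 R \<subseteq> U"
proof -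
  obtain r where r: "0 < r" "cball 0 r \<subseteq> U"
    using U open_contains_cball by blast
  define a' where "a' x = frechet_derivative a (at x)" for x
  have a': "(a has_derivative a' x) (at x)" if "x \<in> U" for x
    unfolding a'_def by (rule Ck_on_1_has_derivative[OF a(1) that])
  have "\<exists>M. \<forall>x\<in>cball 0 r. norm (a' x v) \<le> M" for v
  proof -
    have "continuous_on (cball 0 r) (\<lambda>x. a' x v)"
      unfolding a'_def by (rule continuous_on_subset[OF Ck_on_1_continuous_derivative[OF a(1)] r(2)])
    then have "bounded ((\<lambda>x. a' x v) ` cball 0 r)"
      by (intro compact_imp_bounded compact_continuous_image) auto
    then show ?thesis unfolding bounded_iff by auto
  qed
  then obtain M where M: "\<And>v x. x \<in> cball 0 r \<Longrightarrow> norm (a' x v) \<le> M v" by metis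
  define m where "m = \<bar>M (axis 1 1)\<bar> + \<bar>M (axis 2 1)\<bar>"
  have m0: "0 \<le> m" by (simp add: m_def)
  have m: "norm (a' x v) \<le> m * norm v" if x: "x \<in> cball 0 r" for x v
  proof -
    have "a' x v = v$1 *\<^sub>R a' x (axis 1 1) + v$2 *\<^sub>R a' x (axis 2 1)"
      using a'[of x] r(2) x by (intro linear_expand_2 has_derivative_linear) auto
    then have "norm (a' x v) \<le> \<bar>v$1\<bar> * norm (a' x (axis 1 1)) + \<bar>v$2\<bar> * norm (a' x (axis 2 1))"
      by (metis norm_scaleR norm_triangle_ineq)
    also have "\<dots> \<le> norm v * \<bar>M (axis 1 1)\<bar> + norm v * \<bar>M (axis 2 1)\<bar>"
      using M[OF x, of "axis 1 1"] M[OF x, of "axis 2 1"]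
      by (intro add_mono mult_mono component_le_norm_cart) auto
    finally show ?thesis by (simp add: m_def algebra_simps)
  qed
  obtain k where k: "0 < k" "\<And>A x. norm ((A::real^2^2) *v x) \<le> norm A * norm x * k"
    using bounded_bilinear.pos_bounded[OF bounded_bilinear_matrix_vector] by auto
  define C where "C = m * k"
  define R where "R = min r (1 / (10 * (C + 1)))"
  have C0: "0 \<le> C" using m0 k by (simp add: C_def)
  have R: "0 < R" "R \<le> r" using r C0 by (auto simp: R_def)
  have sub: "ball 0 R \<subseteq> cball 0 r" using R by auto
  have lip: "norm (a x - a 0) \<le> m * norm x" if x: "x \<in> cball 0 r" for x
  proof -
    have "norm (a x - a 0) \<le> m * norm (x - 0)"
    proof (rule differentiable_bound[of "cball 0 r" a a'])
      show "(a has_derivative a' y) (at y within cball 0 r)" if "y \<in> cball 0 r" for y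
        by (rule has_derivative_at_withinI[OF a']) (use r(2) that in blast)
      show "onorm (a' y) \<le> m" if "y \<in> cball 0 r" for y
        by (rule onorm_le[OF m[OF that]])
    qed (use x r in auto)
    then show ?thesis by simp
  qed
  have "near_identity a R C"
  proof
    show "0 < R" "0 \<le> C" by fact+
    have "C * R \<le> (C + 1) * (1 / (10 * (C + 1)))"
      using C0 R by (intro mult_mono) (auto simp: R_def)
    also have "\<dots> = 1 / 10" using C0 by simp
    finally show "C * R \<le> 1 / 10" .
    show "Ck_on 1 a (ball 0 R)"
      by (rule Ck_on_subset[OF a(1)]) (use sub r(2) in blast)
    fix x :: "real^2" and v w assume "x \<in> ball 0 R"
    then have x: "x \<in> cball 0 r" using sub by blast
    then have xU: "x \<in> U" using r(2) by blast
    show "transpose (a x) = a x" by (rule sym[OF xU])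
    have "a x *v v - v = (a x - a 0) *v v"
      by (simp add: matrix_vector_mult_diff_rdistrib a(2))
    also have "norm \<dots> \<le> norm (a x - a 0) * norm v * k" by (rule k(2))
    also have "\<dots> \<le> m * norm x * norm v * k"
      using lip[OF x] k(1) by (intro mult_right_mono) auto
    finally show "norm (a x *v v - v) \<le> C * norm x * norm v" by (simp add: C_def mult_ac)
    have "norm (a' x v *v w) \<le> norm (a' x v) * norm w * k" by (rule k(2))
    also have "\<dots> \<le> m * norm v * norm w * k"
      using m[OF x, of v] k(1) by (intro mult_right_mono) auto
    finally show "norm (frechet_derivative a (at x) v *v w) \<le> C * norm v * norm w"
      by (simp add: C_def a'_def mult_ac)
  qed
  then show ?thesis using that sub r(2) by blast
qed

definition adjugate :: "real^2^2 \<Rightarrow> real^2^2" where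
  "adjugate M = (\<chi> i j. if i = j then (if i = 1 then M$2$2 else M$1$1) else - M$i$j)"

lemma adjugate_nth [simp]:
  "adjugate M $ 1 $ 1 = M$2$2" "adjugate M $ 2 $ 2 = M$1$1"
  "adjugate M $ 1 $ 2 = - M$1$2" "adjugate M $ 2 $ 1 = - M$2$1"
  by (simp_all add: adjugate_def)

lemma matrix_eq_2: "(A::'a^2^2) = B \<longleftrightarrow>
    A$1$1 = B$1$1 \<and> A$1$2 = B$1$2 \<and> A$2$1 = B$2$1 \<and> A$2$2 = B$2$2"
  by (auto simp: vec_eq_iff forall_2)

lemma matrix_matrix_nth_2: "((A::real^2^2) ** B) $ i $ j = A$i$1 * B$1$j + A$i$2 * B$2$j"
  by (simp add: matrix_matrix_mult_def sum_2)

lemma matrix_vector_nth_2: "((A::real^2^2) *v x) $ i = A$i$1 * x$1 + A$i$2 * x$2"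
  by (simp add: matrix_vector_mult_def sum_2)

lemma mat_1_nth_2 [simp]: "(mat 1 :: real^2^2) $ 1 $ 1 = 1" "(mat 1 :: real^2^2) $ 2 $ 2 = 1"
  "(mat 1 :: real^2^2) $ 1 $ 2 = 0" "(mat 1 :: real^2^2) $ 2 $ 1 = 0"
  by (simp_all add: mat_def)

lemma transpose_nth [simp]: "transpose A $ i $ j = A $ j $ i"
  by (simp add: transpose_def)

lemma matrix_inv_2:
  fixes M :: "real^2^2"
  assumes "det M \<noteq> 0"
  shows "matrix_inv M = inverse (det M) *\<^sub>R adjugate M"
proof -
  let ?A = "inverse (det M) *\<^sub>R adjugate M"
  have A: "M ** ?A = mat 1" "?A ** M = mat 1"
    using assms unfolding matrix_eq_2 matrix_matrix_nth_2
    by (simp_all add: det_2 divide_simps mult_ac)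
  then have "M ** matrix_inv M = mat 1"
    unfolding matrix_inv_def by (metis (mono_tags, lifting) someI_ex)
  then have "?A ** (M ** matrix_inv M) = ?A" by simp
  then show ?thesis by (simp add: matrix_mul_assoc A(2))
qed

lemma linear_adjugate: "bounded_linear adjugate"
  by (intro linear_conv_bounded_linear[THEN iffD1] linearI) (simp_all add: matrix_eq_2)

lemma Ck_on_1_matrix_entry:
  fixes G :: "real^2 \<Rightarrow> real^2^2"
  assumes "Ck_on 1 G U"
  shows "Ck_on 1 (\<lambda>x. G x $ i $ j) U"
  using Ck_on_1_bounded_linear[OF bounded_linear_compose[OF bounded_linear_vec_nth bounded_linear_vec_nth] assms]
  by simp

lemma positive_definite_2:
  fixes M :: "real^2^2"
  assumes "transpose M = M" "\<And>v. v \<noteq> 0 \<Longrightarrow> v \<bullet> (M *v v) > 0"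
  shows "M$2$1 = M$1$2" "M$1$1 > 0" "det M > 0"
proof -
  show 1: "M$2$1 = M$1$2" using arg_cong[OF assms(1), of "\<lambda>A. A$1$2"] by simp
  show 2: "M$1$1 > 0"
    using assms(2)[of "axis 1 1"] by (simp add: inner_2 matrix_vector_nth_2 axis_off_diagonal axis_eq_0_iff)
  have "vector [- M$1$2, M$1$1] \<noteq> (0 :: real^2)"
    using 2 by (metis vector_2(2) zero_index less_irrefl)
  from assms(2)[OF this] have "0 < M$1$1 * det M"
    by (simp add: inner_2 matrix_vector_nth_2 det_2 1 algebra_simps)
  then show "det M > 0" using 2 by (simp add: zero_less_mult_iff)
qed

text \<open>The columns of \<open>B\<close> are the Gram-Schmidt orthonormalization of the coordinate basis for the inner
  product with Gram matrix \<open>M\<close>, and \<open>Bi\<close> gives the coordinates in this frame.\<close>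

lemma orthonormal_frame:
  fixes M :: "real^2^2"
  assumes "transpose M = M" "\<And>v. v \<noteq> 0 \<Longrightarrow> v \<bullet> (M *v v) > 0"
  obtains Bi B :: "real^2^2" where "Bi = transpose B ** M" "B ** Bi = mat 1" "Bi ** B = mat 1"
    "\<And>v. sqrt (v \<bullet> (M *v v)) = norm (Bi *v v)"
proof -
  note pd = positive_definite_2[OF assms]
  define e \<Delta> where "e = sqrt (M$1$1)" and "\<Delta> = sqrt (det M)"
  have e: "0 < e" "M$1$1 = e * e" and \<Delta>: "0 < \<Delta>" "det M = \<Delta> * \<Delta>"
    using pd by (auto simp: e_def \<Delta>_def)
  define B :: "real^2^2" where "B = vector [vector [1 / e, - M$1$2 / (e * \<Delta>)], vector [0, e / \<Delta>]]"
  have "e * e * M$2$2 = \<Delta> * \<Delta> + M$1$2 * M$1$2"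
    using \<Delta>(2) e(2) by (simp add: det_2 pd(1))
  then have M22: "M$2$2 = (\<Delta> * \<Delta> + M$1$2 * M$1$2) / (e * e)"
    using e by (simp add: field_simps)
  have "transpose B ** M ** B = mat 1"
    unfolding matrix_eq_2 matrix_matrix_nth_2 using e(1) \<Delta>(1)
    by (simp add: B_def pd(1) e(2) M22 divide_simps algebra_simps)
  then have BiB: "(transpose B ** M) ** B = mat 1" by (simp add: matrix_mul_assoc)
  then have BBi: "B ** (transpose B ** M) = mat 1" by (simp add: matrix_left_right_inverse)
  have "v \<bullet> (M *v v) = ((transpose B ** M) *v v) \<bullet> ((transpose B ** M) *v v)" for v
  proof -
    have "((transpose B ** M) *v v) \<bullet> ((transpose B ** M) *v v) = (M *v v) \<bullet> (B *v ((transpose B ** M) *v v))"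
      by (simp add: dot_lmul_matrix transpose_matrix_vector flip: matrix_vector_mul_assoc)
    also have "\<dots> = v \<bullet> (M *v v)" by (simp only: matrix_vector_mul_assoc BBi matrix_vector_mul_lid inner_commute)
    finally show ?thesis by simp
  qed
  then show ?thesis by (intro that[OF refl BBi BiB]) (simp add: norm_eq_sqrt_inner)
qed

text \<open>The derivative of the transformed field is conjugate to that of \<open>X\<close>, up to the factor \<open>k\<close>, so it has
  the same trace up to this factor.\<close>

lemma divergence_linear_change:
  fixes X :: "real^2 \<Rightarrow> real^2" and B Bi :: "real^2^2"
  assumes X: "(X has_derivative X') (at (x0 + B *v y))" and B: "B ** Bi = mat 1"
  shows "divergence (\<lambda>y. k *\<^sub>R (Bi *v X (x0 + B *v y))) y = k * divergence X (x0 + B *v y)"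
proof -
  have "((\<lambda>y. x0 + B *v y) has_derivative (\<lambda>v. B *v v)) (at y)"
    by (auto intro!: derivative_eq_intros bounded_linear.has_derivative[OF matrix_vector_mul_bounded_linear])
  from has_derivative_compose[OF this X]
  have "((\<lambda>y. k *\<^sub>R (Bi *v X (x0 + B *v y))) has_derivative (\<lambda>v. k *\<^sub>R (Bi *v X' (B *v v)))) (at y)"
    by (intro bounded_linear.has_derivative[OF bounded_linear_scaleR_right]
        bounded_linear.has_derivative[OF matrix_vector_mul_bounded_linear])
  from divergence_eq[OF this]
  have div: "divergence (\<lambda>y. k *\<^sub>R (Bi *v X (x0 + B *v y))) y
    = k * ((Bi *v X' (B *v axis 1 1)) $ 1 + (Bi *v X' (B *v axis 2 1)) $ 2)"
    by (simp add: algebra_simps)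
  define t where "t i j = X' (axis j 1) $ i" for i j :: 2
  have X'B: "X' (B *v axis j 1) $ i = B$1$j * t i 1 + B$2$j * t i 2" for i j
    by (subst linear_expand_2[OF has_derivative_linear[OF X]])
       (simp add: t_def matrix_vector_mult_basis column_def)
  have "(Bi *v X' (B *v axis 1 1)) $ 1 + (Bi *v X' (B *v axis 2 1)) $ 2
    = t 1 1 * (B ** Bi) $ 1 $ 1 + t 1 2 * (B ** Bi) $ 2 $ 1 + t 2 1 * (B ** Bi) $ 1 $ 2 + t 2 2 * (B ** Bi) $ 2 $ 2"
    unfolding matrix_vector_nth_2 matrix_matrix_nth_2 X'B by (simp add: algebra_simps)
  also have "\<dots> = divergence X (x0 + B *v y)"
    by (simp add: B divergence_eq[OF X] t_def)
  finally show ?thesis unfolding div by simp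
qed

lemma laplace_beltrami_coord_divergence:
  assumes X: "Ck_on 1 (\<lambda>y. (sqrt (det (G y)) *\<^sub>R matrix_inv (G y)) *v gradient f y) U" and x: "x \<in> U"
  shows "laplace_beltrami_coord G f x =
    divergence (\<lambda>y. (sqrt (det (G y)) *\<^sub>R matrix_inv (G y)) *v gradient f y) x / sqrt (det (G x))"
proof -
  let ?X = "\<lambda>y. (sqrt (det (G y)) *\<^sub>R matrix_inv (G y)) *v gradient f y"
  have eq: "sqrt (det (G y)) * (\<Sum>j\<in>UNIV. matrix_inv (G y) $ i $ j * partial_deriv j f y) = ?X y $ i" for i y
    by (simp add: matrix_vector_mult_def gradient_def sum_2 algebra_simps)
  have "partial_deriv i (\<lambda>y. ?X y $ i) x = frechet_derivative ?X (at x) (axis i 1) $ i" for i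
  proof -
    have "((\<lambda>y. ?X y $ i) has_derivative (\<lambda>v. frechet_derivative ?X (at x) v $ i)) (at x)"
      by (rule bounded_linear.has_derivative[OF bounded_linear_vec_nth Ck_on_1_has_derivative[OF X x]])
    from frechet_derivative_at[OF this, symmetric] show ?thesis
      by (simp add: partial_deriv_def)
  qed
  then show ?thesis unfolding laplace_beltrami_coord_def eq divergence_def by simp
qed

text \<open>In the coordinate \<open>y\<close> with \<open>x = x0 + B y\<close>, for an orthonormal frame \<open>B\<close> of \<open>G x0\<close>, the norm of the
  displacement becomes the Euclidean norm of \<open>y\<close>. The equation keeps its divergence form, with
  coefficient \<open>Bi a Bi\<^sup>T\<close>; divided by \<open>sqrt (det (G x0))\<close> this is the identity at the origin.\<close>

theorem harmonic_logarithmic_singularity_limit: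
  fixes G :: "real^2 \<Rightarrow> real^2^2" and \<psi> :: "real^2 \<Rightarrow> real"
  assumes U: "open U" "x0 \<in> U" and G: "Ck_on 1 G U"
    and pd: "\<And>x. x \<in> U \<Longrightarrow> transpose (G x) = G x"
      "\<And>x v. x \<in> U \<Longrightarrow> v \<noteq> 0 \<Longrightarrow> v \<bullet> (G x *v v) > 0"
    and \<psi>: "Ck_on 2 \<psi> (U - {x0})" "\<And>x. x \<in> U - {x0} \<Longrightarrow> laplace_beltrami_coord G \<psi> x = 0"
    and bd: "\<And>x. x \<in> U - {x0} \<Longrightarrow>
        \<bar>\<psi> x - \<kappa> * ln (sqrt ((x - x0) \<bullet> (G x0 *v (x - x0))))\<bar> \<le> K"
  shows "\<exists>l. ((\<lambda>x. \<psi> x - \<kappa> * ln (sqrt ((x - x0) \<bullet> (G x0 *v (x - x0))))) \<longlongrightarrow> l) (at x0)"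
proof -
  define W where "W = U - {x0}"
  have oW: "open W" unfolding W_def using U(1) by (simp add: open_Diff)
  have pd2: "G x $ 2 $ 1 = G x $ 1 $ 2" "0 < det (G x)" if "x \<in> U" for x
    using positive_definite_2[OF pd(1)[OF that] pd(2)[OF that]] by auto
  define a where "a x = sqrt (det (G x)) *\<^sub>R matrix_inv (G x)" for x
  have a_eq: "a x = inverse (sqrt (det (G x))) *\<^sub>R adjugate (G x)" if "x \<in> U" for x
  proof -
    have "0 < det (G x)" using pd2(2)[OF that] by simp
    moreover have "sqrt d * inverse d = inverse (sqrt d)" if "0 < d" for d :: real
      using that by (metis abs_of_pos divide_inverse inverse_eq_divide real_div_sqrt
          real_sqrt_gt_zero less_imp_le nonzero_inverse_inverse_eq inverse_divide)
    ultimately show ?thesis by (simp add: a_def matrix_inv_2)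
  qed
  have aC: "Ck_on 1 a U"
  proof (rule Ck_on_cong[OF U(1)])
    have e: "Ck_on 1 (\<lambda>x. G x $ i $ j * G x $ k $ l) U" for i j k l
      by (intro Ck_on_1_bilinear[OF bounded_bilinear_mult] Ck_on_1_matrix_entry G)
    have "Ck_on 1 (\<lambda>x. det (G x)) U"
      using Ck_on_1_add[OF e[of 1 1 2 2] Ck_on_1_bounded_linear[OF bounded_linear_minus[OF bounded_linear_ident] e[of 1 2 2 1]]]
      by (simp add: det_2)
    then have "Ck_on 1 (\<lambda>x. inverse (sqrt (det (G x)))) U"
    proof (rule Ck_on_1_compose_real[where \<phi> = "\<lambda>s. inverse (sqrt s)"])
      show "((\<lambda>s. inverse (sqrt s)) has_real_derivative - inverse (2 * sqrt (det (G x)) * det (G x))) (at (det (G x)))"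
        if "x \<in> U" for x
        using pd2(2)[OF that] inv_sqrt_derivative by blast
      show "continuous_on ((\<lambda>x. det (G x)) ` U) (\<lambda>s. - inverse (2 * sqrt s * s))"
        using pd2(2) by (fastforce intro!: continuous_intros)
    qed
    then show "Ck_on 1 (\<lambda>x. inverse (sqrt (det (G x))) *\<^sub>R adjugate (G x)) U"
      by (intro Ck_on_1_bilinear[OF bounded_bilinear_scaleR] Ck_on_1_bounded_linear[OF linear_adjugate] G)
  qed (simp add: a_eq)
  define X where "X y = a y *v gradient \<psi> y" for y
  have XC: "Ck_on 1 X W"
    unfolding X_def
    using Ck_on_1_bilinear[OF bounded_bilinear_matrix_vector Ck_on_subset[OF aC, of W] Ck_on_2_Ck_on_1_gradient]
      \<psi>(1) by (simp add: W_def)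
  have divX: "divergence X x = 0" if x: "x \<in> W" for x
  proof -
    have "laplace_beltrami_coord G \<psi> x = divergence X x / sqrt (det (G x))"
      using laplace_beltrami_coord_divergence[of G \<psi> W x] XC x unfolding X_def a_def by blast
    moreover have "0 < det (G x)" using pd2(2)[of x] x by (simp add: W_def)
    ultimately show ?thesis using \<psi>(2)[of x] x by (simp add: W_def)
  qed
  obtain Bi B :: "real^2^2" where Bi: "Bi = transpose B ** G x0"
    and BBi: "B ** Bi = mat 1" and BiB: "Bi ** B = mat 1"
    and NBi: "\<And>v. sqrt (v \<bullet> (G x0 *v v)) = norm (Bi *v v)"
    by (rule orthonormal_frame[of "G x0"], rule pd(1)[OF U(2)], erule pd(2)[OF U(2)], rule that)
  define \<Phi> where "\<Phi> y = x0 + B *v y" for y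
  have BBiv: "B *v (Bi *v v) = v" for v by (simp add: matrix_vector_mul_assoc BBi)
  have BiBv: "Bi *v (B *v v) = v" for v by (simp add: matrix_vector_mul_assoc BiB)
  have N: "sqrt ((B *v v) \<bullet> (G x0 *v (B *v v))) = norm v" for v
    by (simp only: NBi BiBv)
  have bl: "bounded_linear (\<lambda>y. B *v y)" by simp
  have \<Phi>0: "\<Phi> y = x0 \<longleftrightarrow> y = 0" for y
    using BiBv[of y] by (auto simp: \<Phi>_def matrix_vector_mult_0_right)
  have oV: "open (\<Phi> -` U)" unfolding \<Phi>_def
    by (intro open_vimage[OF U(1)] continuous_on_add continuous_on_const bounded_linear.continuous_on[OF bl] continuous_on_id)
  define k where "k = sqrt (det (G x0))"
  define c where "c y = inverse k *\<^sub>R (Bi ** a (\<Phi> y) ** transpose Bi)" for y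
  have k: "0 < k" using pd2(2)[OF U(2)] by (simp add: k_def)
  have linc: "bounded_linear (\<lambda>M. inverse k *\<^sub>R (Bi ** M ** transpose Bi))"
    by (intro linear_conv_bounded_linear[THEN iffD1] linearI)
       (simp_all add: matrix_eq_2 matrix_matrix_nth_2 algebra_simps)
  have cC: "Ck_on 1 c (\<Phi> -` U)"
    unfolding c_def \<Phi>_def by (intro Ck_on_1_bounded_linear[OF linc] Ck_on_compose_affine[OF bl U(1) aC])
  have G0: "G x0 ** adjugate (G x0) = (k * k) *\<^sub>R mat 1"
    using pd2(2)[OF U(2)] by (simp add: k_def matrix_eq_2 matrix_matrix_nth_2 det_2)
  have c0: "c 0 = mat 1"
  proof -
    have tBi: "transpose Bi = G x0 ** B"
      by (simp add: Bi matrix_transpose_mul pd(1)[OF U(2)])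
    have "c 0 = inverse k *\<^sub>R (transpose B ** G x0 ** (inverse k *\<^sub>R adjugate (G x0)) ** (G x0 ** B))"
      by (simp add: c_def \<Phi>_def a_eq[OF U(2)] tBi) (simp add: Bi k_def)
    also have "\<dots> = (inverse k * inverse k) *\<^sub>R (transpose B ** (G x0 ** adjugate (G x0)) ** (G x0 ** B))"
      by (simp add: matrix_scalar_ac scalar_matrix_assoc matrix_mul_assoc flip: scalar_matrix_assoc)
    also have "\<dots> = mat 1"
    proof -
      have "P ** (t *\<^sub>R mat 1) ** Q = t *\<^sub>R (P ** Q)" for t and P Q :: "real^2^2"
        by (simp add: matrix_eq_2 matrix_matrix_nth_2 algebra_simps)
      from this[of "transpose B" "k * k" "G x0 ** B"]
      have "transpose B ** (G x0 ** adjugate (G x0)) ** (G x0 ** B) = (k * k) *\<^sub>R mat 1"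
        by (simp only: G0 matrix_mul_assoc BiB[unfolded Bi])
      moreover have "inverse k * inverse k * (k * k) = 1" using k by (simp add: field_simps)
      ultimately show ?thesis by simp
    qed
    finally show ?thesis .
  qed
  have csym: "transpose (c y) = c y" if "y \<in> \<Phi> -` U" for y
  proof -
    have "a (\<Phi> y) $ 2 $ 1 = a (\<Phi> y) $ 1 $ 2"
      using that pd2(1)[of "\<Phi> y"] by (simp add: a_eq)
    then show ?thesis by (simp add: c_def matrix_eq_2 matrix_matrix_nth_2 algebra_simps)
  qed
  obtain R C where RC: "near_identity c R C" and RU: "ball 0 R \<subseteq> \<Phi> -` U"
    using near_identity_exists[OF oV _ cC c0 csym] U(2) \<Phi>0[of 0] by auto
  define D where "D = ball (0::real^2) R - {0}"
  have DW: "\<Phi> y \<in> W" if "y \<in> D" for y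
    using that RU \<Phi>0[of y] by (auto simp: D_def W_def)
  define \<psi>' where "\<psi>' y = \<psi> (\<Phi> y)" for y
  have \<psi>'C: "Ck_on 2 \<psi>' D"
    using Ck_on_compose_affine[OF bl oW, of 2 \<psi> x0] \<psi>(1) DW
    unfolding \<psi>'_def \<Phi>_def W_def by (auto elim!: Ck_on_subset)
  have grad: "gradient \<psi>' y = transpose B *v gradient \<psi> (\<Phi> y)" if "y \<in> D" for y
  proof (rule gradient_unique)
    have "\<psi> differentiable (at (\<Phi> y))"
      using Ck_on_1_has_derivative[OF Ck_on_2D_1[OF \<psi>(1)]] DW[OF that] differentiableI unfolding W_def by blast
    then have "(\<psi> has_derivative (\<lambda>v. gradient \<psi> (\<Phi> y) \<bullet> v)) (at (\<Phi> y))"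
      by (rule has_derivative_gradient)
    moreover have "(\<Phi> has_derivative (\<lambda>v. B *v v)) (at y)"
      unfolding \<Phi>_def by (auto intro!: derivative_eq_intros bounded_linear.has_derivative[OF bl])
    ultimately have "(\<psi>' has_derivative (\<lambda>v. gradient \<psi> (\<Phi> y) \<bullet> (B *v v))) (at y)"
      unfolding \<psi>'_def by (rule has_derivative_compose[rotated])
    then show "(\<psi>' has_derivative (\<lambda>v. (transpose B *v gradient \<psi> (\<Phi> y)) \<bullet> v)) (at y)"
      by (simp add: dot_lmul_matrix transpose_matrix_vector)
  qed
  have oD: "open D" by (simp add: D_def open_Diff)
  have ell: "elliptic_op c \<psi>' y = 0" if y: "y \<in> D" for y
  proof -
    have XX: "(X has_derivative frechet_derivative X (at (x0 + B *v y))) (at (x0 + B *v y))"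
      using Ck_on_1_has_derivative[OF XC DW[OF y]] by (simp add: \<Phi>_def)
    let ?Z = "\<lambda>y. inverse k *\<^sub>R (Bi *v X (x0 + B *v y))"
    have Z0: "divergence ?Z y = 0"
      using divergence_linear_change[OF XX BBi, of "inverse k"] divX[OF DW[OF y]] by (simp add: \<Phi>_def)
    have eq: "c z *v gradient \<psi>' z = ?Z z" if "z \<in> D" for z
    proof -
      have "transpose Bi ** transpose B = mat 1"
        by (simp add: BBi flip: matrix_transpose_mul)
      then have "transpose Bi *v (transpose B *v w) = w" for w
        by (simp only: matrix_vector_mul_assoc matrix_vector_mul_lid)
      then show ?thesis
        by (simp only: c_def grad[OF that] X_def \<Phi>_def flip: scaleR_matrix_vector_assoc matrix_vector_mul_assoc)
    qed
    have "((\<lambda>y. x0 + B *v y) has_derivative (\<lambda>v. B *v v)) (at y)"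
      by (auto intro!: derivative_eq_intros bounded_linear.has_derivative[OF bl])
    from has_derivative_compose[OF this XX]
    have "(?Z has_derivative (\<lambda>v. inverse k *\<^sub>R (Bi *v frechet_derivative X (at (x0 + B *v y)) (B *v v)))) (at y)"
      by (intro bounded_linear.has_derivative[OF bounded_linear_scaleR_right]
          bounded_linear.has_derivative[OF matrix_vector_mul_bounded_linear])
    then have "divergence (\<lambda>z. c z *v gradient \<psi>' z) y = divergence ?Z y"
      by (rule divergence_transform[OF _ oD y]) (rule eq[symmetric])
    with Z0 show ?thesis by (simp only: elliptic_op_def)
  qed
  have bd': "\<bar>\<psi>' y - \<kappa> * ln (norm y)\<bar> \<le> K" if "y \<in> D" for y
    using bd[of "\<Phi> y"] DW[OF that] N[of y] by (simp add: \<psi>'_def W_def \<Phi>_def)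
  obtain l where l: "((\<lambda>y. \<psi>' y - \<kappa> * ln (norm y)) \<longlongrightarrow> l) (at 0)"
    using near_identity.logarithmic_singularity_limit[OF RC, of \<psi>' \<kappa> K] \<psi>'C ell bd'
    unfolding D_def by blast
  have "filterlim (\<lambda>x. Bi *v (x - x0)) (at 0) (at x0)"
  proof (rule filterlim_atI)
    have "((\<lambda>x. Bi *v (x - x0)) \<longlongrightarrow> Bi *v (x0 - x0)) (at x0)"
      by (intro bounded_linear.tendsto[OF matrix_vector_mul_bounded_linear] tendsto_intros)
    then show "((\<lambda>x. Bi *v (x - x0)) \<longlongrightarrow> 0) (at x0)" by simp
    have "Bi *v (x - x0) \<noteq> 0" if "x \<noteq> x0" for x
      using BBiv[of "x - x0"] that by (metis matrix_vector_mult_0_right right_minus_eq)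
    then show "\<forall>\<^sub>F x in at x0. Bi *v (x - x0) \<noteq> 0"
      by (auto simp: eventually_at intro: exI[of _ 1])
  qed
  from filterlim_compose[OF l this]
  have "((\<lambda>x. \<psi>' (Bi *v (x - x0)) - \<kappa> * ln (norm (Bi *v (x - x0)))) \<longlongrightarrow> l) (at x0)" .
  moreover have "\<psi>' (Bi *v (x - x0)) = \<psi> x" for x by (simp add: \<psi>'_def \<Phi>_def BBiv)
  moreover have "norm (Bi *v (x - x0)) = sqrt ((x - x0) \<bullet> (G x0 *v (x - x0)))" for x
    by (simp only: NBi)
  ultimately show ?thesis by auto
qed

section \<open>Paths on a surface\<close>

lemma consecutive_points:
  fixes P :: "real set"
  assumes "finite P" "a \<in> P" "b \<in> P" "a < t" "t < b" "t \<notin> P"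
  obtains p q where "p \<in> P" "q \<in> P" "p < t" "t < q" "{p<..<q} \<inter> P = {}"
proof -
  define p q where "p = Max {x \<in> P. x < t}" and "q = Min {x \<in> P. t < x}"
  have p: "p \<in> {x \<in> P. x < t}" "\<And>x. x \<in> P \<Longrightarrow> x < t \<Longrightarrow> x \<le> p"
    unfolding p_def using assms by (intro Max_in Max_ge; auto)+
  have q: "q \<in> {x \<in> P. t < x}" "\<And>x. x \<in> P \<Longrightarrow> t < x \<Longrightarrow> q \<le> x"
    unfolding q_def using assms by (intro Min_in Min_le; auto)+
  have "{p<..<q} \<inter> P = {}"
    using p(2) q(2) assms(6) by (force simp: not_less[symmetric])
  then show ?thesis using that p(1) q(1) by blast
qed

lemma piecewise_C1_pathE:
  assumes "piecewise_C1_path S A \<gamma>"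
  obtains P where "finite P" "{0, 1} \<subseteq> P" "P \<subseteq> {0..1}"
    "\<And>a b. a \<in> P \<Longrightarrow> b \<in> P \<Longrightarrow> a < b \<Longrightarrow> {a<..<b} \<inter> P = {} \<Longrightarrow> C1_segment A \<gamma> a b"
proof -
  have "\<exists>P. finite P \<and> {0, 1} \<subseteq> P \<and> P \<subseteq> {0..1} \<and>
        (\<forall>a\<in>P. \<forall>b\<in>P. a < b \<and> {a<..<b} \<inter> P = {} \<longrightarrow> C1_segment A \<gamma> a b)"
    using assms unfolding piecewise_C1_path_def by (elim conjE)
  then obtain P where P: "finite P \<and> {0, 1} \<subseteq> P \<and> P \<subseteq> {0..1} \<and>
        (\<forall>a\<in>P. \<forall>b\<in>P. a < b \<and> {a<..<b} \<inter> P = {} \<longrightarrow> C1_segment A \<gamma> a b)" ..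
  show ?thesis by (rule that[of P]) (use P in blast)+
qed

text \<open>Lengths and the asymptotics of the distance are a matter of continuous metrics. In this generality they
  apply to \<open>g\<close> and to \<open>h\<^sup>2 g\<close> alike.\<close>

locale continuous_metric_surface =
  fixes S :: "'a::t2_space set" and A :: "'a chart set" and g :: "'a metric_field"
  assumes surface: "oriented_surface S A"
    and g_cont: "c \<in> A \<Longrightarrow> continuous_on (fst c) (g c)"
    and g_sym: "c \<in> A \<Longrightarrow> p \<in> fst c \<Longrightarrow> transpose (g c p) = g c p"
    and g_pos: "c \<in> A \<Longrightarrow> p \<in> fst c \<Longrightarrow> v \<noteq> 0 \<Longrightarrow> v \<bullet> (g c p *v v) > 0"
    and g_trans: "c \<in> A \<Longrightarrow> c' \<in> A \<Longrightarrow> p \<in> fst c \<inter> fst c' \<Longrightarrow>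
        g c p = transpose (jacobian_matrix (transition c c') (snd c p)) ** g c' p **
                jacobian_matrix (transition c c') (snd c p)"
begin

lemma chart:
  assumes "c \<in> A"
  shows "openin (top_of_set S) (fst c)" "fst c \<subseteq> S" "open (snd c ` fst c)"
    "continuous_on (fst c) (snd c)" "continuous_on (snd c ` fst c) (inv_into (fst c) (snd c))"
    "inj_on (snd c) (fst c)"
proof -
  have "is_chart S c" using surface assms by (simp add: oriented_surface_def)
  then show 1: "openin (top_of_set S) (fst c)" "open (snd c ` fst c)" "continuous_on (fst c) (snd c)"
      "continuous_on (snd c ` fst c) (inv_into (fst c) (snd c))"
    and "inj_on (snd c) (fst c)"
    by (auto simp: is_chart_def homeomorphism_def intro: inj_on_inverseI)
  show "fst c \<subseteq> S" using openin_subset[OF 1(1)] by simp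
qed

lemma chart_inv: "c \<in> A \<Longrightarrow> p \<in> fst c \<Longrightarrow> inv_into (fst c) (snd c) (snd c p) = p"
  by (rule inv_into_f_f[OF chart(6)])

lemma exists_chart: "p \<in> S \<Longrightarrow> \<exists>c\<in>A. p \<in> fst c"
  using surface unfolding oriented_surface_def by blast

lemma transition_eq: "c \<in> A \<Longrightarrow> p \<in> fst c \<Longrightarrow> transition c c' (snd c p) = snd c' p"
  by (simp add: transition_def chart_repr_def chart_inv)

lemma transition_C1:
  assumes "c \<in> A" "c' \<in> A"
  shows "Ck_on 1 (transition c c') (snd c ` (fst c \<inter> fst c'))"
  using surface assms unfolding oriented_surface_def smooth_on_def by blast

lemma stays_in_chart:
  fixes \<gamma> :: "real \<Rightarrow> 'a"
  assumes "continuous_on T \<gamma>" "\<gamma> ` T \<subseteq> S" "t \<in> T" "c \<in> A" "\<gamma> t \<in> fst c"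
  obtains d where "0 < d" "\<And>s. s \<in> T \<Longrightarrow> dist s t < d \<Longrightarrow> \<gamma> s \<in> fst c"
proof -
  obtain U where U: "open U" "fst c = S \<inter> U"
    using chart(1)[OF assms(4)] by (auto simp: openin_open)
  have "\<forall>\<^sub>F s in at t within T. \<gamma> s \<in> U"
    using assms(1,3,5) U by (intro topological_tendstoD) (auto simp: continuous_on_def)
  then obtain d where "0 < d" "\<And>s. s \<in> T \<Longrightarrow> s \<noteq> t \<Longrightarrow> dist s t < d \<Longrightarrow> \<gamma> s \<in> U"
    unfolding eventually_at by auto
  then show ?thesis using that[of d] U assms(2,5) by (metis Int_iff image_subset_iff)
qed

lemma jacobian_apply:
  assumes "c \<in> A" "c' \<in> A" "p \<in> fst c \<inter> fst c'"
  shows "jacobian_matrix (transition c c') (snd c p) *v v = frechet_derivative (transition c c') (at (snd c p)) v"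
  unfolding jacobian_matrix_def
  using Ck_on_1_has_derivative[OF transition_C1[OF assms(1,2)], of "snd c p"] assms(3)
  by (intro matrix_works) (auto intro: has_derivative_linear simp: linear_matrix_vector_mul_eq)

text \<open>The chain rule for the transition map. Coordinate maps are arbitrary outside their domains, so the
  transition map relates the two coordinate curves only at times near \<open>t\<close>.\<close>

lemma velocity_transform:
  fixes \<gamma> :: "real \<Rightarrow> 'a"
  assumes \<gamma>: "continuous_on T \<gamma>" "\<gamma> ` T \<subseteq> S" "t \<in> T" and c: "c \<in> A" "c' \<in> A" "\<gamma> t \<in> fst c \<inter> fst c'"
    and v: "((snd c \<circ> \<gamma>) has_vector_derivative v) (at t within T)"
  shows "((snd c' \<circ> \<gamma>) has_vector_derivative jacobian_matrix (transition c c') (snd c (\<gamma> t)) *v v) (at t within T)"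
proof -
  obtain d where d: "0 < d" "\<And>s. s \<in> T \<Longrightarrow> dist s t < d \<Longrightarrow> \<gamma> s \<in> fst c"
    using stays_in_chart[OF \<gamma> c(1)] c(3) by blast
  have "(transition c c' has_derivative frechet_derivative (transition c c') (at (snd c (\<gamma> t)))) (at (snd c (\<gamma> t)))"
    using c(3) by (intro Ck_on_1_has_derivative[OF transition_C1[OF c(1,2)]]) auto
  then have "((\<lambda>s. transition c c' ((snd c \<circ> \<gamma>) s)) has_vector_derivative
      frechet_derivative (transition c c') (at (snd c (\<gamma> t))) v) (at t within T)"
    by (intro has_vector_derivative_compose[OF v]) simp
  then show ?thesis
    unfolding jacobian_apply[OF c]
    by (rule has_vector_derivative_transform_within[OF _ d(1) \<gamma>(3)])
       (simp add: transition_eq[OF c(1)] d(2))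
qed

text \<open>The transformation law of the metric cancels the Jacobian of the transition map, so that any chart
  may replace the one selected in the definition of the speed.\<close>

lemma speed_eq:
  fixes \<gamma> :: "real \<Rightarrow> 'a"
  assumes \<gamma>: "continuous_on {a..b} \<gamma>" "\<gamma> ` {a..b} \<subseteq> S" "a < t" "t < b"
    and c: "c \<in> A" "\<gamma> t \<in> fst c"
    and v: "((snd c \<circ> \<gamma>) has_vector_derivative v) (at t)"
  shows "speed A g \<gamma> t = sqrt (v \<bullet> (g c (\<gamma> t) *v v))"
proof -
  define c' where "c' = (SOME c. c \<in> A \<and> \<gamma> t \<in> fst c)"
  have c': "c' \<in> A" "\<gamma> t \<in> fst c'"
    using someI[of "\<lambda>c. c \<in> A \<and> \<gamma> t \<in> fst c" c] c by (simp_all add: c'_def)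
  define J where "J = jacobian_matrix (transition c c') (snd c (\<gamma> t))"
  have at: "at t within {a..b} = at t" by (rule at_within_Icc_at[OF \<gamma>(3,4)])
  have "((snd c' \<circ> \<gamma>) has_vector_derivative J *v v) (at t)"
    using velocity_transform[OF \<gamma>(1,2) _ c(1) c'(1), of t v] \<gamma>(3,4) c(2) c'(2) v
    unfolding at J_def by simp
  then have "vector_derivative (snd c' \<circ> \<gamma>) (at t) = J *v v"
    by (rule vector_derivative_at)
  then have "speed A g \<gamma> t = sqrt ((J *v v) \<bullet> (g c' (\<gamma> t) *v (J *v v)))"
    by (simp add: speed_def Let_def c'_def[symmetric])
  also have "(J *v v) \<bullet> (g c' (\<gamma> t) *v (J *v v)) = v \<bullet> ((transpose J ** g c' (\<gamma> t) ** J) *v v)"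
    by (simp add: inner_2 matrix_vector_nth_2 matrix_matrix_nth_2 algebra_simps)
  also have "transpose J ** g c' (\<gamma> t) ** J = g c (\<gamma> t)"
    using g_trans[OF c(1) c'(1)] c c' by (simp add: J_def)
  finally show ?thesis .
qed

lemma speed_nonneg:
  assumes "\<gamma> t \<in> S"
  shows "0 \<le> speed A g \<gamma> t"
proof -
  define c where "c = (SOME c. c \<in> A \<and> \<gamma> t \<in> fst c)"
  have "\<exists>c. c \<in> A \<and> \<gamma> t \<in> fst c" using exists_chart[OF assms] by blast
  from someI_ex[OF this] have c: "c \<in> A" "\<gamma> t \<in> fst c" by (simp_all add: c_def)
  have "0 \<le> v \<bullet> (g c (\<gamma> t) *v v)" for v
    using g_pos[OF c, of v] by (cases "v = 0") auto
  then show ?thesis by (simp add: speed_def Let_def c_def[symmetric])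
qed

text \<open>On a short interval the path stays in a single chart, where the speed agrees with a continuous function
  except possibly at the end points; bisection glues these intervals together. Integrability is
  essential for lower bounds, as the integral of a function that is not integrable is \<open>0\<close> by
  convention.\<close>

lemma speed_integrable_C1_segment:
  fixes \<gamma> :: "real \<Rightarrow> 'a"
  assumes \<gamma>: "continuous_on {a..b} \<gamma>" "\<gamma> ` {a..b} \<subseteq> S" "a \<le> b" and seg: "C1_segment A \<gamma> a b"
  shows "speed A g \<gamma> integrable_on {a..b}"
proof -
  have "a \<le> a \<longrightarrow> b \<le> b \<longrightarrow> speed A g \<gamma> integrable_on {a..b}"
    using \<gamma>(3)
  proof (induction rule: Bolzano[of a b "\<lambda>s t. a \<le> s \<longrightarrow> t \<le> b \<longrightarrow> speed A g \<gamma> integrable_on {s..t}"])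
    case (trans s t u)
    show ?case
    proof (intro impI)
      assume "a \<le> s" "u \<le> b"
      then show "speed A g \<gamma> integrable_on {s..u}"
        by (intro Henstock_Kurzweil_Integration.integrable_combine[OF trans(3,4)]
            trans(1,2)[THEN mp, THEN mp]) (use trans(3,4) in linarith)+
    qed
  next
    case (local x)
    then have x: "x \<in> {a..b}" by auto
    obtain c where c: "c \<in> A" "\<gamma> x \<in> fst c"
      using exists_chart \<gamma>(2) x by blast
    obtain d where d: "0 < d" "\<And>s. s \<in> {a..b} \<Longrightarrow> dist s x < d \<Longrightarrow> \<gamma> s \<in> fst c"
      using stays_in_chart[OF \<gamma>(1,2) x c] by blast
    obtain v where v: "\<And>t. t \<in> {a..b} \<inter> \<gamma> -` fst c \<Longrightarrow> ((snd c \<circ> \<gamma>) has_vector_derivative v t) (at t within {a..b})"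
      and vc: "continuous_on ({a..b} \<inter> \<gamma> -` fst c) v"
      using seg c(1) unfolding C1_segment_def by blast
    have "speed A g \<gamma> integrable_on {s..t}" if st: "s \<le> x" "x \<le> t" "t - s < d" "a \<le> s" "t \<le> b" for s t
    proof -
      have sub: "{s..t} \<subseteq> {a..b}" using st by auto
      have inc: "\<gamma> r \<in> fst c" if "r \<in> {s..t}" for r
        using that st by (intro d(2)) (auto simp: dist_real_def)
      have \<gamma>c: "continuous_on {s..t} \<gamma>" by (rule continuous_on_subset[OF \<gamma>(1) sub])
      have "continuous_on {s..t} v"
        using sub inc by (intro continuous_on_subset[OF vc]) auto
      moreover have "continuous_on {s..t} (\<lambda>r. g c (\<gamma> r))"
        using inc by (intro continuous_on_compose2[OF g_cont[OF c(1)] \<gamma>c]) auto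
      ultimately have "continuous_on {s..t} (\<lambda>r. sqrt (v r \<bullet> (g c (\<gamma> r) *v v r)))"
        by (intro continuous_on_real_sqrt continuous_on_inner
            bounded_bilinear.continuous_on[OF bounded_bilinear_matrix_vector, unfolded split_beta fst_conv snd_conv])
      then have "(\<lambda>r. sqrt (v r \<bullet> (g c (\<gamma> r) *v v r))) integrable_on {s..t}"
        by (rule integrable_continuous_interval)
      moreover have "speed A g \<gamma> r = sqrt (v r \<bullet> (g c (\<gamma> r) *v v r))" if "r \<in> {s..t} - {s, t}" for r
      proof (rule speed_eq[OF \<gamma>(1,2) _ _ c(1) inc])
        show r: "a < r" "r < b" "r \<in> {s..t}" using that st by auto
        show "((snd c \<circ> \<gamma>) has_vector_derivative v r) (at r)"
          using v[of r] inc[OF r(3)] r(1,2) by (simp add: at_within_Icc_at)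
      qed
      ultimately show ?thesis
        by (intro integrable_spike_finite[of "{s, t}" "{s..t}" "speed A g \<gamma>"]) auto
    qed
    then show ?case using d(1) by blast
  qed
  then show ?thesis by simp
qed

lemma speed_integrable:
  assumes "piecewise_C1_path S A \<gamma>"
  shows "speed A g \<gamma> integrable_on {0..1}"
proof -
  obtain P where P: "finite P" "{0, 1} \<subseteq> P" "P \<subseteq> {0..1}"
    and seg: "\<And>a b. a \<in> P \<Longrightarrow> b \<in> P \<Longrightarrow> a < b \<Longrightarrow> {a<..<b} \<inter> P = {} \<Longrightarrow> C1_segment A \<gamma> a b"
    by (rule piecewise_C1_pathE[OF assms], rule that)
  have \<gamma>: "continuous_on {0..1} \<gamma>" "\<gamma> ` {0..1} \<subseteq> S"
    using assms by (auto simp: piecewise_C1_path_def path_def path_image_def)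
  have "speed A g \<gamma> integrable_on {0..t}" if "t \<in> P" for t
    using that
  proof (induction "card {x \<in> P. x < t}" arbitrary: t rule: less_induct)
    case less
    show ?case
    proof (cases "t = 0")
      case True
      then show ?thesis using integrable_on_refl[of "speed A g \<gamma>" 0] by simp
    next
      case False
      have "t \<in> {0..1}" using less.prems P(3) by (rule rev_subsetD)
      with False have t: "0 < t" "t \<le> 1" by auto
      define p where "p = Max {x \<in> P. x < t}"
      have p: "p \<in> {x \<in> P. x < t}" "\<And>x. x \<in> P \<Longrightarrow> x < t \<Longrightarrow> x \<le> p"
        unfolding p_def using P t by (intro Max_in Max_ge; auto)+
      have p0: "0 \<le> p" using p(1) P(3) by auto
      have sub: "{p..t} \<subseteq> {0..1}" using p0 t by auto
      have "{x \<in> P. x < p} \<subset> {x \<in> P. x < t}" using p(1) by auto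
      then have "card {x \<in> P. x < p} < card {x \<in> P. x < t}"
        using P(1) by (intro psubset_card_mono) auto
      then have 1: "speed A g \<gamma> integrable_on {0..p}" using less.hyps p(1) by simp
      have "{p<..<t} \<inter> P = {}" using p(2) by force
      then have "C1_segment A \<gamma> p t" using seg p(1) less.prems by simp
      then have 2: "speed A g \<gamma> integrable_on {p..t}"
        using p(1) \<gamma>(2) sub by (intro speed_integrable_C1_segment continuous_on_subset[OF \<gamma>(1)]) auto
      have "p \<le> t" using p(1) by simp
      from Henstock_Kurzweil_Integration.integrable_combine[OF p0 this 1 2] show ?thesis .
    qed
  qed
  then show ?thesis using P(2) by simp
qed

lemma length_nonneg:
  assumes "piecewise_C1_path S A \<gamma>"
  shows "0 \<le> riemannian_length A g \<gamma>"
  unfolding riemannian_length_def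
proof (rule integral_nonneg[OF speed_integrable[OF assms]])
  fix t :: real assume "t \<in> {0..1}"
  then have "\<gamma> t \<in> S" using assms by (auto simp: piecewise_C1_path_def path_image_def)
  then show "0 \<le> speed A g \<gamma> t" by (rule speed_nonneg)
qed

end

section \<open>The geodesic distance near a point\<close>

text \<open>A chart with a coordinate ball of radius \<open>\<rho>\<close> about \<open>s0\<close> on which the metric differs from its value at
  \<open>s0\<close> by a factor between \<open>1 - \<epsilon>\<close> and \<open>1 + \<epsilon>\<close>. The ball and the reference norm are those of the frame
  coordinates \<open>Bi\<close>.\<close>

locale almost_flat_chart = continuous_metric_surface S A g
  for S :: "'a::t2_space set" and A :: "'a chart set" and g :: "'a metric_field" +
  fixes c :: "'a chart" and s0 :: 'a and B Bi :: "real^2^2" and \<epsilon> \<rho> :: real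
  assumes c: "c \<in> A" "s0 \<in> fst c" and BBi: "B ** Bi = mat 1" and BiB: "Bi ** B = mat 1"
    and \<epsilon>: "0 < \<epsilon>" "\<epsilon> < 1" and \<rho>: "0 < \<rho>"
    and ball: "norm (Bi *v (y - snd c s0)) \<le> \<rho> \<Longrightarrow> y \<in> snd c ` fst c"
    and lower: "p \<in> fst c \<Longrightarrow> norm (Bi *v (snd c p - snd c s0)) \<le> \<rho> \<Longrightarrow>
        (1 - \<epsilon>) * norm (Bi *v v) \<le> sqrt (v \<bullet> (g c p *v v))"
    and upper: "p \<in> fst c \<Longrightarrow> norm (Bi *v (snd c p - snd c s0)) \<le> \<rho> \<Longrightarrow>
        sqrt (v \<bullet> (g c p *v v)) \<le> (1 + \<epsilon>) * norm (Bi *v v)"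
begin

definition radius :: "'a \<Rightarrow> real" where
  "radius p = norm (Bi *v (snd c p - snd c s0))"

lemma radius_centre: "radius s0 = 0" by (simp add: radius_def)

text \<open>The segment of straight coordinates from \<open>p\<close> to the centre stays in the ball, and its velocity is
  constant in this chart. Its differentiability in the other charts comes from the transition maps.\<close>

lemma straight_path:
  assumes p: "p \<in> fst c" "radius p \<le> \<rho>"
  obtains \<gamma> where "piecewise_C1_path S A \<gamma>" "pathstart \<gamma> = p" "pathfinish \<gamma> = s0"
    "riemannian_length A g \<gamma> \<le> (1 + \<epsilon>) * radius p"
proof -
  define w where "w = snd c s0 - snd c p"
  define l where "l t = snd c p + t *\<^sub>R w" for t
  define \<gamma> where "\<gamma> t = inv_into (fst c) (snd c) (l t)" for t
  have Nw: "norm (Bi *v w) = radius p"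
    by (simp add: w_def radius_def matrix_vector_mult_diff_distrib norm_minus_commute)
  have Nl: "norm (Bi *v (l t - snd c s0)) \<le> \<rho>" if "t \<in> {0..1}" for t
  proof -
    have "l t - snd c s0 = (t - 1) *\<^sub>R w" by (simp add: l_def w_def algebra_simps)
    then have "norm (Bi *v (l t - snd c s0)) = \<bar>t - 1\<bar> * radius p"
      by (simp add: matrix_vector_mult_scaleR Nw)
    also have "\<dots> \<le> 1 * radius p"
      using that by (intro mult_right_mono) (auto simp: radius_def)
    finally show ?thesis using p(2) by simp
  qed
  have lW: "l t \<in> snd c ` fst c" if "t \<in> {0..1}" for t using ball[OF Nl[OF that]] .
  have \<gamma>c: "\<gamma> t \<in> fst c" "snd c (\<gamma> t) = l t" if "t \<in> {0..1}" for t
    unfolding \<gamma>_def using lW[OF that] by (auto intro: inv_into_into f_inv_into_f)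
  have lcont: "continuous_on T l" for T unfolding l_def by (intro continuous_intros)
  have \<gamma>cont: "continuous_on {0..1} \<gamma>"
    unfolding \<gamma>_def using lW by (intro continuous_on_compose2[OF chart(5)[OF c(1)] lcont]) auto
  have \<gamma>S: "\<gamma> ` {0..1} \<subseteq> S" using \<gamma>c(1) chart(2)[OF c(1)] by blast
  have l': "(l has_vector_derivative w) (at t within T)" for t T
    unfolding l_def by (auto intro!: derivative_eq_intros simp: has_vector_derivative_def)
  have dl: "((snd c \<circ> \<gamma>) has_vector_derivative w) (at t within {0..1})" if "t \<in> {0..1}" for t
    by (rule has_vector_derivative_transform_within[OF l' zero_less_one that]) (simp add: \<gamma>c(2))
  have seg: "C1_segment A \<gamma> 0 1"
    unfolding C1_segment_def
  proof (intro ballI exI conjI)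
    fix c' assume c': "c' \<in> A"
    let ?T = "{0..1} \<inter> \<gamma> -` fst c'"
    let ?v = "\<lambda>t. frechet_derivative (transition c c') (at (l t)) w"
    show "((snd c' \<circ> \<gamma>) has_vector_derivative ?v t) (at t within {0..1})" if "t \<in> ?T" for t
    proof -
      have t: "t \<in> {0..1}" "\<gamma> t \<in> fst c'" using that by auto
      have "\<gamma> t \<in> fst c \<inter> fst c'" using \<gamma>c(1)[OF t(1)] t(2) by simp
      from velocity_transform[OF \<gamma>cont \<gamma>S t(1) c(1) c' this dl[OF t(1)]] jacobian_apply[OF c(1) c' this, of w]
      show ?thesis by (simp add: \<gamma>c(2)[OF t(1)])
    qed
    have "l t \<in> snd c ` (fst c \<inter> fst c')" if "t \<in> ?T" for t
    proof -
      have t: "t \<in> {0..1}" "\<gamma> t \<in> fst c'" using that by auto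
      then show ?thesis using \<gamma>c[OF t(1)] by (metis IntI imageI)
    qed
    then show "continuous_on ?T ?v"
      by (intro continuous_on_compose2[OF Ck_on_1_continuous_derivative[OF transition_C1[OF c(1) c']] lcont]) auto
  qed
  have pc: "piecewise_C1_path S A \<gamma>"
    unfolding piecewise_C1_path_def path_def path_image_def
  proof (intro conjI exI[of _ "{0, 1}"])
    show "\<forall>a\<in>{0, 1}. \<forall>b\<in>{0, 1}. a < b \<and> {a<..<b} \<inter> {0, 1} = {} \<longrightarrow> C1_segment A \<gamma> a b"
      using seg by auto
  qed (use \<gamma>cont \<gamma>S in auto)
  moreover have "pathstart \<gamma> = p" "pathfinish \<gamma> = s0"
    using chart_inv[OF c(1)] p(1) c(2) by (simp_all add: pathstart_def pathfinish_def \<gamma>_def l_def w_def)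
  moreover have "riemannian_length A g \<gamma> \<le> (1 + \<epsilon>) * radius p"
  proof -
    have "integral {0<..<1} (speed A g \<gamma>) \<le> integral {0<..<1::real} (\<lambda>t. (1 + \<epsilon>) * radius p)"
    proof (rule integral_le)
      show "speed A g \<gamma> integrable_on {0<..<1}"
        using speed_integrable[OF pc] by (simp add: integrable_on_open_interval_real)
      show "(\<lambda>t. (1 + \<epsilon>) * radius p) integrable_on {0<..<1::real}"
        unfolding integrable_on_open_interval_real by (rule integrable_const_ivl)
      fix t :: real assume t: "t \<in> {0<..<1}"
      then have t01: "t \<in> {0..1}" "0 < t" "t < 1" by auto
      have "((snd c \<circ> \<gamma>) has_vector_derivative w) (at t)"
        using dl[OF t01(1)] at_within_Icc_at[OF t01(2,3)] by simp
      then have "speed A g \<gamma> t = sqrt (w \<bullet> (g c (\<gamma> t) *v w))"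
        by (rule speed_eq[OF \<gamma>cont \<gamma>S t01(2,3) c(1) \<gamma>c(1)[OF t01(1)]])
      also have "\<dots> \<le> (1 + \<epsilon>) * norm (Bi *v w)"
        using Nl[OF t01(1)] by (intro upper \<gamma>c(1)[OF t01(1)]) (simp add: \<gamma>c(2)[OF t01(1)])
      finally show "speed A g \<gamma> t \<le> (1 + \<epsilon>) * radius p" by (simp add: Nw)
    qed
    then show ?thesis
      by (simp add: riemannian_length_def flip: integral_open_interval_real)
  qed
  ultimately show ?thesis by (rule that)
qed

text \<open>The open coordinate ball of radius \<open>radius p\<close> is open in \<open>S\<close>, so there is a last time at which the path
  is outside it. The closed ball is the image of a compact set, hence closed; so at that time the
  path is already in the closed ball, that is, on the sphere.\<close>

lemma last_entry:
  fixes \<gamma> :: "real \<Rightarrow> 'a"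
  assumes \<gamma>: "continuous_on {0..1} \<gamma>" "\<gamma> ` {0..1} \<subseteq> S" "\<gamma> 0 = p" "\<gamma> 1 = s0"
    and p: "p \<in> fst c" "0 < radius p" "radius p \<le> \<rho>"
  obtains \<tau> where "0 \<le> \<tau>" "\<tau> < 1" "radius (\<gamma> \<tau>) = radius p"
    "\<And>t. \<tau> \<le> t \<Longrightarrow> t \<le> 1 \<Longrightarrow> \<gamma> t \<in> fst c \<and> radius (\<gamma> t) \<le> radius p"
proof -
  let ?inv = "inv_into (fst c) (snd c)"
  define U where "U = {q \<in> fst c. radius q < radius p}"
  define K where "K = {q \<in> fst c. radius q \<le> radius p}"
  have rc: "continuous_on (fst c) radius"
    unfolding radius_def
    by (intro continuous_on_norm bounded_linear.continuous_on[OF matrix_vector_mul_bounded_linear]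
        continuous_on_diff continuous_on_const chart(4)[OF c(1)])
  have U: "openin (top_of_set S) U"
  proof -
    have "U = fst c \<inter> radius -` {..<radius p}" by (auto simp: U_def)
    moreover have "openin (top_of_set (fst c)) (fst c \<inter> radius -` {..<radius p})"
      by (rule continuous_openin_preimage_gen[OF rc]) simp
    ultimately show ?thesis using chart(1)[OF c(1)] openin_trans by metis
  qed
  have Kc: "closed K"
  proof -
    define Z where "Z = {y. norm (Bi *v (y - snd c s0)) \<le> radius p}"
    have Z: "Z = (\<lambda>w. snd c s0 + B *v w) ` cball 0 (radius p)"
    proof (intro set_eqI iffI)
      fix y assume "y \<in> Z"
      moreover have "y = snd c s0 + B *v (Bi *v (y - snd c s0))"
        by (simp add: matrix_vector_mul_assoc BBi)
      ultimately show "y \<in> (\<lambda>w. snd c s0 + B *v w) ` cball 0 (radius p)" by (auto simp: Z_def)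
    next
      fix y assume "y \<in> (\<lambda>w. snd c s0 + B *v w) ` cball 0 (radius p)"
      then show "y \<in> Z" by (auto simp: Z_def matrix_vector_mul_assoc BiB)
    qed
    have "compact Z"
      unfolding Z by (intro compact_continuous_image compact_cball continuous_on_add continuous_on_const
          bounded_linear.continuous_on[OF matrix_vector_mul_bounded_linear] continuous_on_id)
    moreover have ZW: "Z \<subseteq> snd c ` fst c" using ball p(3) by (auto simp: Z_def)
    ultimately have "compact (?inv ` Z)"
      by (intro compact_continuous_image continuous_on_subset[OF chart(5)[OF c(1)]])
    moreover have "?inv ` Z = K"
    proof (intro set_eqI iffI)
      fix q assume "q \<in> ?inv ` Z"
      then obtain y where y: "y \<in> Z" "q = ?inv y" by blast
      then have "q \<in> fst c" "snd c q = y" using ZW by (auto intro: inv_into_into f_inv_into_f)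
      then show "q \<in> K" using y(1) by (simp add: K_def Z_def radius_def)
    next
      fix q assume "q \<in> K"
      then have "snd c q \<in> Z" "q = ?inv (snd c q)"
        using chart_inv[OF c(1)] by (auto simp: K_def Z_def radius_def)
      then show "q \<in> ?inv ` Z" by blast
    qed
    ultimately show ?thesis by (metis compact_imp_closed)
  qed
  define T where "T = {0..1} \<inter> \<gamma> -` (S - U)"
  have "closedin (top_of_set S) (S - U)" using U by (simp add: closedin_def Diff_Diff_Int openin_imp_subset inf.absorb2)
  then have "closedin (top_of_set {0..1}) T"
    unfolding T_def using \<gamma>(1,2) by (intro continuous_closedin_preimage_gen[of _ \<gamma> S]) auto
  then have "compact T" by (rule closedin_compact[rotated]) simp
  moreover have "0 \<in> T" using \<gamma>(2,3) by (auto simp: T_def U_def)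
  ultimately obtain \<tau> where \<tau>: "\<tau> \<in> T" "\<And>t. t \<in> T \<Longrightarrow> t \<le> \<tau>"
    using compact_attains_sup[of T] by blast
  have \<tau>01: "0 \<le> \<tau>" "\<tau> \<le> 1" using \<tau>(1) by (auto simp: T_def)
  have "s0 \<in> U" using c(2) p(2) by (simp add: U_def radius_centre)
  then have \<tau>1: "\<tau> < 1" using \<tau>(1) \<tau>01 \<gamma>(4) by (cases "\<tau> = 1") (auto simp: T_def)
  have after: "\<gamma> t \<in> U" if "\<tau> < t" "t \<le> 1" for t
  proof (rule ccontr)
    assume "\<gamma> t \<notin> U"
    then have "t \<in> T" using that \<tau>01 \<gamma>(2) by (auto simp: T_def)
    then show False using \<tau>(2) that by force
  qed
  have "\<gamma> \<tau> \<in> K"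
  proof (rule Lim_in_closed_set[OF Kc])
    show "\<forall>\<^sub>F t in at \<tau> within {\<tau>..1}. \<gamma> t \<in> K"
      unfolding eventually_at using after by (intro exI[of _ 1]) (force simp: U_def K_def)
    show "at \<tau> within {\<tau>..1} \<noteq> bot" using \<tau>1 by (simp add: trivial_limit_within islimpt_Icc)
    have "continuous_on {\<tau>..1} \<gamma>" using \<tau>01 by (intro continuous_on_subset[OF \<gamma>(1)]) auto
    then show "(\<gamma> \<longlongrightarrow> \<gamma> \<tau>) (at \<tau> within {\<tau>..1})" using \<tau>1 by (auto simp: continuous_on_def)
  qed
  moreover have "\<gamma> \<tau> \<notin> U" using \<tau>(1) by (simp add: T_def)
  ultimately have "radius (\<gamma> \<tau>) = radius p" by (auto simp: U_def K_def)
  moreover have "\<gamma> t \<in> fst c \<and> radius (\<gamma> t) \<le> radius p" if "\<tau> \<le> t" "t \<le> 1" for t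
    using after[of t] \<open>\<gamma> \<tau> \<in> K\<close> that by (cases "t = \<tau>") (auto simp: U_def K_def)
  ultimately show ?thesis using that \<tau>01(1) \<tau>1 by blast
qed

text \<open>After the last entry the path runs in the ball from the sphere of radius \<open>radius p\<close> to the centre. There
  the speed is at least \<open>1 - \<epsilon>\<close> times the Euclidean speed in frame coordinates, and this is at least the
  rate of change of a linear functional of norm \<open>1\<close> which drops by \<open>radius p\<close>.\<close>

lemma length_lower_bound:
  assumes pc: "piecewise_C1_path S A \<gamma>" and ends: "pathstart \<gamma> = p" "pathfinish \<gamma> = s0"
    and p: "p \<in> fst c" "radius p \<le> \<rho>"
  shows "(1 - \<epsilon>) * radius p \<le> riemannian_length A g \<gamma>"
proof (cases "radius p = 0")
  case True
  then show ?thesis using length_nonneg[OF pc] by simp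
next
  case False
  define n where "n = radius p"
  have n: "0 < n" using False by (simp add: n_def radius_def)
  have \<gamma>: "continuous_on {0..1} \<gamma>" "\<gamma> ` {0..1} \<subseteq> S" "\<gamma> 0 = p" "\<gamma> 1 = s0"
    using pc ends by (auto simp: piecewise_C1_path_def path_def path_image_def pathstart_def pathfinish_def)
  obtain \<tau> where \<tau>: "0 \<le> \<tau>" "\<tau> < 1" "radius (\<gamma> \<tau>) = n"
    "\<And>t. \<tau> \<le> t \<Longrightarrow> t \<le> 1 \<Longrightarrow> \<gamma> t \<in> fst c \<and> radius (\<gamma> t) \<le> n"
    unfolding n_def by (rule last_entry[OF \<gamma> p(1) n[unfolded n_def] p(2)]) blast
  obtain P where P: "finite P" "{0, 1} \<subseteq> P" "P \<subseteq> {0..1}"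
    and seg: "\<And>a b. a \<in> P \<Longrightarrow> b \<in> P \<Longrightarrow> a < b \<Longrightarrow> {a<..<b} \<inter> P = {} \<Longrightarrow> C1_segment A \<gamma> a b"
    by (rule piecewise_C1_pathE[OF pc], rule that)
  have "\<exists>v. ((snd c \<circ> \<gamma>) has_vector_derivative v) (at t)" if t: "t \<in> {\<tau><..<1} - P" for t
  proof -
    obtain a b where ab: "a \<in> P" "b \<in> P" "a < t" "t < b" "{a<..<b} \<inter> P = {}"
      using consecutive_points[of P 0 1 t] P t \<tau>(1) by auto
    have "a < b" using ab by linarith
    then obtain v where "\<And>t. t \<in> {a..b} \<inter> \<gamma> -` fst c \<Longrightarrow> ((snd c \<circ> \<gamma>) has_vector_derivative v t) (at t within {a..b})"
      using seg[OF ab(1,2) _ ab(5)] c(1) unfolding C1_segment_def by blast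
    from this[of t] have "((snd c \<circ> \<gamma>) has_vector_derivative v t) (at t)"
      using ab(3,4) \<tau>(4)[of t] t by (simp add: at_within_Icc_at)
    then show ?thesis ..
  qed
  then obtain v where v: "\<And>t. t \<in> {\<tau><..<1} - P \<Longrightarrow> ((snd c \<circ> \<gamma>) has_vector_derivative v t) (at t)"
    by metis
  \<comment> \<open>\<open>L\<close> is minus the component in the radial direction at time \<open>\<tau>\<close>; along the path it
    increases by \<open>n\<close> in total.\<close>
  define w where "w = Bi *v (snd c (\<gamma> \<tau>) - snd c s0)"
  have w: "norm w = n" using \<tau>(3) by (simp add: w_def radius_def)
  define L where "L y = - ((w \<bullet> (Bi *v y)) / n)" for y
  have L: "bounded_linear L"
    unfolding L_def divide_inverse
    by (intro bounded_linear_minus bounded_linear_mult_const bounded_linear_inner_right_comp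
        matrix_vector_mul_bounded_linear)
  \<comment> \<open>The value \<open>0\<close> at the exceptional times keeps \<open>F'\<close> below the speed there, whose value is unspecified
    but nonnegative.\<close>
  define F' where "F' t = (if t \<in> P \<union> {\<tau>} then 0 else L (v t))" for t
  have "((F') has_integral (L (snd c (\<gamma> 1)) - L (snd c (\<gamma> \<tau>)))) {\<tau>..1}"
  proof (rule fundamental_theorem_of_calculus_interior_strong[of "P"])
    show "finite P" by (rule P(1))
    show "\<tau> \<le> 1" using \<tau>(2) by simp
    show "((\<lambda>t. L (snd c (\<gamma> t))) has_vector_derivative F' t) (at t)" if "t \<in> {\<tau><..<1} - P" for t
    proof -
      have "((\<lambda>t. L ((snd c \<circ> \<gamma>) t)) has_vector_derivative L (v t)) (at t)"
        by (rule bounded_linear.has_vector_derivative[OF L v[OF that]])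
      then show ?thesis using that by (simp add: F'_def)
    qed
    have "continuous_on {\<tau>..1} \<gamma>" using \<tau>(1) by (intro continuous_on_subset[OF \<gamma>(1)]) auto
    then have "continuous_on {\<tau>..1} (\<lambda>t. snd c (\<gamma> t))"
      by (rule continuous_on_compose2[OF chart(4)[OF c(1)]]) (use \<tau>(4) in auto)
    then show "continuous_on {\<tau>..1} (\<lambda>t. L (snd c (\<gamma> t)))"
      by (rule bounded_linear.continuous_on[OF L])
  qed
  moreover have "L (snd c (\<gamma> 1)) - L (snd c (\<gamma> \<tau>)) = n"
  proof -
    have "L (snd c (\<gamma> 1)) - L (snd c (\<gamma> \<tau>)) = (w \<bullet> w) / n"
      unfolding L_def \<gamma>(4) w_def
      by (simp add: matrix_vector_mult_diff_distrib inner_diff_right diff_divide_distrib)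
    then show ?thesis using n w by (simp add: power2_eq_square flip: power2_norm_eq_inner)
  qed
  ultimately have I: "(F' has_integral n) {\<tau>..1}" by simp
  have int: "speed A g \<gamma> integrable_on {\<tau>..1}"
    using speed_integrable[OF pc] \<tau>(1,2) by (auto intro: integrable_subinterval_real)
  have "integral {\<tau>..1} (\<lambda>t. (1 - \<epsilon>) * F' t) \<le> integral {\<tau>..1} (speed A g \<gamma>)"
  proof (rule integral_le[OF _ int])
    show "(\<lambda>t. (1 - \<epsilon>) * F' t) integrable_on {\<tau>..1}"
      using has_integral_mult_right[OF I, of "1 - \<epsilon>"] by (rule has_integral_integrable)
    fix t assume t: "t \<in> {\<tau>..1}"
    have "\<gamma> t \<in> S" using t \<tau>(1) \<gamma>(2) by auto
    show "(1 - \<epsilon>) * F' t \<le> speed A g \<gamma> t"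
    proof (cases "t \<in> P \<union> {\<tau>}")
      case True
      then show ?thesis using speed_nonneg[of \<gamma> t] \<open>\<gamma> t \<in> S\<close> by (simp add: F'_def)
    next
      case False
      then have t': "t \<in> {\<tau><..<1} - P" using t P(2) by (auto simp: less_le)
      have t01: "0 < t" "t < 1" using t' \<tau>(1) by auto
      have in_c: "\<gamma> t \<in> fst c" "radius (\<gamma> t) \<le> n" using \<tau>(4)[of t] t by auto
      have "L (v t) \<le> norm (Bi *v v t)"
      proof -
        have "- (w \<bullet> (Bi *v v t)) \<le> norm w * norm (Bi *v v t)"
          using Cauchy_Schwarz_ineq2[of w "Bi *v v t"] by linarith
        then show ?thesis using n by (simp add: L_def w field_simps)
      qed
      then have "(1 - \<epsilon>) * F' t \<le> (1 - \<epsilon>) * norm (Bi *v v t)"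
        using False \<epsilon> by (simp add: F'_def mult_left_mono)
      also have "\<dots> \<le> sqrt (v t \<bullet> (g c (\<gamma> t) *v v t))"
        using in_c p(2) by (intro lower) (auto simp: radius_def n_def)
      also have "\<dots> = speed A g \<gamma> t"
        by (rule speed_eq[OF \<gamma>(1,2) t01 c(1) in_c(1) v[OF t'], symmetric])
      finally show ?thesis .
    qed
  qed
  moreover have "integral {\<tau>..1} (\<lambda>t. (1 - \<epsilon>) * F' t) = (1 - \<epsilon>) * n"
    using has_integral_mult_right[OF I, of "1 - \<epsilon>"] by (rule integral_unique)
  moreover have "integral {\<tau>..1} (speed A g \<gamma>) \<le> integral {0..1} (speed A g \<gamma>)"
    using int speed_integrable[OF pc] \<tau>(1) speed_nonneg \<gamma>(2)
    by (intro integral_subset_le) auto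
  ultimately have "(1 - \<epsilon>) * n \<le> integral {0..1} (speed A g \<gamma>)" by linarith
  then show ?thesis by (simp add: riemannian_length_def n_def)
qed

lemma geodesic_dist_bounds:
  assumes p: "p \<in> fst c" "radius p \<le> \<rho>"
  shows "(1 - \<epsilon>) * radius p \<le> geodesic_dist S A g p s0"
    and "geodesic_dist S A g p s0 \<le> (1 + \<epsilon>) * radius p"
proof -
  let ?L = "{riemannian_length A g \<gamma> |\<gamma>. piecewise_C1_path S A \<gamma> \<and> pathstart \<gamma> = p \<and> pathfinish \<gamma> = s0}"
  obtain \<gamma> where \<gamma>: "piecewise_C1_path S A \<gamma>" "pathstart \<gamma> = p" "pathfinish \<gamma> = s0"
    "riemannian_length A g \<gamma> \<le> (1 + \<epsilon>) * radius p"
    by (rule straight_path[OF p])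
  have mem: "riemannian_length A g \<gamma> \<in> ?L" using \<gamma> by blast
  have low: "(1 - \<epsilon>) * radius p \<le> x" if "x \<in> ?L" for x
    using that length_lower_bound[OF _ _ _ p] by blast
  show "(1 - \<epsilon>) * radius p \<le> geodesic_dist S A g p s0"
    unfolding geodesic_dist_def using mem low by (intro cInf_greatest) auto
  have "Inf ?L \<le> riemannian_length A g \<gamma>"
    by (rule cInf_lower[OF mem]) (use low in \<open>auto simp: bdd_below_def\<close>)
  then show "geodesic_dist S A g p s0 \<le> (1 + \<epsilon>) * radius p"
    unfolding geodesic_dist_def using \<gamma>(4) by linarith
qed

end

context continuous_metric_surface
begin

text \<open>The metric is continuous at \<open>s0\<close>, and the frame norm is equivalent to the Euclidean norm.\<close>

lemma almost_flat_chart_exists: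
  assumes c: "c \<in> A" "s0 \<in> fst c" and BBi: "B ** Bi = mat 1" "Bi ** B = mat 1"
    and N: "\<And>v. sqrt (v \<bullet> (g c s0 *v v)) = norm (Bi *v v)" and \<epsilon>: "0 < \<epsilon>" "\<epsilon> < 1"
  obtains \<rho> where "almost_flat_chart S A g c s0 B Bi \<epsilon> \<rho>"
proof -
  let ?x0 = "snd c s0"
  obtain k where k: "0 < k" "\<And>M x. norm ((M::real^2^2) *v x) \<le> norm M * norm x * k"
    using bounded_bilinear.pos_bounded[OF bounded_bilinear_matrix_vector] by auto
  obtain K where K: "0 < K" "\<And>w. norm (B *v w) \<le> norm w * K"
    using bounded_linear.pos_bounded[OF matrix_vector_mul_bounded_linear[of B]] by auto
  have KN: "norm v \<le> norm (Bi *v v) * K" for v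
    using K(2)[of "Bi *v v"] by (simp add: matrix_vector_mul_assoc BBi)
  \<comment> \<open>If the Gram matrices differ by at most \<open>\<eta>\<close>, the squared norms differ by at most \<open>\<epsilon>\<close> times the
    squared frame norm.\<close>
  define \<eta> where "\<eta> = \<epsilon> / (k * K\<^sup>2)"
  have \<eta>: "0 < \<eta>" "\<eta> * (k * K\<^sup>2) = \<epsilon>" using \<epsilon> k(1) K(1) by (auto simp: \<eta>_def)
  define G where "G y = g c (inv_into (fst c) (snd c) y)" for y
  have "continuous_on (snd c ` fst c) G"
    unfolding G_def by (rule continuous_on_compose2[OF g_cont[OF c(1)] chart(5)[OF c(1)]])
      (auto intro: inv_into_into)
  moreover have x0: "?x0 \<in> snd c ` fst c" using c(2) by simp
  ultimately have "(G \<longlongrightarrow> G ?x0) (at ?x0)"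
    using chart(3)[OF c(1)] by (metis at_within_open continuous_on_def)
  from tendstoD[OF this \<eta>(1)] obtain d1 where d1: "0 < d1"
    "\<And>y. y \<noteq> ?x0 \<Longrightarrow> dist y ?x0 < d1 \<Longrightarrow> dist (G y) (G ?x0) < \<eta>"
    unfolding eventually_at by auto
  obtain d2 where d2: "0 < d2" "\<And>y. dist y ?x0 < d2 \<Longrightarrow> y \<in> snd c ` fst c"
    using chart(3)[OF c(1)] x0 unfolding open_dist by blast
  define \<rho> where "\<rho> = min d1 d2 / (2 * K)"
  have \<rho>: "0 < \<rho>" using d1(1) d2(1) K(1) by (simp add: \<rho>_def)
  have near: "dist y ?x0 < d1" "dist y ?x0 < d2" if "norm (Bi *v (y - ?x0)) \<le> \<rho>" for y
  proof -
    have "norm (y - ?x0) \<le> \<rho> * K"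
      using KN[of "y - ?x0"] mult_right_mono[OF that, of K] K(1) by linarith
    also have "\<dots> = min d1 d2 / 2" using K(1) by (simp add: \<rho>_def)
    finally show "dist y ?x0 < d1" "dist y ?x0 < d2"
      using d1(1) d2(1) unfolding dist_norm by linarith+
  qed
  have cmp: "\<bar>v \<bullet> (g c p *v v) - (norm (Bi *v v))\<^sup>2\<bar> \<le> \<epsilon> * (norm (Bi *v v))\<^sup>2"
    if p: "p \<in> fst c" "norm (Bi *v (snd c p - ?x0)) \<le> \<rho>" for p v
  proof -
    have "norm (g c p - g c s0) \<le> \<eta>"
    proof (cases "p = s0")
      case False
      then have "snd c p \<noteq> ?x0" using inj_onD[OF chart(6)[OF c(1)], of p s0] p(1) c(2) by blast
      from d1(2)[OF this near(1)[OF p(2)]] show ?thesis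
        by (simp add: G_def dist_norm chart_inv[OF c(1) p(1)] chart_inv[OF c])
    qed (use \<eta>(1) in simp)
    have "0 \<le> v \<bullet> (g c s0 *v v)" using g_pos[OF c, of v] by (cases "v = 0") auto
    then have "(norm (Bi *v v))\<^sup>2 = v \<bullet> (g c s0 *v v)"
      unfolding N[symmetric] by simp
    then have "\<bar>v \<bullet> (g c p *v v) - (norm (Bi *v v))\<^sup>2\<bar> = \<bar>v \<bullet> ((g c p - g c s0) *v v)\<bar>"
      by (simp add: matrix_vector_mult_diff_rdistrib inner_diff_right)
    also have "\<dots> \<le> norm v * norm ((g c p - g c s0) *v v)" by (rule Cauchy_Schwarz_ineq2)
    also have "\<dots> \<le> norm v * (norm (g c p - g c s0) * norm v * k)"
      by (intro mult_left_mono k(2)) simp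
    also have "\<dots> = norm (g c p - g c s0) * k * (norm v)\<^sup>2" by (simp add: power2_eq_square)
    also have "\<dots> \<le> \<eta> * k * (norm (Bi *v v) * K)\<^sup>2"
      using \<open>norm (g c p - g c s0) \<le> \<eta>\<close> k(1) \<eta>(1) KN[of v]
      by (intro mult_mono power_mono) auto
    also have "\<dots> = \<epsilon> * (norm (Bi *v v))\<^sup>2"
      unfolding \<eta>(2)[symmetric] by (simp add: power_mult_distrib)
    finally show ?thesis .
  qed
  have "almost_flat_chart S A g c s0 B Bi \<epsilon> \<rho>"
  proof (intro almost_flat_chart.intro almost_flat_chart_axioms.intro continuous_metric_surface_axioms)
    show "c \<in> A" "s0 \<in> fst c" "B ** Bi = mat 1" "Bi ** B = mat 1" "0 < \<epsilon>" "\<epsilon> < 1" "0 < \<rho>" by fact+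
    show "y \<in> snd c ` fst c" if "norm (Bi *v (y - ?x0)) \<le> \<rho>" for y
      by (rule d2(2)[OF near(2)[OF that]])
    fix p v assume p: "p \<in> fst c" "norm (Bi *v (snd c p - ?x0)) \<le> \<rho>"
    let ?n = "norm (Bi *v v)"
    \<comment> \<open>The square roots of \<open>1 - \<epsilon>\<close> and \<open>1 + \<epsilon>\<close> lie between \<open>1 - \<epsilon>\<close> and \<open>1 + \<epsilon>\<close>.\<close>
    have "(1 - \<epsilon>)\<^sup>2 \<le> 1 - \<epsilon>" "1 + \<epsilon> \<le> (1 + \<epsilon>)\<^sup>2"
      using \<epsilon> by (simp_all add: power2_eq_square algebra_simps)
    then have "((1 - \<epsilon>) * ?n)\<^sup>2 \<le> (1 - \<epsilon>) * ?n\<^sup>2" "(1 + \<epsilon>) * ?n\<^sup>2 \<le> ((1 + \<epsilon>) * ?n)\<^sup>2"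
      unfolding power_mult_distrib by (auto intro: mult_right_mono)
    moreover have "(1 - \<epsilon>) * ?n\<^sup>2 \<le> v \<bullet> (g c p *v v)" "v \<bullet> (g c p *v v) \<le> (1 + \<epsilon>) * ?n\<^sup>2"
      using cmp[OF p, of v] by (simp_all add: algebra_simps abs_le_iff)
    ultimately have "((1 - \<epsilon>) * ?n)\<^sup>2 \<le> v \<bullet> (g c p *v v)" "v \<bullet> (g c p *v v) \<le> ((1 + \<epsilon>) * ?n)\<^sup>2" by linarith+
    then show "(1 - \<epsilon>) * ?n \<le> sqrt (v \<bullet> (g c p *v v))" "sqrt (v \<bullet> (g c p *v v)) \<le> (1 + \<epsilon>) * ?n"
      using \<epsilon> by (auto intro: real_le_rsqrt real_le_lsqrt)
  qed
  then show ?thesis by (rule that)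
qed

text \<open>Limits at \<open>s0\<close> in the surface and limits at \<open>snd c s0\<close> in the plane can be exchanged, since a chart
  is a homeomorphism onto an open set and its domain is a neighbourhood of \<open>s0\<close>.\<close>

lemma chart_limit:
  assumes c: "c \<in> A" "s0 \<in> fst c"
  shows "filterlim (snd c) (at (snd c s0)) (at s0 within S)"
    and "\<forall>\<^sub>F s in at s0 within S. s \<in> fst c"
    and "filterlim (inv_into (fst c) (snd c)) (at s0 within S) (at (snd c s0))"
proof -
  obtain U where U: "open U" "fst c = S \<inter> U"
    using chart(1)[OF c(1)] by (auto simp: openin_open)
  have "\<forall>\<^sub>F s in at s0 within S. s \<in> U \<and> s \<in> S"
    using U c(2) by (auto simp: eventually_at_topological)
  then show ev: "\<forall>\<^sub>F s in at s0 within S. s \<in> fst c" by (simp add: U(2) conj_commute)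
  have same: "at s0 within S = at s0 within fst c"
    using U c(2) by (intro at_within_nhd[of s0 U]) auto
  show "filterlim (snd c) (at (snd c s0)) (at s0 within S)"
  proof (rule filterlim_atI)
    show "(snd c \<longlongrightarrow> snd c s0) (at s0 within S)"
      unfolding same using chart(4)[OF c(1)] c(2) by (simp add: continuous_on_def)
    have "\<forall>\<^sub>F s in at s0 within S. s \<noteq> s0" by (auto simp: eventually_at_topological)
    with ev show "\<forall>\<^sub>F s in at s0 within S. snd c s \<noteq> snd c s0"
      by eventually_elim (use inj_onD[OF chart(6)[OF c(1)]] c(2) in blast)
  qed
  let ?W = "snd c ` fst c" and ?i = "inv_into (fst c) (snd c)"
  have W: "open ?W" "snd c s0 \<in> ?W" using chart(3)[OF c(1)] c(2) by auto
  have "(?i \<longlongrightarrow> s0) (at (snd c s0))"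
    using chart(5)[OF c(1)] W chart_inv[OF c] at_within_open[OF W(2,1)]
    unfolding continuous_on_def by metis
  moreover have "\<forall>\<^sub>F y in at (snd c s0). y \<in> ?W" using W by (auto simp: eventually_at_topological)
  then have "\<forall>\<^sub>F y in at (snd c s0). ?i y \<in> S \<and> ?i y \<noteq> s0"
    using eventually_neq_at_within[of "snd c s0"]
  proof eventually_elim
    case (elim y)
    then have "?i y \<in> fst c" "snd c (?i y) = y" by (auto intro: inv_into_into f_inv_into_f)
    then show ?case using elim chart(2)[OF c(1)] by auto
  qed
  ultimately show "filterlim ?i (at s0 within S) (at (snd c s0))"
    by (simp add: filterlim_at)
qed

text \<open>For every \<open>\<epsilon>\<close> the distance lies between \<open>1 - \<epsilon>\<close> and \<open>1 + \<epsilon>\<close> times the coordinate norm in a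
  sufficiently small coordinate ball.\<close>

theorem geodesic_dist_asymptotics:
  assumes c: "c \<in> A" "s0 \<in> fst c"
  shows "((\<lambda>s. geodesic_dist S A g s s0 /
            sqrt ((snd c s - snd c s0) \<bullet> (g c s0 *v (snd c s - snd c s0)))) \<longlongrightarrow> 1) (at s0 within S)"
proof -
  obtain Bi B :: "real^2^2" where B: "Bi = transpose B ** g c s0" "B ** Bi = mat 1" "Bi ** B = mat 1"
    and N: "\<And>v. sqrt (v \<bullet> (g c s0 *v v)) = norm (Bi *v v)"
    by (rule orthonormal_frame[of "g c s0"], rule g_sym[OF c], erule g_pos[OF c], rule that)
  show ?thesis
  proof (rule tendstoI)
    fix e :: real assume e: "0 < e"
    define \<epsilon> where "\<epsilon> = min e 1 / 2"
    have \<epsilon>: "0 < \<epsilon>" "\<epsilon> < 1" and \<epsilon>e: "\<epsilon> < e" using e by (auto simp: \<epsilon>_def)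
    obtain \<rho> where "almost_flat_chart S A g c s0 B Bi \<epsilon> \<rho>"
      by (rule almost_flat_chart_exists[OF c B(2,3) N \<epsilon>(1,2)])
    then interpret almost_flat_chart S A g c s0 B Bi \<epsilon> \<rho> .
    have "((\<lambda>y. norm (Bi *v (y - snd c s0))) \<longlongrightarrow> norm (Bi *v (snd c s0 - snd c s0))) (at (snd c s0))"
      by (intro tendsto_norm bounded_linear.tendsto[OF matrix_vector_mul_bounded_linear] tendsto_intros)
    then have "((\<lambda>y. norm (Bi *v (y - snd c s0))) \<longlongrightarrow> 0) (at (snd c s0))" by simp
    from filterlim_compose[OF this chart_limit(1)[OF c]] have "(radius \<longlongrightarrow> 0) (at s0 within S)"
      by (simp add: radius_def[abs_def])
    from order_tendstoD(2)[OF this \<rho>] have ev: "\<forall>\<^sub>F s in at s0 within S. radius s < \<rho>" .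
    have "\<forall>\<^sub>F s in at s0 within S. s \<noteq> s0" by (auto simp: eventually_at_topological)
    with ev chart_limit(2)[OF c]
    show "\<forall>\<^sub>F s in at s0 within S. dist (geodesic_dist S A g s s0 /
        sqrt ((snd c s - snd c s0) \<bullet> (g c s0 *v (snd c s - snd c s0)))) 1 < e"
    proof eventually_elim
      case (elim s)
      have "snd c s - snd c s0 \<noteq> 0"
        using elim inj_onD[OF chart(6)[OF c(1)], of s s0] c(2) by auto
      moreover have "B *v (Bi *v v) = v" for v by (simp add: matrix_vector_mul_assoc B(2))
      ultimately have "Bi *v (snd c s - snd c s0) \<noteq> 0"
        by (metis matrix_vector_mult_0_right)
      then have r: "0 < radius s" by (simp add: radius_def)
      have b: "(1 - \<epsilon>) * radius s \<le> geodesic_dist S A g s s0" "geodesic_dist S A g s s0 \<le> (1 + \<epsilon>) * radius s"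
        using geodesic_dist_bounds[of s] elim by auto
      have "1 - \<epsilon> \<le> geodesic_dist S A g s s0 / radius s" "geodesic_dist S A g s s0 / radius s \<le> 1 + \<epsilon>"
        using b r by (simp_all add: pos_le_divide_eq pos_divide_le_eq)
      then show ?case using \<epsilon>e by (simp add: N radius_def[symmetric] dist_real_def abs_less_iff)
    qed
  qed
qed

end

section \<open>The regularized stream function\<close>

lemma continuous_on_from_chart:
  assumes "is_chart S c" "smooth_on (chart_repr c f) (snd c ` fst c)"
  shows "continuous_on (fst c) f"
proof -
  have "Ck_on 0 (chart_repr c f) (snd c ` fst c)" using assms(2) unfolding smooth_on_def by blast
  then have 1: "continuous_on (snd c ` fst c) (chart_repr c f)" by simp
  have c: "continuous_on (fst c) (snd c)" and inv: "\<And>p. p \<in> fst c \<Longrightarrow> inv_into (fst c) (snd c) (snd c p) = p"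
    using assms(1) by (auto simp: is_chart_def homeomorphism_def)
  have "continuous_on (fst c) (\<lambda>p. chart_repr c f (snd c p))"
    by (rule continuous_on_compose2[OF 1 c]) simp
  then show ?thesis by (rule continuous_on_eq) (simp add: chart_repr_def inv)
qed

lemma riemannian_metric_continuous_metric_surface:
  assumes "oriented_surface S A" "riemannian_metric A g"
  shows "continuous_metric_surface S A g"
proof
  show "oriented_surface S A" by fact
  fix c p assume c: "c \<in> A"
  then have "is_chart S c" using assms(1) by (simp add: oriented_surface_def)
  then show "continuous_on (fst c) (g c)"
    using continuous_on_from_chart assms(2) c unfolding riemannian_metric_def by blast
  show "transpose (g c p) = g c p" "\<And>v. v \<noteq> 0 \<Longrightarrow> v \<bullet> (g c p *v v) > 0" if "p \<in> fst c"
    using assms(2) c that unfolding riemannian_metric_def by blast+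
  show "g c p = transpose (jacobian_matrix (transition c c') (snd c p)) ** g c' p **
        jacobian_matrix (transition c c') (snd c p)" if "c' \<in> A" "p \<in> fst c \<inter> fst c'" for c'
    using assms(2) c that unfolding riemannian_metric_def by blast
qed

context continuous_metric_surface
begin

lemma conformal_change:
  assumes h: "smooth_function A h" "\<And>s. s \<in> S \<Longrightarrow> 0 < h s"
  shows "continuous_metric_surface S A (conformal_metric h g)"
proof
  show "oriented_surface S A" by (rule surface)
  fix c p assume c: "c \<in> A"
  have "is_chart S c" using surface c by (simp add: oriented_surface_def)
  then have "continuous_on (fst c) h"
    using continuous_on_from_chart h(1) c unfolding smooth_function_def by blast
  then show "continuous_on (fst c) (conformal_metric h g c)"
    unfolding conformal_metric_def by (intro continuous_on_scaleR continuous_on_power g_cont[OF c])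
  show "transpose (conformal_metric h g c p) = conformal_metric h g c p" if "p \<in> fst c"
    using arg_cong[OF g_sym[OF c that], of "\<lambda>M. M $ 1 $ 2"]
    by (simp add: conformal_metric_def matrix_eq_2)
  show "v \<bullet> (conformal_metric h g c p *v v) > 0" if "p \<in> fst c" "v \<noteq> 0" for v
  proof -
    have "0 < h p" using h(2) chart(2)[OF c] that(1) by blast
    then show ?thesis
      using g_pos[OF c that] by (simp add: conformal_metric_def flip: scaleR_matrix_vector_assoc)
  qed
  show "conformal_metric h g c p = transpose (jacobian_matrix (transition c c') (snd c p)) **
      conformal_metric h g c' p ** jacobian_matrix (transition c c') (snd c p)"
    if "c' \<in> A" "p \<in> fst c \<inter> fst c'" for c'
    unfolding conformal_metric_def g_trans[OF c that]
    by (simp add: matrix_eq_2 matrix_matrix_nth_2 algebra_simps)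
qed

definition coordinate_norm :: "'a chart \<Rightarrow> 'a \<Rightarrow> 'a \<Rightarrow> real" where
  "coordinate_norm c s0 s = sqrt ((snd c s - snd c s0) \<bullet> (g c s0 *v (snd c s - snd c s0)))"

lemma eventually_coordinate_norm_pos:
  assumes c: "c \<in> A" "s0 \<in> fst c"
  shows "\<forall>\<^sub>F s in at s0 within S. 0 < coordinate_norm c s0 s"
proof -
  have "\<forall>\<^sub>F s in at s0 within S. s \<noteq> s0" by (auto simp: eventually_at_topological)
  with chart_limit(2)[OF c] show ?thesis
  proof eventually_elim
    case (elim s)
    then have "snd c s - snd c s0 \<noteq> 0"
      using inj_onD[OF chart(6)[OF c(1)], of s s0] c(2) by auto
    from g_pos[OF c this] show ?case by (simp add: coordinate_norm_def)
  qed
qed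

lemma ln_dist_coordinate_norm:
  assumes c: "c \<in> A" "s0 \<in> fst c"
  shows "((\<lambda>s. ln (geodesic_dist S A g s s0) - ln (coordinate_norm c s0 s)) \<longlongrightarrow> 0) (at s0 within S)"
proof -
  have lim: "((\<lambda>s. geodesic_dist S A g s s0 / coordinate_norm c s0 s) \<longlongrightarrow> 1) (at s0 within S)"
    using geodesic_dist_asymptotics[OF c] by (simp add: coordinate_norm_def)
  then have "((\<lambda>s. ln (geodesic_dist S A g s s0 / coordinate_norm c s0 s)) \<longlongrightarrow> ln 1) (at s0 within S)"
    by (intro tendsto_ln) auto
  moreover have "\<forall>\<^sub>F s in at s0 within S. ln (geodesic_dist S A g s s0 / coordinate_norm c s0 s)
      = ln (geodesic_dist S A g s s0) - ln (coordinate_norm c s0 s)"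
    using eventually_coordinate_norm_pos[OF c] order_tendstoD(1)[OF lim zero_less_one]
    by eventually_elim (simp add: zero_less_divide_iff ln_div)
  ultimately have "((\<lambda>s. ln (geodesic_dist S A g s s0) - ln (coordinate_norm c s0 s)) \<longlongrightarrow> ln 1) (at s0 within S)"
    by (rule Lim_transform_eventually)
  then show ?thesis by simp
qed

text \<open>A surface has no isolated points because the plane has none. This makes limits at \<open>s0\<close> unique, as
  needed to evaluate \<open>Lim\<close>.\<close>

lemma at_within_surface_nontrivial:
  assumes "s0 \<in> S"
  shows "at s0 within S \<noteq> bot"
proof
  assume bot: "at s0 within S = bot"
  obtain c where c: "c \<in> A" "s0 \<in> fst c" using exists_chart[OF assms] by blast
  from chart_limit(3)[OF c] show False unfolding bot by (simp add: filterlim_def bot.extremum_unique filtermap_bot_iff)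
qed

text \<open>Boundedness of \<open>\<psi> - ln d / (2 pi)\<close> is the same as boundedness of \<open>\<psi> - ln N / (2 pi)\<close>, since \<open>d / N\<close>
  tends to \<open>1\<close>. As there are only finitely many vortices, \<open>\<psi>\<close> is harmonic in a punctured
  neighbourhood of \<open>s0\<close>.\<close>

theorem stream_function_coordinate_limit:
  assumes g: "riemannian_metric A g" and c: "c \<in> A" "s0 \<in> fst c"
    and \<psi>: "unit_vortex_stream_function S A g s0 \<psi>"
  shows "\<exists>l. ((\<lambda>s. \<psi> s - ln (coordinate_norm c s0 s) / (2 * pi)) \<longlongrightarrow> l) (at s0 within S)"
proof -
  let ?W = "snd c ` fst c" and ?x0 = "snd c s0" and ?i = "inv_into (fst c) (snd c)"
  define G where "G = chart_repr c (g c)"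
  define f where "f = chart_repr c \<psi>"
  have Gx: "G (snd c p) = g c p" and fx: "f (snd c p) = \<psi> p" if "p \<in> fst c" for p
    using chart_inv[OF c(1) that] by (simp_all add: G_def f_def chart_repr_def)
  obtain V where V: "finite V" and harm: "harmonic_on A g (S - V) \<psi>"
    and bfun: "Bfun (\<lambda>s. \<psi> s - ln (geodesic_dist S A g s s0) / (2 * pi)) (at s0 within S)"
    using \<psi> unfolding unit_vortex_stream_function_def by blast
  obtain K where K: "\<forall>\<^sub>F s in at s0 within S. norm (\<psi> s - ln (geodesic_dist S A g s s0) / (2 * pi)) \<le> K"
    using bfun by (rule BfunE)
  have "\<forall>\<^sub>F s in at s0 within S. \<bar>ln (geodesic_dist S A g s s0) - ln (coordinate_norm c s0 s)\<bar> < 1"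
    using tendstoD[OF ln_dist_coordinate_norm[OF c] zero_less_one] by (simp add: dist_real_def)
  with K have "\<forall>\<^sub>F s in at s0 within S. \<bar>\<psi> s - ln (coordinate_norm c s0 s) / (2 * pi)\<bar> \<le> K + 1"
  proof eventually_elim
    case (elim s)
    let ?d = "ln (geodesic_dist S A g s s0)" and ?n = "ln (coordinate_norm c s0 s)"
    have "\<bar>(?d - ?n) / (2 * pi)\<bar> \<le> 1"
      using elim(2) pi_ge_two by (simp add: abs_divide divide_le_eq)
    moreover have "\<psi> s - ?n / (2 * pi) = (\<psi> s - ?d / (2 * pi)) + (?d - ?n) / (2 * pi)"
      by (simp add: diff_divide_distrib)
    ultimately show ?case using elim(1) by (simp only: real_norm_def)
  qed
  then have "\<forall>\<^sub>F y in at ?x0. \<bar>\<psi> (?i y) - ln (coordinate_norm c s0 (?i y)) / (2 * pi)\<bar> \<le> K + 1"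
    using chart_limit(3)[OF c] by (rule eventually_compose_filterlim)
  then obtain U' where U': "open U'" "?x0 \<in> U'"
    "\<And>y. y \<in> U' \<Longrightarrow> y \<noteq> ?x0 \<Longrightarrow> \<bar>\<psi> (?i y) - ln (coordinate_norm c s0 (?i y)) / (2 * pi)\<bar> \<le> K + 1"
    unfolding eventually_at_topological by blast
  \<comment> \<open>The other vortices in the chart are removed.\<close>
  define U where "U = ?W \<inter> U' - snd c ` (V \<inter> fst c - {s0})"
  have oU: "open U" unfolding U_def
    using chart(3)[OF c(1)] U'(1) V by (intro open_Diff open_Int finite_imp_closed finite_imageI) auto
  have x0U: "?x0 \<in> U"
    unfolding U_def using U'(2) c(2) inj_onD[OF chart(6)[OF c(1)], of s0] by blast
  have UW: "U \<subseteq> ?W" by (auto simp: U_def)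
  have sub: "U - {?x0} \<subseteq> snd c ` (fst c \<inter> (S - V))"
    using chart(2)[OF c(1)] unfolding U_def by blast
  have GC: "Ck_on 1 G U"
    using g c(1) UW unfolding riemannian_metric_def smooth_on_def G_def by (blast intro: Ck_on_subset)
  have fC: "Ck_on 2 f (U - {?x0})"
    using harm c(1) sub unfolding harmonic_on_def f_def by (blast intro: Ck_on_subset)
  have lap: "laplace_beltrami_coord G f x = 0" if "x \<in> U - {?x0}" for x
    using harm c(1) sub that unfolding harmonic_on_def f_def G_def by blast
  have G_metric: "transpose (G x) = G x" "v \<noteq> 0 \<Longrightarrow> v \<bullet> (G x *v v) > 0" if xU: "x \<in> U" for x v
  proof -
    obtain p where p: "p \<in> fst c" "x = snd c p" using UW xU by blast
    show "transpose (G x) = G x" "v \<noteq> 0 \<Longrightarrow> v \<bullet> (G x *v v) > 0"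
      using g_sym[OF c(1) p(1)] g_pos[OF c(1) p(1)] by (simp_all add: p Gx)
  qed
  have bd: "\<bar>f x - 1 / (2 * pi) * ln (sqrt ((x - ?x0) \<bullet> (G ?x0 *v (x - ?x0))))\<bar> \<le> K + 1"
    if xU: "x \<in> U - {?x0}" for x
  proof -
    obtain p where p: "p \<in> fst c" "x = snd c p" using UW xU by blast
    have "x \<in> U'" "x \<noteq> ?x0" using xU by (auto simp: U_def)
    from U'(3)[OF this] show ?thesis
      by (simp add: p fx Gx[OF c(2)] chart_inv[OF c(1) p(1)] coordinate_norm_def)
  qed
  obtain l where l: "((\<lambda>x. f x - 1 / (2 * pi) * ln (sqrt ((x - ?x0) \<bullet> (G ?x0 *v (x - ?x0))))) \<longlongrightarrow> l) (at ?x0)"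
    using harmonic_logarithmic_singularity_limit[OF oU x0U GC G_metric fC lap bd] by blast
  from filterlim_compose[OF l chart_limit(1)[OF c]]
  have "((\<lambda>s. f (snd c s) - ln (coordinate_norm c s0 s) / (2 * pi)) \<longlongrightarrow> l) (at s0 within S)"
    by (simp add: Gx[OF c(2)] coordinate_norm_def)
  moreover have "\<forall>\<^sub>F s in at s0 within S. f (snd c s) - ln (coordinate_norm c s0 s) / (2 * pi)
      = \<psi> s - ln (coordinate_norm c s0 s) / (2 * pi)"
    using chart_limit(2)[OF c] by eventually_elim (simp add: fx)
  ultimately have "((\<lambda>s. \<psi> s - ln (coordinate_norm c s0 s) / (2 * pi)) \<longlongrightarrow> l) (at s0 within S)"
    by (rule Lim_transform_eventually)
  then show ?thesis ..
qed

lemma coordinate_norm_to_dist: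
  assumes c: "c \<in> A" "s0 \<in> fst c"
    and l: "((\<lambda>s. \<psi> s - ln (coordinate_norm c s0 s) / (2 * pi)) \<longlongrightarrow> l) (at s0 within S)"
  shows "((\<lambda>s. \<psi> s - ln (geodesic_dist S A g s s0) / (2 * pi)) \<longlongrightarrow> l) (at s0 within S)"
proof -
  have "((\<lambda>s. (\<psi> s - ln (coordinate_norm c s0 s) / (2 * pi)) -
      (ln (geodesic_dist S A g s s0) - ln (coordinate_norm c s0 s)) / (2 * pi)) \<longlongrightarrow> l - 0 / (2 * pi)) (at s0 within S)"
    by (intro tendsto_diff l tendsto_divide ln_dist_coordinate_norm[OF c] tendsto_const) simp
  then show ?thesis by (simp add: diff_divide_distrib)
qed

end

theorem proposition2:
  fixes S :: "'a::t2_space set" and A :: "'a chart set" and g :: "'a metric_field"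
    and h \<psi> :: "'a \<Rightarrow> real" and s\<^sub>o :: 'a
  assumes "closed_oriented_surface S A"
    and "riemannian_metric A g"
    and "smooth_function A h" and "\<forall>s\<in>S. h s > 0"
    and "s\<^sub>o \<in> S"
    and "unit_vortex_stream_function S A g s\<^sub>o \<psi>"
  shows "((\<lambda>s. \<psi> s - ln (geodesic_dist S A g s s\<^sub>o) / (2 * pi))
            \<longlongrightarrow> regularized_stream_function S A g s\<^sub>o \<psi>) (at s\<^sub>o within S)
       \<and> ((\<lambda>s. \<psi> s - ln (geodesic_dist S A (conformal_metric h g) s s\<^sub>o) / (2 * pi))
            \<longlongrightarrow> regularized_stream_function S A (conformal_metric h g) s\<^sub>o \<psi>) (at s\<^sub>o within S)
       \<and> regularized_stream_function S A (conformal_metric h g) s\<^sub>o \<psi>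
           = regularized_stream_function S A g s\<^sub>o \<psi> - ln (h s\<^sub>o) / (2 * pi)"
proof -
  have surf: "oriented_surface S A" using assms(1) by (simp add: closed_oriented_surface_def)
  interpret g: continuous_metric_surface S A g
    by (rule riemannian_metric_continuous_metric_surface[OF surf assms(2)])
  interpret hg: continuous_metric_surface S A "conformal_metric h g"
    by (rule g.conformal_change[OF assms(3)]) (use assms(4) in blast)
  obtain c where c: "c \<in> A" "s\<^sub>o \<in> fst c" using g.exists_chart[OF assms(5)] by blast
  have h: "0 < h s\<^sub>o" using assms(4,5) by blast
  obtain l where l: "((\<lambda>s. \<psi> s - ln (g.coordinate_norm c s\<^sub>o s) / (2 * pi)) \<longlongrightarrow> l) (at s\<^sub>o within S)"
    using g.stream_function_coordinate_limit[OF assms(2) c assms(6)] by blast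
  have norm_eq: "hg.coordinate_norm c s\<^sub>o s = h s\<^sub>o * g.coordinate_norm c s\<^sub>o s" for s
  proof -
    have "conformal_metric h g c s\<^sub>o = (h s\<^sub>o)\<^sup>2 *\<^sub>R g c s\<^sub>o" by (simp add: conformal_metric_def)
    then show ?thesis
      using h unfolding hg.coordinate_norm_def g.coordinate_norm_def
      by (simp add: real_sqrt_mult flip: scaleR_matrix_vector_assoc)
  qed
  have "((\<lambda>s. (\<psi> s - ln (g.coordinate_norm c s\<^sub>o s) / (2 * pi)) - ln (h s\<^sub>o) / (2 * pi))
      \<longlongrightarrow> l - ln (h s\<^sub>o) / (2 * pi)) (at s\<^sub>o within S)"
    by (intro tendsto_diff l tendsto_const)
  moreover have "\<forall>\<^sub>F s in at s\<^sub>o within S. (\<psi> s - ln (g.coordinate_norm c s\<^sub>o s) / (2 * pi)) - ln (h s\<^sub>o) / (2 * pi)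
      = \<psi> s - ln (hg.coordinate_norm c s\<^sub>o s) / (2 * pi)"
    using g.eventually_coordinate_norm_pos[OF c]
    by eventually_elim (use h in \<open>simp add: norm_eq ln_mult add_divide_distrib\<close>)
  ultimately have "((\<lambda>s. \<psi> s - ln (hg.coordinate_norm c s\<^sub>o s) / (2 * pi))
      \<longlongrightarrow> l - ln (h s\<^sub>o) / (2 * pi)) (at s\<^sub>o within S)"
    by (rule Lim_transform_eventually)
  note lim_hg = hg.coordinate_norm_to_dist[OF c this]
  note lim_g = g.coordinate_norm_to_dist[OF c l]
  note nt = g.at_within_surface_nontrivial[OF assms(5)]
  have "regularized_stream_function S A g s\<^sub>o \<psi> = l"
    "regularized_stream_function S A (conformal_metric h g) s\<^sub>o \<psi> = l - ln (h s\<^sub>o) / (2 * pi)"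
    unfolding regularized_stream_function_def
    by (rule tendsto_Lim[OF nt lim_g], rule tendsto_Lim[OF nt lim_hg])
  with lim_g lim_hg show ?thesis by simp
qed

end
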